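(* Let $\Gamma$ be a finite connected graph and let $v$ be a maximal vertex of $\Gamma$. Let $G \leq \mathrm{Out}(A_\Gamma)$ be generated by $T=G\cap\mathcal{S}_\Gamma$, and let $G^0$ be the subgroup of $G$ generated by the extended partial conjugations, inversions and transvections in $T$. Then, under the projection homomorphism $P_v$, the group $P_v(G^0)\leq \mathrm{Out}(A_{lk[v]})$ is generated by a subset of $\mathcal{S}_{lk[v]}$, and $d_{SL}(P_v(G^0))\leq d_{SL}(G)=d_{SL}(G^0)$.
   Context: $\Gamma$ is a finite simple graph with vertices $v_1,\dots,v_n$; $A_\Gamma$ is generated by the vertices, with relations $[v,w]=1$ for $v,w$ adjacent. For a full subgraph $\Gamma'$, $A_{\Gamma'}$ is viewed as the subgroup of $A_\Gamma$ generated by $V(\Gamma')$. $lk(v)$ is the set of vertices adjacent to $v$, $st(v)=lk(v)\cup\{v\}$; for a full subgraph $\Gamma'$, $lk(\Gamma')=\bigcap_{w\in\Gamma'}lk(w)$ and $st(\Gamma')=\Gamma'\cup lk(\Gamma')$. Subsets of vertices are identified with the full subgraphs they span. The set $\mathcal{S}_\Gamma\subset \mathrm{Out}(A_\Gamma)$ consists of the classes of the following automorphisms: - graph symmetries: automorphisms induced by graph automorphisms of $\Gamma$; - inversions $s_i$: $v_i\mapsto v_i^{-1}$, fixing all other vertices; - transvections $\rho_{ij}$ ($i\ne j$), defined when $lk(v_i)\subset st(v_j)$: $v_i\mapsto v_iv_j$, fixing all other vertices; - extended partial conjugations: products $\prod_{t\in T_0}K_{tj}$, where $T_0$ is a set of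 vertices of $\Gamma- st(v_j)$, no two in the same connected component of $\Gamma-st(v_j)$. Here, for $v_i\notin st(v_j)$, the partial conjugation $K_{ij}$ sends $v_k\mapsto v_jv_kv_j^{-1}$ for every vertex $v_k$ in the connected component of $\Gamma-st(v_j)$ containing $v_i$, and fixes all other vertices. $\mathrm{Out}^0(A_\Gamma)$ is the subgroup generated by inversions, partial conjugations and transvections. For $G\le \mathrm{Out}(A_\Gamma)$ define a preorder on $V(\Gamma)$ by $v_i\le_G v_j$ if $i=j$ or $[\rho_{ij}]\in G$, and let $\sim_G$ be the induced equivalence relation. For each class $[v]_G$ the subgroup $A_{[v]_G}$ is either free abelian (the class is called abelian) or free non-abelian. $d_{SL}(G)$ is the number of vertices in the largest abelian equivalence class of $\sim_G$, and is $1$ if there are none. The same definitions apply to subgroups of $\mathrm{Out}(A_{\Gamma'})$ for a full subgraph $\Gamma'$, with $\mathcal{S}_{\Gamma'}$ and transvections of $A_{\Gamma'}$. The standard preorder on $V(\Gamma)$ is $u\le w$ iff $lk(u)\subset st(w)$; $[v]$ is the equivalence class of $v$ for this preorder, and $v$ is maximal if $[v]$ is maximal in the induced partial order on classes. When $\Gamma$ is connected and $v$ is maximal, every element of $\mathrm{Out}^0(A_\Gamma)$ has a representative $\psi\in\mathrm{Aut}(A_\Gamma)$ preserving $A_{st[v]}=A_{[v]}\times A_{lk[v]}$ and such that $\psi|_{A_{st[v]}}$ preserves the normal subgroup $A_{[v]}$; the projection homomorphism $P_v:\mathrm{Out}^0(A_\Gamma)\to\mathrm{Out}(A_{lk[v]})$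 sends the element to the class of the automorphism of $A_{st[v]}/A_{[v]}\cong A_{lk[v]}$ induced by $\psi$ (this is well defined). *)

theory Defs
  imports
    "Graph_Theory.Digraph_Component"
    "HOL-Algebra.Bij"
    "HOL-Algebra.Generated_Groups"
    "HOL-Algebra.Free_Abelian_Groups"
begin

section \<open>Links, stars and the standard preorder\<close>

text \<open>Finite simple graphs are the \<^locale>\<open>graph\<close>s of the Graph Theory library: every undirected
  edge is a pair of opposite arcs. Full subgraphs are \<open>\<Gamma> \<restriction> U\<close>.\<close>

definition link :: "('v, 'e) pre_digraph \<Rightarrow> 'v \<Rightarrow> 'v set" where
  "link \<Gamma> v = {w \<in> verts \<Gamma>. v \<rightarrow>\<^bsub>\<Gamma>\<^esub> w}"

definition star :: "('v, 'e) pre_digraph \<Rightarrow> 'v \<Rightarrow> 'v set" where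
  "star \<Gamma> v = insert v (link \<Gamma> v)"

definition link_set :: "('v, 'e) pre_digraph \<Rightarrow> 'v set \<Rightarrow> 'v set" where
  "link_set \<Gamma> U = verts \<Gamma> \<inter> (\<Inter>w\<in>U. link \<Gamma> w)"

definition star_set :: "('v, 'e) pre_digraph \<Rightarrow> 'v set \<Rightarrow> 'v set" where
  "star_set \<Gamma> U = U \<union> link_set \<Gamma> U"

definition std_le :: "('v, 'e) pre_digraph \<Rightarrow> 'v \<Rightarrow> 'v \<Rightarrow> bool" where
  "std_le \<Gamma> u w \<longleftrightarrow> link \<Gamma> u \<subseteq> star \<Gamma> w"

definition std_class :: "('v, 'e) pre_digraph \<Rightarrow> 'v \<Rightarrow> 'v set" where
  "std_class \<Gamma> v = {w \<in> verts \<Gamma>. std_le \<Gamma> v w \<and> std_le \<Gamma> w v}"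

definition maximal_vertex :: "('v, 'e) pre_digraph \<Rightarrow> 'v \<Rightarrow> bool" where
  "maximal_vertex \<Gamma> v \<longleftrightarrow>
     v \<in> verts \<Gamma> \<and> (\<forall>w\<in>verts \<Gamma>. std_le \<Gamma> v w \<longrightarrow> std_le \<Gamma> w v)"


section \<open>The group \<open>A\<^sub>\<Gamma>\<close>\<close>

text \<open>Elements of \<open>A\<^sub>\<Gamma>\<close> are classes of words; the letter \<open>(v, True)\<close> stands for \<open>v\<close> and
  \<open>(v, False)\<close> for its inverse.\<close>

definition words :: "('v, 'e) pre_digraph \<Rightarrow> ('v \<times> bool) list set" where
  "words \<Gamma> = lists (verts \<Gamma> \<times> UNIV)"

inductive raag_eq :: "('v, 'e) pre_digraph \<Rightarrow> ('v \<times> bool) list \<Rightarrow> ('v \<times> bool) list \<Rightarrow> bool"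
  for \<Gamma> where
  refl: "x \<in> words \<Gamma> \<Longrightarrow> raag_eq \<Gamma> x x"
| sym: "raag_eq \<Gamma> x y \<Longrightarrow> raag_eq \<Gamma> y x"
| trans: "raag_eq \<Gamma> x y \<Longrightarrow> raag_eq \<Gamma> y z \<Longrightarrow> raag_eq \<Gamma> x z"
| append: "raag_eq \<Gamma> x x' \<Longrightarrow> raag_eq \<Gamma> y y' \<Longrightarrow> raag_eq \<Gamma> (x @ y) (x' @ y')"
| cancel: "v \<in> verts \<Gamma> \<Longrightarrow> raag_eq \<Gamma> [(v, b), (v, \<not> b)] []"
| commute: "v \<in> verts \<Gamma> \<Longrightarrow> w \<in> verts \<Gamma> \<Longrightarrow> v \<rightarrow>\<^bsub>\<Gamma>\<^esub> w \<Longrightarrow>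
    raag_eq \<Gamma> [(v, True), (w, True)] [(w, True), (v, True)]"

definition raag_rel ::
    "('v, 'e) pre_digraph \<Rightarrow> (('v \<times> bool) list \<times> ('v \<times> bool) list) set" where
  "raag_rel \<Gamma> = {(x, y). raag_eq \<Gamma> x y}"

definition raag :: "('v, 'e) pre_digraph \<Rightarrow> ('v \<times> bool) list set monoid" where
  "raag \<Gamma> =
     \<lparr> carrier = words \<Gamma> // raag_rel \<Gamma>,
       mult = (\<lambda>X Y. \<Union>x\<in>X. \<Union>y\<in>Y. raag_rel \<Gamma> `` {x @ y}),
       one = raag_rel \<Gamma> `` {[]} \<rparr>"

definition gen :: "('v, 'e) pre_digraph \<Rightarrow> 'v \<Rightarrow> ('v \<times> bool) list set" where
  "gen \<Gamma> v = raag_rel \<Gamma> `` {[(v, True)]}"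

definition raag_sub :: "('v, 'e) pre_digraph \<Rightarrow> 'v set \<Rightarrow> ('v \<times> bool) list set monoid" where
  "raag_sub \<Gamma> U = subgroup_generated (raag \<Gamma>) (gen \<Gamma> ` U)"

text \<open>The canonical embedding \<open>A\<^sub>\<Delta> \<rightarrow> A\<^sub>\<Gamma>\<close> for a full subgraph \<open>\<Delta>\<close> of \<open>\<Gamma>\<close>, with image
  \<open>raag_sub \<Gamma> (verts \<Delta>)\<close>: the class of a word in \<open>A\<^sub>\<Delta>\<close> goes to its class in \<open>A\<^sub>\<Gamma>\<close>.\<close>

definition raag_emb ::
    "('v, 'e) pre_digraph \<Rightarrow> ('v \<times> bool) list set \<Rightarrow> ('v \<times> bool) list set" where
  "raag_emb \<Gamma> X = raag_rel \<Gamma> `` X"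


section \<open>Outer automorphism groups\<close>

definition Inn :: "('a, 'b) monoid_scheme \<Rightarrow> ('a \<Rightarrow> 'a) set" where
  "Inn A = {(\<lambda>x\<in>carrier A. g \<otimes>\<^bsub>A\<^esub> x \<otimes>\<^bsub>A\<^esub> inv\<^bsub>A\<^esub> g) | g. g \<in> carrier A}"

definition Out :: "('a, 'b) monoid_scheme \<Rightarrow> ('a \<Rightarrow> 'a) set monoid" where
  "Out A = AutoGroup A Mod Inn A"

definition out_class :: "('a, 'b) monoid_scheme \<Rightarrow> ('a \<Rightarrow> 'a) \<Rightarrow> ('a \<Rightarrow> 'a) set" where
  "out_class A \<phi> = Inn A #>\<^bsub>AutoGroup A\<^esub> \<phi>"


section \<open>The generators\<close>

text \<open>The automorphism with prescribed images of the vertices; meaningful only if there is one, in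
  which case it is unique since elements of \<^const>\<open>auto\<close> are extensional.\<close>

definition raag_aut ::
    "('v, 'e) pre_digraph \<Rightarrow> ('v \<Rightarrow> ('v \<times> bool) list set)
      \<Rightarrow> (('v \<times> bool) list set \<Rightarrow> ('v \<times> bool) list set)" where
  "raag_aut \<Gamma> f = (THE \<phi>. \<phi> \<in> auto (raag \<Gamma>) \<and> (\<forall>k\<in>verts \<Gamma>. \<phi> (gen \<Gamma> k) = f k))"

definition graph_automorphism :: "('v, 'e) pre_digraph \<Rightarrow> ('v \<Rightarrow> 'v) \<Rightarrow> bool" where
  "graph_automorphism \<Gamma> \<sigma> \<longleftrightarrow> bij_betw \<sigma> (verts \<Gamma>) (verts \<Gamma>) \<and>
     (\<forall>u\<in>verts \<Gamma>. \<forall>w\<in>verts \<Gamma>. u \<rightarrow>\<^bsub>\<Gamma>\<^esub> w \<longleftrightarrow> \<sigma> u \<rightarrow>\<^bsub>\<Gamma>\<^esub> \<sigma> w)"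

definition graph_symmetry where
  "graph_symmetry \<Gamma> \<sigma> = raag_aut \<Gamma> (\<lambda>k. gen \<Gamma> (\<sigma> k))"

definition inversion where
  "inversion \<Gamma> i =
     raag_aut \<Gamma> (\<lambda>k. if k = i then inv\<^bsub>raag \<Gamma>\<^esub> gen \<Gamma> k else gen \<Gamma> k)"

definition transvection where
  "transvection \<Gamma> i j =
     raag_aut \<Gamma> (\<lambda>k. if k = i then gen \<Gamma> i \<otimes>\<^bsub>raag \<Gamma>\<^esub> gen \<Gamma> j else gen \<Gamma> k)"

definition transvection_defined :: "('v, 'e) pre_digraph \<Rightarrow> 'v \<Rightarrow> 'v \<Rightarrow> bool" where
  "transvection_defined \<Gamma> i j \<longleftrightarrow>
     i \<in> verts \<Gamma> \<and> j \<in> verts \<Gamma> \<and> i \<noteq> j \<and> link \<Gamma> i \<subseteq> star \<Gamma> j"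

definition same_component :: "('v, 'e) pre_digraph \<Rightarrow> 'v \<Rightarrow> 'v \<Rightarrow> 'v \<Rightarrow> bool" where
  "same_component \<Gamma> j s t \<longleftrightarrow> s \<rightarrow>\<^sup>*\<^bsub>\<Gamma> \<restriction> (verts \<Gamma> - star \<Gamma> j)\<^esub> t"

definition partial_conjugation where
  "partial_conjugation \<Gamma> i j =
     raag_aut \<Gamma> (\<lambda>k. if same_component \<Gamma> j i k
       then gen \<Gamma> j \<otimes>\<^bsub>raag \<Gamma>\<^esub> gen \<Gamma> k \<otimes>\<^bsub>raag \<Gamma>\<^esub> inv\<^bsub>raag \<Gamma>\<^esub> gen \<Gamma> j
       else gen \<Gamma> k)"

definition graph_symmetries where
  "graph_symmetries \<Gamma> = {graph_symmetry \<Gamma> \<sigma> | \<sigma>. graph_automorphism \<Gamma> \<sigma>}"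

definition inversions where
  "inversions \<Gamma> = {inversion \<Gamma> i | i. i \<in> verts \<Gamma>}"

definition transvections where
  "transvections \<Gamma> = {transvection \<Gamma> i j | i j. transvection_defined \<Gamma> i j}"

definition partial_conjugations where
  "partial_conjugations \<Gamma> =
     {partial_conjugation \<Gamma> i j | i j. j \<in> verts \<Gamma> \<and> i \<in> verts \<Gamma> - star \<Gamma> j}"

text \<open>The set \<open>T\<^sub>0\<close> is enumerated by the list \<open>ts\<close>; the factors commute, so the order
  is irrelevant.\<close>

definition ext_partial_conjugations where
  "ext_partial_conjugations \<Gamma> =
     {foldr (\<lambda>t \<phi>. partial_conjugation \<Gamma> t j \<otimes>\<^bsub>AutoGroup (raag \<Gamma>)\<^esub> \<phi>) ts
        \<one>\<^bsub>AutoGroup (raag \<Gamma>)\<^esub> | j ts.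
      j \<in> verts \<Gamma> \<and> distinct ts \<and> set ts \<subseteq> verts \<Gamma> - star \<Gamma> j \<and>
      (\<forall>s\<in>set ts. \<forall>t\<in>set ts. s \<noteq> t \<longrightarrow> \<not> same_component \<Gamma> j s t)}"

definition S_set where
  "S_set \<Gamma> = out_class (raag \<Gamma>) `
     (graph_symmetries \<Gamma> \<union> inversions \<Gamma> \<union> transvections \<Gamma> \<union> ext_partial_conjugations \<Gamma>)"

definition S0_set where
  "S0_set \<Gamma> = out_class (raag \<Gamma>) `
     (ext_partial_conjugations \<Gamma> \<union> inversions \<Gamma> \<union> transvections \<Gamma>)"

definition Out0 where
  "Out0 \<Gamma> = generate (Out (raag \<Gamma>))
     (out_class (raag \<Gamma>) ` (inversions \<Gamma> \<union> partial_conjugations \<Gamma> \<union> transvections \<Gamma>))"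


section \<open>The preorder of a subgroup and \<open>d\<^sub>S\<^sub>L\<close>\<close>

definition G_le where
  "G_le \<Gamma> G i j \<longleftrightarrow>
     i = j \<or> (transvection_defined \<Gamma> i j \<and> out_class (raag \<Gamma>) (transvection \<Gamma> i j) \<in> G)"

definition G_class where
  "G_class \<Gamma> G v = {w \<in> verts \<Gamma>. G_le \<Gamma> G v w \<and> G_le \<Gamma> G w v}"

text \<open>The basis \<open>B\<close> may be taken in the vertex type, because \<open>A\<^sub>C\<close> free abelian has
  rank \<open>card C\<close>.\<close>

definition abelian_class :: "('v, 'e) pre_digraph \<Rightarrow> 'v set \<Rightarrow> bool" where
  "abelian_class \<Gamma> C \<longleftrightarrow> (\<exists>B :: 'v set. raag_sub \<Gamma> C \<cong> free_Abelian_group B)"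

definition d_SL where
  "d_SL \<Gamma> G =
     (let \<C> = {C \<in> G_class \<Gamma> G ` verts \<Gamma>. abelian_class \<Gamma> C}
      in if \<C> = {} then 1 else Max (card ` \<C>))"


section \<open>The projection homomorphism\<close>

text \<open>\<open>\<psi> ` C\<close> is the image of the coset \<open>C\<close> under the automorphism of \<open>A\<^sub>s\<^sub>t\<^sub>[\<^sub>v\<^sub>] / A\<^sub>[\<^sub>v\<^sub>]\<close> induced
  by \<open>\<psi>\<close>, and the isomorphism \<open>A\<^sub>l\<^sub>k\<^sub>[\<^sub>v\<^sub>] \<cong> A\<^sub>s\<^sub>t\<^sub>[\<^sub>v\<^sub>] / A\<^sub>[\<^sub>v\<^sub>]\<close> sends \<open>g\<close> to \<open>A\<^sub>[\<^sub>v\<^sub>] g\<close>.\<close>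

definition induces_on_link where
  "induces_on_link \<Gamma> v \<psi> \<theta> \<longleftrightarrow>
     (let L = \<Gamma> \<restriction> link_set \<Gamma> (std_class \<Gamma> v);
          N = carrier (raag_sub \<Gamma> (std_class \<Gamma> v));
          H = carrier (raag_sub \<Gamma> (star_set \<Gamma> (std_class \<Gamma> v)))
      in \<psi> ` H = H \<and> \<psi> ` N = N \<and> \<theta> \<in> auto (raag L) \<and>
         (\<forall>g\<in>carrier (raag L).
            \<psi> ` (N #>\<^bsub>raag \<Gamma>\<^esub> raag_emb \<Gamma> g) = N #>\<^bsub>raag \<Gamma>\<^esub> raag_emb \<Gamma> (\<theta> g)))"

definition projection where
  "projection \<Gamma> v = (\<lambda>\<Phi>\<in>Out0 \<Gamma>. THE \<Psi>. \<exists>\<psi>\<in>\<Phi>. \<exists>\<theta>. induces_on_link \<Gamma> v \<psi> \<theta> \<and>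
     \<Psi> = out_class (raag (\<Gamma> \<restriction> link_set \<Gamma> (std_class \<Gamma> v))) \<theta>)"

end

theory Submission
  imports Defs
begin

text \<open>
  If \<open>\<psi>\<close> preserves \<open>A\<^sub>s\<^sub>t\<^sub>[\<^sub>v\<^sub>]\<close> and \<open>A\<^sub>[\<^sub>v\<^sub>]\<close>, the automorphism it induces on \<open>A\<^sub>l\<^sub>k\<^sub>[\<^sub>v\<^sub>]\<close> is
  \<open>r \<circ> \<psi>\<close>, where \<open>r: A\<^sub>\<Gamma> \<rightarrow> A\<^sub>l\<^sub>k\<^sub>[\<^sub>v\<^sub>]\<close> is the retraction killing the other vertices. Replacing \<open>\<psi>\<close>
  by its composite with conjugation by \<open>g\<close> changes \<open>r \<circ> \<psi>\<close> by conjugation by \<open>r(g)\<close>, so \<open>P\<^sub>v\<close> is a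
  well-defined homomorphism without any appeal to normal forms or normalizers. It sends an
  inversion, a transvection or an extended partial conjugation to one of the same kind or to the
  identity; for a partial conjugation by \<open>j\<close> outside \<open>st[v]\<close> this holds because maximality of \<open>v\<close>
  forces \<open>st[v] - st(j)\<close> into a single component of \<open>\<Gamma> - st(j)\<close>.

  For \<open>d\<^sub>S\<^sub>L\<close>, the generators of \<open>P\<^sub>v(G\<^sup>0)\<close> act on the abelianization of \<open>A\<^sub>l\<^sub>k\<^sub>[\<^sub>v\<^sub>]\<close> by matrices whose
  nonzero entries \<open>(i, j)\<close> satisfy \<open>i \<le>\<^sub>G j\<close>. Since \<open>\<le>\<^sub>G\<close> is transitive, so does every element of
  \<open>P\<^sub>v(G\<^sup>0)\<close>; hence a transvection \<open>\<rho>\<^sub>i\<^sub>j\<close> in \<open>P\<^sub>v(G\<^sup>0)\<close> forces \<open>i \<le>\<^sub>G j\<close>, and the classes of \<open>P\<^sub>v(G\<^sup>0)\<close>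
  are contained in classes of \<open>G\<close>. A class with two adjacent vertices is a clique, so it is
  abelian.
\<close>

subsection \<open>The universal property of \<open>A\<^sub>\<Gamma>\<close>\<close>

text \<open>The family of generators has to be stable under restriction. If \<open>j\<close> lies in
  lk[v], one component of \<Gamma> - st(j) can meet lk[v] in several components of lk[v] - st(j), so
  a partial conjugation may project to a product of several of them. The extended ones are stable,
  because a set closed under adjacency outside st(j) stays so after intersection with lk[v].
  Generators that die cause no trouble either: the identity is a graph symmetry.

  The obstacle for \<open>d_SL\<close> is that a transvection in the image need not come from a
  transvection in T; it may arise from a long product. An invariant of arbitrary products is
  therefore needed, and the support of the matrix is one as soon as the relation is transitive.
  Transitivity of \<le>_G rests on the Steinberg relation between transvections. Finally, a class of
  the image that lies in a class of G gives a bound only if the larger class is abelian as well. An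
  edge in the smaller class settles this, and classes without an edge are covered by the bound 1
  \<le> \<open>d_SL\<close>.\<close>

lemma raag_eq_words:
  "raag_eq \<Gamma> x y \<Longrightarrow> x \<in> words \<Gamma> \<and> y \<in> words \<Gamma>"
  by (induction rule: raag_eq.induct) (auto simp: words_def)

lemma equiv_raag_rel: "equiv (words \<Gamma>) (raag_rel \<Gamma>)"
  unfolding equiv_def
proof (intro conjI)
  show "refl_on (words \<Gamma>) (raag_rel \<Gamma>)"
    by (auto simp: refl_on_def raag_rel_def intro: raag_eq.refl)
  show "sym (raag_rel \<Gamma>)"
    by (auto simp: sym_def raag_rel_def intro: raag_eq.sym)
  show "trans (raag_rel \<Gamma>)"
    by (auto simp: trans_def raag_rel_def intro: raag_eq.trans)
  show "raag_rel \<Gamma> \<subseteq> words \<Gamma> \<times> words \<Gamma>"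
    by (auto simp: raag_rel_def dest: raag_eq_words)
qed

definition word_class :: "('v, 'e) pre_digraph \<Rightarrow> ('v \<times> bool) list \<Rightarrow> ('v \<times> bool) list set" where
  "word_class \<Gamma> w = raag_rel \<Gamma> `` {w}"

lemma word_class_eq_iff:
  assumes "x \<in> words \<Gamma>" "y \<in> words \<Gamma>"
  shows "word_class \<Gamma> x = word_class \<Gamma> y \<longleftrightarrow> raag_eq \<Gamma> x y"
  using eq_equiv_class_iff[OF equiv_raag_rel, of x \<Gamma> y] assms
  by (simp add: word_class_def) (simp add: raag_rel_def)

lemma carrier_raag: "carrier (raag \<Gamma>) = word_class \<Gamma> ` words \<Gamma>"
  by (auto simp: raag_def quotient_def word_class_def)

lemma words_append [simp]: "x @ y \<in> words \<Gamma> \<longleftrightarrow> x \<in> words \<Gamma> \<and> y \<in> words \<Gamma>"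
  by (auto simp: words_def)

lemma words_Nil [simp]: "[] \<in> words \<Gamma>"
  by (auto simp: words_def)

lemma words_Cons [simp]: "(v, b) # x \<in> words \<Gamma> \<longleftrightarrow> v \<in> verts \<Gamma> \<and> x \<in> words \<Gamma>"
  by (auto simp: words_def)

lemma mult_word_class:
  assumes "x \<in> words \<Gamma>" "y \<in> words \<Gamma>"
  shows "word_class \<Gamma> x \<otimes>\<^bsub>raag \<Gamma>\<^esub> word_class \<Gamma> y = word_class \<Gamma> (x @ y)"
proof -
  have "congruent2 (raag_rel \<Gamma>) (raag_rel \<Gamma>) (\<lambda>x y. raag_rel \<Gamma> `` {x @ y})"
  proof (rule congruent2I')
    fix y1 z1 y2 z2
    assume "(y1, z1) \<in> raag_rel \<Gamma>" "(y2, z2) \<in> raag_rel \<Gamma>"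
    then have "(y1 @ y2, z1 @ z2) \<in> raag_rel \<Gamma>"
      by (auto simp: raag_rel_def intro: raag_eq.append)
    then show "raag_rel \<Gamma> `` {y1 @ y2} = raag_rel \<Gamma> `` {z1 @ z2}"
      by (rule equiv_class_eq[OF equiv_raag_rel])
  qed
  from UN_equiv_class2[OF equiv_raag_rel equiv_raag_rel this assms]
  show ?thesis by (simp add: raag_def word_class_def)
qed

lemma one_raag: "\<one>\<^bsub>raag \<Gamma>\<^esub> = word_class \<Gamma> []"
  by (simp add: raag_def word_class_def)

lemma raag_eq_cancel_Cons:
  assumes "v \<in> verts \<Gamma>" "w \<in> words \<Gamma>"
  shows "raag_eq \<Gamma> ((v, b) # (v, \<not> b) # w) w"
  using raag_eq.append[OF raag_eq.cancel[OF assms(1), of b] raag_eq.refl[OF assms(2)]] by simp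

lemma word_left_inverse:
  "x \<in> words \<Gamma> \<Longrightarrow> \<exists>y\<in>words \<Gamma>. raag_eq \<Gamma> (y @ x) []"
proof (induction x)
  case Nil
  then show ?case by (auto intro!: bexI[of _ "[]"] raag_eq.refl)
next
  case (Cons a x)
  obtain v b where a: "a = (v, b)" by (cases a)
  with Cons obtain y where y: "y \<in> words \<Gamma>" "raag_eq \<Gamma> (y @ x) []" and v: "v \<in> verts \<Gamma>" "x \<in> words \<Gamma>"
    by auto
  have "raag_eq \<Gamma> (y @ (v, \<not> b) # (v, b) # x) (y @ x)"
    using raag_eq.append[OF raag_eq.refl[OF y(1)] raag_eq_cancel_Cons[OF v, of "\<not> b"]] by simp
  then have "raag_eq \<Gamma> ((y @ [(v, \<not> b)]) @ a # x) []"
    using y(2) by (auto intro: raag_eq.trans simp: a)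
  then show ?case using y v by (intro bexI[of _ "y @ [(v, \<not> b)]"]) auto
qed

lemma group_raag: "group (raag \<Gamma>)"
proof (rule groupI)
  fix x assume "x \<in> carrier (raag \<Gamma>)"
  then obtain w where w: "w \<in> words \<Gamma>" "x = word_class \<Gamma> w" by (auto simp: carrier_raag)
  obtain y where "y \<in> words \<Gamma>" "raag_eq \<Gamma> (y @ w) []" using word_left_inverse[OF w(1)] by auto
  then show "\<exists>y\<in>carrier (raag \<Gamma>). y \<otimes>\<^bsub>raag \<Gamma>\<^esub> x = \<one>\<^bsub>raag \<Gamma>\<^esub>"
    using w by (auto simp: carrier_raag mult_word_class one_raag word_class_eq_iff intro!: bexI[of _ y])
qed (auto simp: carrier_raag mult_word_class one_raag)

lemma gen_closed [simp, intro]: "v \<in> verts \<Gamma> \<Longrightarrow> gen \<Gamma> v \<in> carrier (raag \<Gamma>)"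
  by (auto simp: gen_def carrier_raag word_class_def)

lemma gen_eq_word_class: "gen \<Gamma> v = word_class \<Gamma> [(v, True)]"
  by (simp add: gen_def word_class_def)

lemma inv_gen_eq_word_class:
  assumes "v \<in> verts \<Gamma>"
  shows "inv\<^bsub>raag \<Gamma>\<^esub> gen \<Gamma> v = word_class \<Gamma> [(v, False)]"
proof -
  interpret group "raag \<Gamma>" by (rule group_raag)
  have "word_class \<Gamma> [(v, False)] \<otimes>\<^bsub>raag \<Gamma>\<^esub> gen \<Gamma> v = \<one>\<^bsub>raag \<Gamma>\<^esub>"
    using assms raag_eq_cancel_Cons[of v \<Gamma> "[]" False]
    by (simp add: gen_eq_word_class mult_word_class one_raag word_class_eq_iff)
  then show ?thesis
    using assms gen_closed[OF assms] by (intro inv_equality) (auto simp: carrier_raag)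
qed

lemma gen_commute:
  assumes "u \<in> verts \<Gamma>" "w \<in> verts \<Gamma>" "u \<rightarrow>\<^bsub>\<Gamma>\<^esub> w"
  shows "gen \<Gamma> u \<otimes>\<^bsub>raag \<Gamma>\<^esub> gen \<Gamma> w = gen \<Gamma> w \<otimes>\<^bsub>raag \<Gamma>\<^esub> gen \<Gamma> u"
  using assms by (simp add: gen_eq_word_class mult_word_class word_class_eq_iff raag_eq.commute)

text \<open>An element is the class of a word, and a word is built by prefixing letters. All later
  checks "on generators" that are not about homomorphisms alone use this rule.\<close>

lemma raag_induct [consumes 1, case_names one gen inv_gen]:
  assumes "x \<in> carrier (raag \<Gamma>)" "P \<one>\<^bsub>raag \<Gamma>\<^esub>"
    and "\<And>v y. v \<in> verts \<Gamma> \<Longrightarrow> y \<in> carrier (raag \<Gamma>) \<Longrightarrow> P y \<Longrightarrow> P (gen \<Gamma> v \<otimes>\<^bsub>raag \<Gamma>\<^esub> y)"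
    and "\<And>v y. v \<in> verts \<Gamma> \<Longrightarrow> y \<in> carrier (raag \<Gamma>) \<Longrightarrow> P y \<Longrightarrow> P (inv\<^bsub>raag \<Gamma>\<^esub> gen \<Gamma> v \<otimes>\<^bsub>raag \<Gamma>\<^esub> y)"
  shows "P x"
proof -
  have "P (word_class \<Gamma> w)" if "w \<in> words \<Gamma>" for w
    using that
  proof (induction w)
    case Nil
    then show ?case using assms(2) by (simp add: one_raag)
  next
    case (Cons a w)
    obtain v b where a: "a = (v, b)" by (cases a)
    with Cons have v: "v \<in> verts \<Gamma>" and w: "w \<in> words \<Gamma>" and P: "P (word_class \<Gamma> w)" by auto
    have "word_class \<Gamma> w \<in> carrier (raag \<Gamma>)" using w by (simp add: carrier_raag)
    note * = assms(3)[OF v this P] assms(4)[OF v this P]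
    show ?case
      using * v w by (cases b) (simp_all add: a gen_eq_word_class inv_gen_eq_word_class[OF v, unfolded gen_eq_word_class] mult_word_class)
  qed
  then show ?thesis using assms(1) by (auto simp: carrier_raag)
qed

section \<open>Evaluation of words and the extension of vertex maps to homomorphisms\<close>

definition word_eval :: "('a, 'b) monoid_scheme \<Rightarrow> ('v \<Rightarrow> 'a) \<Rightarrow> ('v \<times> bool) list \<Rightarrow> 'a" where
  "word_eval G f w = foldr (\<lambda>(v, b) g. (if b then f v else inv\<^bsub>G\<^esub> f v) \<otimes>\<^bsub>G\<^esub> g) w \<one>\<^bsub>G\<^esub>"

text \<open>The value is read off an arbitrary representative; it is independent of the choice as
  soon as \<open>f\<close> respects arcs, by \<open>word_eval_cong\<close>.\<close>

definition raag_lift where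
  "raag_lift G f X = word_eval G f (SOME w. w \<in> X)"

text \<open>The hypothesis of von Dyck's theorem for this presentation: commutations of adjacent
  vertices are the only relations that a map into a group could violate.\<close>

definition respects_arcs ::
    "('v, 'e) pre_digraph \<Rightarrow> ('a, 'b) monoid_scheme \<Rightarrow> ('v \<Rightarrow> 'a) \<Rightarrow> bool" where
  "respects_arcs \<Gamma> G f \<longleftrightarrow> f \<in> verts \<Gamma> \<rightarrow> carrier G \<and>
     (\<forall>u\<in>verts \<Gamma>. \<forall>w\<in>verts \<Gamma>. u \<rightarrow>\<^bsub>\<Gamma>\<^esub> w \<longrightarrow> f u \<otimes>\<^bsub>G\<^esub> f w = f w \<otimes>\<^bsub>G\<^esub> f u)"

context group
begin

lemma word_eval_simps [simp]:
  "word_eval G f [] = \<one>"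
  "word_eval G f ((v, b) # w) = (if b then f v else inv f v) \<otimes> word_eval G f w"
  by (auto simp: word_eval_def)

lemma word_eval_closed:
  "f \<in> verts \<Gamma> \<rightarrow> carrier G \<Longrightarrow> w \<in> words \<Gamma> \<Longrightarrow> word_eval G f w \<in> carrier G"
  by (induction w) (auto simp: Pi_def)

lemma word_eval_append:
  "f \<in> verts \<Gamma> \<rightarrow> carrier G \<Longrightarrow> x \<in> words \<Gamma> \<Longrightarrow> y \<in> words \<Gamma> \<Longrightarrow>
    word_eval G f (x @ y) = word_eval G f x \<otimes> word_eval G f y"
  by (induction x) (auto simp: word_eval_closed m_assoc Pi_def)

text \<open>Induction over the derivation of the equality. Cancellation holds in every group, and
  the commutation rule is the assumption on \<open>f\<close>.\<close>

lemma word_eval_cong: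
  assumes "respects_arcs \<Gamma> G f"
  shows "raag_eq \<Gamma> x y \<Longrightarrow> word_eval G f x = word_eval G f y"
proof (induction rule: raag_eq.induct)
  case (append x x' y y')
  have "f \<in> verts \<Gamma> \<rightarrow> carrier G" using assms by (simp add: respects_arcs_def)
  with append show ?case
    using raag_eq_words[OF append(1)] raag_eq_words[OF append(2)]
    by (simp add: word_eval_append[where \<Gamma> = \<Gamma>])
qed (use assms in \<open>auto simp: respects_arcs_def Pi_def\<close>)

lemma raag_lift_word_class:
  assumes "respects_arcs \<Gamma> G f" "w \<in> words \<Gamma>"
  shows "raag_lift G f (word_class \<Gamma> w) = word_eval G f w"
proof -
  have "w \<in> word_class \<Gamma> w" using assms by (auto simp: word_class_def raag_rel_def intro: raag_eq.refl)
  then have "(SOME x. x \<in> word_class \<Gamma> w) \<in> word_class \<Gamma> w" by (rule someI)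
  then have "raag_eq \<Gamma> w (SOME x. x \<in> word_class \<Gamma> w)" by (simp add: word_class_def raag_rel_def)
  then show ?thesis using word_eval_cong[OF assms(1)] by (simp add: raag_lift_def)
qed

lemma raag_lift_hom:
  assumes "respects_arcs \<Gamma> G f"
  shows "raag_lift G f \<in> hom (raag \<Gamma>) G"
proof (rule homI)
  show "raag_lift G f x \<in> carrier G" if "x \<in> carrier (raag \<Gamma>)" for x
    using that assms word_eval_closed[of f \<Gamma>]
    by (auto simp: carrier_raag raag_lift_word_class) (simp add: respects_arcs_def)
  show "raag_lift G f (x \<otimes>\<^bsub>raag \<Gamma>\<^esub> y) = raag_lift G f x \<otimes> raag_lift G f y"
    if "x \<in> carrier (raag \<Gamma>)" "y \<in> carrier (raag \<Gamma>)" for x y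
    using that assms
    by (auto simp: carrier_raag mult_word_class raag_lift_word_class)
       (simp add: respects_arcs_def word_eval_append[where \<Gamma> = \<Gamma>])
qed

lemma raag_lift_gen:
  assumes "respects_arcs \<Gamma> G f" "v \<in> verts \<Gamma>"
  shows "raag_lift G f (gen \<Gamma> v) = f v"
  using assms by (simp add: gen_eq_word_class raag_lift_word_class) (auto simp: respects_arcs_def Pi_iff)

lemma raag_hom_eqI:
  assumes "h \<in> hom (raag \<Gamma>) G" "h' \<in> hom (raag \<Gamma>) G"
    and "\<And>v. v \<in> verts \<Gamma> \<Longrightarrow> h (gen \<Gamma> v) = h' (gen \<Gamma> v)"
    and "x \<in> carrier (raag \<Gamma>)"
  shows "h x = h' x"
proof -
  interpret h: group_hom "raag \<Gamma>" G h
    using assms by (simp add: group_hom_def group_hom_axioms_def group_raag is_group)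
  interpret h': group_hom "raag \<Gamma>" G h'
    using assms by (simp add: group_hom_def group_hom_axioms_def group_raag is_group)
  show ?thesis
    using assms(4) by (induction x rule: raag_induct) (simp_all add: assms(3))
qed

end

subsection \<open>Automorphisms and outer automorphisms\<close>

context group
begin

text \<open>Together with \<open>commute_inv\<close> this says that a centralizer is a subgroup.
  Both serve to verify \<open>respects_arcs\<close> for the prescribed images and to pass
  commutation from generators to subgroups.\<close>

lemma commute_mult:
  assumes "x \<in> carrier G" "y \<in> carrier G" "z \<in> carrier G"
    and "x \<otimes> y = y \<otimes> x" "x \<otimes> z = z \<otimes> x"
  shows "x \<otimes> (y \<otimes> z) = (y \<otimes> z) \<otimes> x"
  using assms by (metis m_assoc)

lemma commute_inv:
  assumes "x \<in> carrier G" "y \<in> carrier G" "x \<otimes> y = y \<otimes> x"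
  shows "x \<otimes> inv y = inv y \<otimes> x"
  using assms by (metis inv_closed inv_solve_left inv_solve_right m_assoc m_closed)

text \<open>Needed alongside \<open>m_assoc\<close>: once products are bracketed to the right, an
  adjacent pair \<open>x\<close>, \<open>inv x\<close> is no longer a subterm to which the inverse
  laws apply.\<close>

lemma inv_cancel_left [simp]:
  assumes "x \<in> carrier G" "y \<in> carrier G"
  shows "x \<otimes> (inv x \<otimes> y) = y" "inv x \<otimes> (x \<otimes> y) = y"
  using assms by (simp_all add: m_assoc [symmetric])

lemma carrier_AutoGroup [simp]: "carrier (AutoGroup G) = auto G"
  by (simp add: AutoGroup_def)

lemma auto_imp_hom: "\<phi> \<in> auto G \<Longrightarrow> \<phi> \<in> hom G G"
  by (simp add: auto_def)

lemma auto_closed: "\<phi> \<in> auto G \<Longrightarrow> x \<in> carrier G \<Longrightarrow> \<phi> x \<in> carrier G"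
  by (auto simp: auto_def hom_def)

lemma auto_group_hom: "\<phi> \<in> auto G \<Longrightarrow> group_hom G G \<phi>"
  by (simp add: group_hom_def group_hom_axioms_def is_group auto_imp_hom)

lemma auto_mult:
  "\<phi> \<in> auto G \<Longrightarrow> x \<in> carrier G \<Longrightarrow> y \<in> carrier G \<Longrightarrow> \<phi> (x \<otimes> y) = \<phi> x \<otimes> \<phi> y"
  by (auto simp: auto_def hom_def)

lemma auto_inv:
  "\<phi> \<in> auto G \<Longrightarrow> x \<in> carrier G \<Longrightarrow> \<phi> (inv x) = inv \<phi> x"
  by (rule group_hom.hom_inv[OF auto_group_hom])

lemma auto_eqI:
  assumes "\<phi> \<in> auto G" "\<chi> \<in> auto G" "\<And>x. x \<in> carrier G \<Longrightarrow> \<phi> x = \<chi> x"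
  shows "\<phi> = \<chi>"
  using assms by (intro extensionalityI[of _ "carrier G"]) (auto simp: auto_def Bij_def)

lemma mult_AutoGroup:
  "\<phi> \<in> auto G \<Longrightarrow> \<chi> \<in> auto G \<Longrightarrow> \<phi> \<otimes>\<^bsub>AutoGroup G\<^esub> \<chi> = compose (carrier G) \<phi> \<chi>"
  by (simp add: AutoGroup_def BijGroup_def auto_def)

lemma mult_AutoGroup_apply:
  "\<phi> \<in> auto G \<Longrightarrow> \<chi> \<in> auto G \<Longrightarrow> x \<in> carrier G \<Longrightarrow> (\<phi> \<otimes>\<^bsub>AutoGroup G\<^esub> \<chi>) x = \<phi> (\<chi> x)"
  by (simp add: mult_AutoGroup compose_def)

lemma one_AutoGroup: "\<one>\<^bsub>AutoGroup G\<^esub> = (\<lambda>x\<in>carrier G. x)"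
  by (simp add: AutoGroup_def BijGroup_def)

lemma mult_AutoGroup_closed:
  "\<phi> \<in> auto G \<Longrightarrow> \<chi> \<in> auto G \<Longrightarrow> \<phi> \<otimes>\<^bsub>AutoGroup G\<^esub> \<chi> \<in> auto G"
  using monoid.m_closed[OF group.is_monoid[OF AutoGroup]] by simp

lemma inv_AutoGroup_closed: "\<phi> \<in> auto G \<Longrightarrow> inv\<^bsub>AutoGroup G\<^esub> \<phi> \<in> auto G"
  using group.inv_closed[OF AutoGroup] by simp

lemma inv_AutoGroup_apply:
  assumes "\<phi> \<in> auto G" "x \<in> carrier G"
  shows "(inv\<^bsub>AutoGroup G\<^esub> \<phi>) (\<phi> x) = x" "\<phi> ((inv\<^bsub>AutoGroup G\<^esub> \<phi>) x) = x"
proof -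
  interpret Aut: group "AutoGroup G" by (rule AutoGroup)
  have "inv\<^bsub>AutoGroup G\<^esub> \<phi> \<otimes>\<^bsub>AutoGroup G\<^esub> \<phi> = (\<lambda>x\<in>carrier G. x)"
    "\<phi> \<otimes>\<^bsub>AutoGroup G\<^esub> inv\<^bsub>AutoGroup G\<^esub> \<phi> = (\<lambda>x\<in>carrier G. x)"
    using assms by (simp_all add: one_AutoGroup [symmetric])
  then show "(inv\<^bsub>AutoGroup G\<^esub> \<phi>) (\<phi> x) = x" "\<phi> ((inv\<^bsub>AutoGroup G\<^esub> \<phi>) x) = x"
    using assms mult_AutoGroup_apply[OF assms(1) inv_AutoGroup_closed[OF assms(1)] assms(2)]
      mult_AutoGroup_apply[OF inv_AutoGroup_closed[OF assms(1)] assms]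
    by simp_all
qed

lemma inv_AutoGroup_eq:
  assumes "\<phi> \<in> auto G" "x \<in> carrier G" "\<phi> x = y"
  shows "(inv\<^bsub>AutoGroup G\<^esub> \<phi>) y = x"
  using inv_AutoGroup_apply(1)[OF assms(1,2)] assms(3) by simp

section \<open>Inner automorphisms and classes in the outer automorphism group\<close>

definition conj_aut :: "'a \<Rightarrow> 'a \<Rightarrow> 'a" where
  "conj_aut g = (\<lambda>x\<in>carrier G. g \<otimes> x \<otimes> inv g)"

lemma Inn_eq: "Inn G = conj_aut ` carrier G"
  by (auto simp: Inn_def conj_aut_def)

lemma conj_aut_apply: "x \<in> carrier G \<Longrightarrow> conj_aut g x = g \<otimes> x \<otimes> inv g"
  by (simp add: conj_aut_def)

lemma conj_aut_closed:
  assumes "g \<in> carrier G" shows "conj_aut g \<in> auto G"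
proof -
  have "bij_betw (conj_aut g) (carrier G) (carrier G)"
    by (rule bij_betw_byWitness[where f' = "conj_aut (inv g)"])
       (use assms in \<open>auto simp: conj_aut_apply m_assoc\<close>)
  moreover have "conj_aut g \<in> hom G G"
    using assms by (auto simp: hom_def conj_aut_apply m_assoc)
  moreover have "conj_aut g \<in> extensional (carrier G)"
    by (simp add: conj_aut_def)
  ultimately show ?thesis by (simp add: auto_def Bij_def)
qed

lemma conj_aut_mult:
  assumes "g \<in> carrier G" "h \<in> carrier G"
  shows "conj_aut g \<otimes>\<^bsub>AutoGroup G\<^esub> conj_aut h = conj_aut (g \<otimes> h)"
  using assms
  by (intro auto_eqI mult_AutoGroup_closed conj_aut_closed)
     (auto simp: mult_AutoGroup_apply conj_aut_closed conj_aut_apply m_assoc inv_mult_group)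

lemma conj_aut_one: "conj_aut \<one> = \<one>\<^bsub>AutoGroup G\<^esub>"
  by (auto simp: conj_aut_def one_AutoGroup)

lemma conj_aut_inv:
  assumes "g \<in> carrier G"
  shows "inv\<^bsub>AutoGroup G\<^esub> conj_aut g = conj_aut (inv g)"
proof -
  interpret Aut: group "AutoGroup G" by (rule AutoGroup)
  show ?thesis
    using assms by (intro Aut.inv_equality) (simp_all add: conj_aut_mult conj_aut_one conj_aut_closed)
qed

text \<open>The relation behind normality of \<open>Inn\<close>: conjugating the inner automorphism
  of \<open>g\<close> by \<phi> gives that of \<phi>(g).\<close>

lemma auto_conj_aut:
  assumes "\<phi> \<in> auto G" "g \<in> carrier G"
  shows "\<phi> \<otimes>\<^bsub>AutoGroup G\<^esub> conj_aut g = conj_aut (\<phi> g) \<otimes>\<^bsub>AutoGroup G\<^esub> \<phi>"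
  using assms
  by (intro auto_eqI mult_AutoGroup_closed conj_aut_closed)
     (auto simp: mult_AutoGroup_apply conj_aut_closed conj_aut_apply auto_mult auto_inv auto_closed)

lemma Inn_normal: "Inn G \<lhd> AutoGroup G"
proof -
  interpret Aut: group "AutoGroup G" by (rule AutoGroup)
  have "subgroup (Inn G) (AutoGroup G)"
    by (rule Aut.subgroupI) (auto simp: Inn_eq conj_aut_closed conj_aut_mult conj_aut_inv)
  moreover have "\<phi> \<otimes>\<^bsub>AutoGroup G\<^esub> h \<otimes>\<^bsub>AutoGroup G\<^esub> inv\<^bsub>AutoGroup G\<^esub> \<phi> \<in> Inn G"
    if \<phi>: "\<phi> \<in> carrier (AutoGroup G)" and "h \<in> Inn G" for \<phi> h
  proof -
    from \<open>h \<in> Inn G\<close> obtain g where g: "g \<in> carrier G" "h = conj_aut g" by (auto simp: Inn_eq)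
    with \<phi> have "\<phi> \<otimes>\<^bsub>AutoGroup G\<^esub> h \<otimes>\<^bsub>AutoGroup G\<^esub> inv\<^bsub>AutoGroup G\<^esub> \<phi> = conj_aut (\<phi> g)"
      by (simp add: auto_conj_aut auto_closed conj_aut_closed inv_AutoGroup_closed Aut.m_assoc)
    then show ?thesis using g \<phi> by (auto simp: Inn_eq auto_closed)
  qed
  ultimately show ?thesis by (simp add: Aut.normal_inv_iff)
qed

lemma group_Out: "group (Out G)"
  unfolding Out_def by (rule normal.factorgroup_is_group[OF Inn_normal])

lemma carrier_Out: "carrier (Out G) = out_class G ` auto G"
  by (auto simp: Out_def FactGroup_def RCOSETS_def out_class_def)

lemma out_class_hom: "out_class G \<in> hom (AutoGroup G) (Out G)"
  using normal.r_coset_hom_Mod[OF Inn_normal] by (simp add: Out_def out_class_def[abs_def])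

lemma out_class_group_hom: "group_hom (AutoGroup G) (Out G) (out_class G)"
  by (simp add: group_hom_def group_hom_axioms_def AutoGroup group_Out out_class_hom)

lemma out_class_mult:
  "\<phi> \<in> auto G \<Longrightarrow> \<chi> \<in> auto G \<Longrightarrow>
    out_class G (\<phi> \<otimes>\<^bsub>AutoGroup G\<^esub> \<chi>) = out_class G \<phi> \<otimes>\<^bsub>Out G\<^esub> out_class G \<chi>"
  using out_class_hom by (simp add: hom_def)

lemma out_class_inv:
  "\<phi> \<in> auto G \<Longrightarrow> out_class G (inv\<^bsub>AutoGroup G\<^esub> \<phi>) = inv\<^bsub>Out G\<^esub> out_class G \<phi>"
  using group_hom.hom_inv[OF out_class_group_hom] by simp

lemma out_class_one: "out_class G \<one>\<^bsub>AutoGroup G\<^esub> = \<one>\<^bsub>Out G\<^esub>"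
  by (rule group_hom.hom_one[OF out_class_group_hom])

lemma mem_out_class_iff:
  "\<phi> \<in> auto G \<Longrightarrow> \<chi> \<in> out_class G \<phi> \<longleftrightarrow> (\<exists>g\<in>carrier G. \<chi> = conj_aut g \<otimes>\<^bsub>AutoGroup G\<^esub> \<phi>)"
  by (auto simp: out_class_def r_coset_def Inn_eq)

lemma out_class_self: "\<phi> \<in> auto G \<Longrightarrow> \<phi> \<in> out_class G \<phi>"
  using monoid.l_one[OF group.is_monoid[OF AutoGroup]]
  by (auto simp: mem_out_class_iff conj_aut_one intro!: bexI[of _ \<one>])

lemma mem_out_class_auto: "\<phi> \<in> auto G \<Longrightarrow> \<chi> \<in> out_class G \<phi> \<Longrightarrow> \<chi> \<in> auto G"
  by (auto simp: mem_out_class_iff intro: mult_AutoGroup_closed conj_aut_closed)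

lemma mem_out_class_imp_eq:
  assumes "\<phi> \<in> auto G" "\<chi> \<in> out_class G \<phi>"
  shows "out_class G \<chi> = out_class G \<phi>"
proof -
  interpret Aut: group "AutoGroup G" by (rule AutoGroup)
  show ?thesis
    using Aut.repr_independence[of \<chi> "Inn G" \<phi>] assms normal_imp_subgroup[OF Inn_normal]
    by (simp add: out_class_def)
qed

lemma conj_aut_mult_out_class:
  assumes "\<phi> \<in> auto G" "g \<in> carrier G"
  shows "out_class G (conj_aut g \<otimes>\<^bsub>AutoGroup G\<^esub> \<phi>) = out_class G \<phi>"
  using assms by (intro mem_out_class_imp_eq) (auto simp: mem_out_class_iff)

end

subsection \<open>The generators are automorphisms\<close>

lemma raag_auto_eqI:
  assumes "\<phi> \<in> auto (raag \<Gamma>)" "\<chi> \<in> auto (raag \<Gamma>)"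
    and "\<And>k. k \<in> verts \<Gamma> \<Longrightarrow> \<phi> (gen \<Gamma> k) = \<chi> (gen \<Gamma> k)"
  shows "\<phi> = \<chi>"
proof (rule group.auto_eqI[OF group_raag assms(1,2)])
  fix x assume x: "x \<in> carrier (raag \<Gamma>)"
  show "\<phi> x = \<chi> x"
    by (rule group.raag_hom_eqI[OF group_raag _ _ _ x])
       (use assms in \<open>auto intro: group.auto_imp_hom[OF group_raag]\<close>)
qed

lemma raag_aut_eq:
  assumes "\<phi> \<in> auto (raag \<Gamma>)" "\<And>k. k \<in> verts \<Gamma> \<Longrightarrow> \<phi> (gen \<Gamma> k) = f k"
  shows "raag_aut \<Gamma> f = \<phi>"
  unfolding raag_aut_def using assms by (intro the_equality) (auto intro: raag_auto_eqI)

text \<open>The map \<open>g\<close> is a candidate for the inverse. Both composites fix every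
  vertex, hence are the identity by the uniqueness half of the universal property; this also makes
  the description in \<open>raag_aut\<close> meaningful.\<close>

lemma raag_autI:
  assumes "respects_arcs \<Gamma> (raag \<Gamma>) f" "respects_arcs \<Gamma> (raag \<Gamma>) g"
    and "\<And>k. k \<in> verts \<Gamma> \<Longrightarrow> raag_lift (raag \<Gamma>) g (f k) = gen \<Gamma> k"
    and "\<And>k. k \<in> verts \<Gamma> \<Longrightarrow> raag_lift (raag \<Gamma>) f (g k) = gen \<Gamma> k"
  shows "raag_aut \<Gamma> f \<in> auto (raag \<Gamma>)"
    and "k \<in> verts \<Gamma> \<Longrightarrow> raag_aut \<Gamma> f (gen \<Gamma> k) = f k"
proof -
  interpret group "raag \<Gamma>" by (rule group_raag)
  let ?F = "raag_lift (raag \<Gamma>) f" and ?G = "raag_lift (raag \<Gamma>) g"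
  \<comment> \<open>Elements of \<open>auto\<close> are extensional, whereas a lift has arbitrary
    values off the carrier.\<close>
  let ?\<phi> = "restrict ?F (carrier (raag \<Gamma>))"
  have F: "?F \<in> hom (raag \<Gamma>) (raag \<Gamma>)" and G: "?G \<in> hom (raag \<Gamma>) (raag \<Gamma>)"
    using assms by (auto intro: raag_lift_hom)
  have id: "(\<lambda>x. x) \<in> hom (raag \<Gamma>) (raag \<Gamma>)" by (auto simp: hom_def)
  have "?G (?F x) = x" if "x \<in> carrier (raag \<Gamma>)" for x
    using raag_hom_eqI[OF hom_compose[OF F G] id _ that] that assms by (simp add: raag_lift_gen compose_def)
  moreover have "?F (?G x) = x" if "x \<in> carrier (raag \<Gamma>)" for x
    using raag_hom_eqI[OF hom_compose[OF G F] id _ that] that assms by (simp add: raag_lift_gen compose_def)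
  ultimately have "bij_betw ?\<phi> (carrier (raag \<Gamma>)) (carrier (raag \<Gamma>))"
    using F G by (intro bij_betw_byWitness[where f' = ?G]) (auto simp: hom_def Pi_def)
  moreover have "?\<phi> \<in> hom (raag \<Gamma>) (raag \<Gamma>)"
    using F by (auto simp: hom_def)
  ultimately have \<phi>: "?\<phi> \<in> auto (raag \<Gamma>)" by (auto simp: auto_def Bij_def)
  moreover have \<phi>_gen: "?\<phi> (gen \<Gamma> k) = f k" if "k \<in> verts \<Gamma>" for k
    using assms(1) that by (simp add: raag_lift_gen gen_closed)
  ultimately have "raag_aut \<Gamma> f = ?\<phi>" by (rule raag_aut_eq)
  with \<phi> \<phi>_gen show "raag_aut \<Gamma> f \<in> auto (raag \<Gamma>)"
    and "k \<in> verts \<Gamma> \<Longrightarrow> raag_aut \<Gamma> f (gen \<Gamma> k) = f k" by auto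
qed

locale raag_graph = graph \<Gamma> for \<Gamma> :: "('v, 'e) pre_digraph"

sublocale raag_graph \<subseteq> A: group "raag \<Gamma>"
  by (rule group_raag)

context raag_graph
begin

lemma adj_sym: "u \<rightarrow>\<^bsub>\<Gamma>\<^esub> w \<longleftrightarrow> w \<rightarrow>\<^bsub>\<Gamma>\<^esub> u"
  using sym_arcs by (auto dest: arcs_ends_symmetric)

lemma mem_link_iff: "w \<in> link \<Gamma> v \<longleftrightarrow> v \<rightarrow>\<^bsub>\<Gamma>\<^esub> w"
  by (auto simp: link_def intro: adj_in_verts)

lemma link_sym: "w \<in> link \<Gamma> v \<longleftrightarrow> v \<in> link \<Gamma> w"
  using adj_sym by (simp add: mem_link_iff)

lemma link_irrefl: "v \<notin> link \<Gamma> v"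
  using adj_not_same by (auto simp: mem_link_iff)

lemma link_verts: "w \<in> link \<Gamma> v \<Longrightarrow> v \<in> verts \<Gamma> \<and> w \<in> verts \<Gamma>"
  by (auto simp: mem_link_iff intro: adj_in_verts)

lemma star_sym: "w \<in> star \<Gamma> v \<longleftrightarrow> v \<in> star \<Gamma> w"
  using link_sym by (auto simp: star_def)

lemma gen_commute_star:
  assumes "v \<in> verts \<Gamma>" "w \<in> star \<Gamma> v"
  shows "gen \<Gamma> v \<otimes>\<^bsub>raag \<Gamma>\<^esub> gen \<Gamma> w = gen \<Gamma> w \<otimes>\<^bsub>raag \<Gamma>\<^esub> gen \<Gamma> v"
  using assms gen_commute[of v \<Gamma> w] link_verts[of w v] by (auto simp: star_def mem_link_iff)

lemma respects_arcsI:
  assumes "\<And>u. u \<in> verts \<Gamma> \<Longrightarrow> f u \<in> carrier G"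
    and "\<And>u w. w \<in> link \<Gamma> u \<Longrightarrow> f u \<otimes>\<^bsub>G\<^esub> f w = f w \<otimes>\<^bsub>G\<^esub> f u"
  shows "respects_arcs \<Gamma> G f"
  using assms by (auto simp: respects_arcs_def mem_link_iff)

lemma raag_lift_mult:
  assumes "respects_arcs \<Gamma> (raag \<Gamma>) f" "x \<in> carrier (raag \<Gamma>)" "y \<in> carrier (raag \<Gamma>)"
  shows "raag_lift (raag \<Gamma>) f (x \<otimes>\<^bsub>raag \<Gamma>\<^esub> y) = raag_lift (raag \<Gamma>) f x \<otimes>\<^bsub>raag \<Gamma>\<^esub> raag_lift (raag \<Gamma>) f y"
  using A.raag_lift_hom[OF assms(1)] assms(2,3) by (auto simp: hom_def)

lemma raag_lift_inv:
  assumes "respects_arcs \<Gamma> (raag \<Gamma>) f" "x \<in> carrier (raag \<Gamma>)"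
  shows "raag_lift (raag \<Gamma>) f (inv\<^bsub>raag \<Gamma>\<^esub> x) = inv\<^bsub>raag \<Gamma>\<^esub> raag_lift (raag \<Gamma>) f x"
  using A.raag_lift_hom[OF assms(1)] assms(2)
  by (intro group_hom.hom_inv) (auto simp: group_hom_def group_hom_axioms_def)

text \<open>An inversion is its own inverse, so one prescription plays both roles in
  \<open>raag_autI\<close>.\<close>

lemma inversion:
  assumes "i \<in> verts \<Gamma>"
  shows inversion_auto: "inversion \<Gamma> i \<in> auto (raag \<Gamma>)"
    and inversion_gen: "k \<in> verts \<Gamma> \<Longrightarrow>
      inversion \<Gamma> i (gen \<Gamma> k) = (if k = i then inv\<^bsub>raag \<Gamma>\<^esub> gen \<Gamma> k else gen \<Gamma> k)"
proof -
  let ?f = "\<lambda>k. if k = i then inv\<^bsub>raag \<Gamma>\<^esub> gen \<Gamma> k else gen \<Gamma> k"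
  have f: "respects_arcs \<Gamma> (raag \<Gamma>) ?f"
  proof (rule respects_arcsI)
    fix u w assume w: "w \<in> link \<Gamma> u"
    then have "u \<in> verts \<Gamma>" "w \<in> verts \<Gamma>" "u \<noteq> w" using link_irrefl by (auto dest: link_verts)
    with w show "?f u \<otimes>\<^bsub>raag \<Gamma>\<^esub> ?f w = ?f w \<otimes>\<^bsub>raag \<Gamma>\<^esub> ?f u"
      using A.commute_inv[of "gen \<Gamma> u" "gen \<Gamma> w"] A.commute_inv[of "gen \<Gamma> w" "gen \<Gamma> u"] gen_commute_star[of u w]
      by (auto simp: star_def)
  qed auto
  have "raag_lift (raag \<Gamma>) ?f (?f k) = gen \<Gamma> k" if "k \<in> verts \<Gamma>" for k
    using that f by (auto simp: raag_lift_inv A.raag_lift_gen gen_closed)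
  from raag_autI[OF f f this this]
  show "inversion \<Gamma> i \<in> auto (raag \<Gamma>)" and "k \<in> verts \<Gamma> \<Longrightarrow>
      inversion \<Gamma> i (gen \<Gamma> k) = (if k = i then inv\<^bsub>raag \<Gamma>\<^esub> gen \<Gamma> k else gen \<Gamma> k)"
    by (simp_all add: inversion_def)
qed

text \<open>The candidate inverse sends \<open>v_i\<close> to \<open>v_i v_j^-1\<close>. The
  condition lk(i) \<subseteq> st(j) is what makes every neighbour of \<open>i\<close> commute with
  the new image of \<open>v_i\<close>.\<close>

lemma transvection:
  assumes "transvection_defined \<Gamma> i j"
  shows transvection_auto: "transvection \<Gamma> i j \<in> auto (raag \<Gamma>)"
    and transvection_gen: "k \<in> verts \<Gamma> \<Longrightarrow>
      transvection \<Gamma> i j (gen \<Gamma> k) = (if k = i then gen \<Gamma> i \<otimes>\<^bsub>raag \<Gamma>\<^esub> gen \<Gamma> j else gen \<Gamma> k)"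
proof -
  have i: "i \<in> verts \<Gamma>" and j: "j \<in> verts \<Gamma>" and "i \<noteq> j" and sub: "link \<Gamma> i \<subseteq> star \<Gamma> j"
    using assms by (auto simp: transvection_defined_def)
  \<comment> \<open>The parameter \<open>x\<close> stands for \<open>v_j\<close> or its inverse, so
    that one verification covers the transvection and its inverse.\<close>
  define f where "f = (\<lambda>x k. if k = i then gen \<Gamma> i \<otimes>\<^bsub>raag \<Gamma>\<^esub> x else gen \<Gamma> k)"
  have f: "respects_arcs \<Gamma> (raag \<Gamma>) (f x)" if x: "x = gen \<Gamma> j \<or> x = inv\<^bsub>raag \<Gamma>\<^esub> gen \<Gamma> j" for x
  proof (rule respects_arcsI)
    have x': "x \<in> carrier (raag \<Gamma>)" using x j by auto
    then show "f x u \<in> carrier (raag \<Gamma>)" if "u \<in> verts \<Gamma>" for u using that by (auto simp: f_def)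
    have *: "gen \<Gamma> w \<otimes>\<^bsub>raag \<Gamma>\<^esub> (gen \<Gamma> i \<otimes>\<^bsub>raag \<Gamma>\<^esub> x) = (gen \<Gamma> i \<otimes>\<^bsub>raag \<Gamma>\<^esub> x) \<otimes>\<^bsub>raag \<Gamma>\<^esub> gen \<Gamma> w"
      if w: "w \<in> link \<Gamma> i" for w
    proof (rule A.commute_mult)
      have wv: "w \<in> verts \<Gamma>" using w by (auto dest: link_verts)
      then show "gen \<Gamma> w \<otimes>\<^bsub>raag \<Gamma>\<^esub> gen \<Gamma> i = gen \<Gamma> i \<otimes>\<^bsub>raag \<Gamma>\<^esub> gen \<Gamma> w"
        using gen_commute_star[of i w] i w by (auto simp: star_def)
      have "gen \<Gamma> w \<otimes>\<^bsub>raag \<Gamma>\<^esub> gen \<Gamma> j = gen \<Gamma> j \<otimes>\<^bsub>raag \<Gamma>\<^esub> gen \<Gamma> w"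
        using gen_commute_star[of j w] j w sub by auto
      then show "gen \<Gamma> w \<otimes>\<^bsub>raag \<Gamma>\<^esub> x = x \<otimes>\<^bsub>raag \<Gamma>\<^esub> gen \<Gamma> w"
        using x wv j A.commute_inv[of "gen \<Gamma> w" "gen \<Gamma> j"] by auto
      show "gen \<Gamma> w \<in> carrier (raag \<Gamma>)" "gen \<Gamma> i \<in> carrier (raag \<Gamma>)" using wv i by auto
    qed (fact x')
    fix u w assume w: "w \<in> link \<Gamma> u"
    then have uw: "u \<in> verts \<Gamma>" "w \<in> verts \<Gamma>" "u \<noteq> w" using link_irrefl by (auto dest: link_verts)
    have wu: "u \<in> link \<Gamma> w" using w link_sym by blast
    from uw w wu show "f x u \<otimes>\<^bsub>raag \<Gamma>\<^esub> f x w = f x w \<otimes>\<^bsub>raag \<Gamma>\<^esub> f x u"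
      using *[of u] *[of w] gen_commute_star[of u w] by (auto simp: star_def f_def)
  qed
  note f1 = f[of "gen \<Gamma> j"] and f2 = f[of "inv\<^bsub>raag \<Gamma>\<^esub> gen \<Gamma> j"]
  have g: "f x j = gen \<Gamma> j" for x using \<open>i \<noteq> j\<close> by (simp add: f_def)
  have gi: "f x i = gen \<Gamma> i \<otimes>\<^bsub>raag \<Gamma>\<^esub> x" for x by (simp add: f_def)
  have "raag_lift (raag \<Gamma>) (f (inv\<^bsub>raag \<Gamma>\<^esub> gen \<Gamma> j)) (f (gen \<Gamma> j) k) = gen \<Gamma> k" if "k \<in> verts \<Gamma>" for k
  proof (cases "k = i")
    case True
    then show ?thesis using i j f2
      by (simp add: gi raag_lift_mult A.raag_lift_gen g gen_closed A.m_assoc)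
  qed (use that f2 in \<open>simp add: f_def A.raag_lift_gen\<close>)
  moreover have "raag_lift (raag \<Gamma>) (f (gen \<Gamma> j)) (f (inv\<^bsub>raag \<Gamma>\<^esub> gen \<Gamma> j) k) = gen \<Gamma> k" if "k \<in> verts \<Gamma>" for k
  proof (cases "k = i")
    case True
    then show ?thesis using i j f1
      by (simp add: gi raag_lift_mult raag_lift_inv A.raag_lift_gen g gen_closed A.m_assoc)
  qed (use that f1 in \<open>simp add: f_def A.raag_lift_gen\<close>)
  ultimately show "transvection \<Gamma> i j \<in> auto (raag \<Gamma>)" and "k \<in> verts \<Gamma> \<Longrightarrow>
      transvection \<Gamma> i j (gen \<Gamma> k) = (if k = i then gen \<Gamma> i \<otimes>\<^bsub>raag \<Gamma>\<^esub> gen \<Gamma> j else gen \<Gamma> k)"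
    using raag_autI[OF f1 f2] by (simp_all add: transvection_def f_def)
qed

text \<open>Extended partial conjugations by \<open>j\<close> are the conjugations by \<open>j\<close> on a union \<open>U\<close> of connected
  components of \<open>\<Gamma> - st(j)\<close>, that is, on a set closed under adjacency outside \<open>st(j)\<close>.\<close>

definition component_union :: "'v \<Rightarrow> 'v set \<Rightarrow> bool" where
  "component_union j U \<longleftrightarrow> U \<subseteq> verts \<Gamma> - star \<Gamma> j \<and>
     (\<forall>u\<in>U. \<forall>w\<in>link \<Gamma> u. w \<notin> star \<Gamma> j \<longrightarrow> w \<in> U)"

definition union_conjugation :: "'v \<Rightarrow> 'v set \<Rightarrow> ('v \<times> bool) list set \<Rightarrow> ('v \<times> bool) list set" where
  "union_conjugation j U = raag_aut \<Gamma> (\<lambda>k. if k \<in> U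
     then gen \<Gamma> j \<otimes>\<^bsub>raag \<Gamma>\<^esub> gen \<Gamma> k \<otimes>\<^bsub>raag \<Gamma>\<^esub> inv\<^bsub>raag \<Gamma>\<^esub> gen \<Gamma> j else gen \<Gamma> k)"

text \<open>Two adjacent vertices of \<open>U\<close> are conjugated together. If \<open>u\<close>
  in \<open>U\<close> is adjacent to \<open>w\<close> outside \<open>U\<close>, then closure forces
  \<open>w\<close> into st(j), so \<open>w\<close> commutes with \<open>v_j\<close> as well as with
  \<open>v_u\<close>, and hence with the conjugate. The inverse conjugates by
  \<open>v_j^-1\<close>.\<close>

lemma union_conjugation:
  assumes "j \<in> verts \<Gamma>" "component_union j U"
  shows union_conjugation_auto: "union_conjugation j U \<in> auto (raag \<Gamma>)"
    and union_conjugation_gen: "k \<in> verts \<Gamma> \<Longrightarrow>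
      union_conjugation j U (gen \<Gamma> k) = (if k \<in> U
        then gen \<Gamma> j \<otimes>\<^bsub>raag \<Gamma>\<^esub> gen \<Gamma> k \<otimes>\<^bsub>raag \<Gamma>\<^esub> inv\<^bsub>raag \<Gamma>\<^esub> gen \<Gamma> j else gen \<Gamma> k)"
proof -
  have U: "U \<subseteq> verts \<Gamma>" "\<And>u. u \<in> U \<Longrightarrow> u \<notin> star \<Gamma> j"
    "\<And>u w. u \<in> U \<Longrightarrow> w \<in> link \<Gamma> u \<Longrightarrow> w \<notin> star \<Gamma> j \<Longrightarrow> w \<in> U"
    using assms(2) unfolding component_union_def by blast+
  define f where "f = (\<lambda>x k. if k \<in> U then x \<otimes>\<^bsub>raag \<Gamma>\<^esub> gen \<Gamma> k \<otimes>\<^bsub>raag \<Gamma>\<^esub> inv\<^bsub>raag \<Gamma>\<^esub> x else gen \<Gamma> k)"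
  have f: "respects_arcs \<Gamma> (raag \<Gamma>) (f x)" if x: "x = gen \<Gamma> j \<or> x = inv\<^bsub>raag \<Gamma>\<^esub> gen \<Gamma> j" for x
  proof (rule respects_arcsI)
    have x': "x \<in> carrier (raag \<Gamma>)" using x assms(1) by auto
    then show "f x u \<in> carrier (raag \<Gamma>)" if "u \<in> verts \<Gamma>" for u using that by (auto simp: f_def)
    have *: "gen \<Gamma> w \<otimes>\<^bsub>raag \<Gamma>\<^esub> (x \<otimes>\<^bsub>raag \<Gamma>\<^esub> gen \<Gamma> u \<otimes>\<^bsub>raag \<Gamma>\<^esub> inv\<^bsub>raag \<Gamma>\<^esub> x) =
        (x \<otimes>\<^bsub>raag \<Gamma>\<^esub> gen \<Gamma> u \<otimes>\<^bsub>raag \<Gamma>\<^esub> inv\<^bsub>raag \<Gamma>\<^esub> x) \<otimes>\<^bsub>raag \<Gamma>\<^esub> gen \<Gamma> w"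
      if u: "u \<in> U" and w: "w \<in> link \<Gamma> u" "w \<notin> U" for u w
    proof -
      have "w \<in> star \<Gamma> j" using U(3)[OF u w(1)] w(2) by blast
      have wv: "w \<in> verts \<Gamma>" and uv: "u \<in> verts \<Gamma>" using w by (auto dest: link_verts)
      have "gen \<Gamma> w \<otimes>\<^bsub>raag \<Gamma>\<^esub> gen \<Gamma> j = gen \<Gamma> j \<otimes>\<^bsub>raag \<Gamma>\<^esub> gen \<Gamma> w"
        using gen_commute_star[of j w] assms(1) \<open>w \<in> star \<Gamma> j\<close> by auto
      then have wx: "gen \<Gamma> w \<otimes>\<^bsub>raag \<Gamma>\<^esub> x = x \<otimes>\<^bsub>raag \<Gamma>\<^esub> gen \<Gamma> w"
        using x wv assms(1) A.commute_inv[of "gen \<Gamma> w" "gen \<Gamma> j"] by auto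
      have "gen \<Gamma> w \<otimes>\<^bsub>raag \<Gamma>\<^esub> gen \<Gamma> u = gen \<Gamma> u \<otimes>\<^bsub>raag \<Gamma>\<^esub> gen \<Gamma> w"
        using gen_commute_star[of u w] uv w by (auto simp: star_def)
      with wx x' wv uv show ?thesis
        by (intro A.commute_mult A.commute_inv) simp_all
    qed
    fix u w assume w: "w \<in> link \<Gamma> u"
    then have uw: "u \<in> verts \<Gamma>" "w \<in> verts \<Gamma>" by (auto dest: link_verts)
    have wu: "u \<in> link \<Gamma> w" using w link_sym by blast
    have c: "gen \<Gamma> u \<otimes>\<^bsub>raag \<Gamma>\<^esub> gen \<Gamma> w = gen \<Gamma> w \<otimes>\<^bsub>raag \<Gamma>\<^esub> gen \<Gamma> u"
      using gen_commute_star[of u w] uw w by (auto simp: star_def)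
    have c': "A.conj_aut x (gen \<Gamma> u) \<otimes>\<^bsub>raag \<Gamma>\<^esub> A.conj_aut x (gen \<Gamma> w) =
        A.conj_aut x (gen \<Gamma> w) \<otimes>\<^bsub>raag \<Gamma>\<^esub> A.conj_aut x (gen \<Gamma> u)"
      using A.auto_mult[OF A.conj_aut_closed[OF x'], symmetric] uw c by auto
    consider "u \<in> U" "w \<in> U" | "u \<in> U" "w \<notin> U" | "u \<notin> U" "w \<in> U" | "u \<notin> U" "w \<notin> U" by blast
    then show "f x u \<otimes>\<^bsub>raag \<Gamma>\<^esub> f x w = f x w \<otimes>\<^bsub>raag \<Gamma>\<^esub> f x u"
    proof cases
      case 1
      then show ?thesis using c' uw by (simp add: f_def A.conj_aut_apply gen_closed)
    next
      case 2
      then show ?thesis using *[of u w] w by (simp add: f_def)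
    next
      case 3
      then show ?thesis using *[of w u] wu by (simp add: f_def)
    next
      case 4
      then show ?thesis using c by (simp add: f_def)
    qed
  qed
  \<comment> \<open>The conjugating element is itself fixed by both candidates, which is why
    conjugating by \<open>v_j\<close> and then by its inverse cancels.\<close>
  have j: "j \<notin> U" using U(2)[of j] by (auto simp: star_def)
  have g: "raag_lift (raag \<Gamma>) (f y) x = x"
    if x: "x = gen \<Gamma> j \<or> x = inv\<^bsub>raag \<Gamma>\<^esub> gen \<Gamma> j" and y: "y = gen \<Gamma> j \<or> y = inv\<^bsub>raag \<Gamma>\<^esub> gen \<Gamma> j" for x y
  proof -
    have "f y j = gen \<Gamma> j" using j by (simp add: f_def)
    with A.raag_lift_gen[OF f[OF y] assms(1)]
    have h: "raag_lift (raag \<Gamma>) (f y) (gen \<Gamma> j) = gen \<Gamma> j" by (simp only:)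
    with raag_lift_inv[OF f[OF y] gen_closed[OF assms(1)]]
    have "raag_lift (raag \<Gamma>) (f y) (inv\<^bsub>raag \<Gamma>\<^esub> gen \<Gamma> j) = inv\<^bsub>raag \<Gamma>\<^esub> gen \<Gamma> j" by (simp only:)
    with h x show ?thesis by (elim disjE) (simp_all only:)
  qed
  have key: "raag_lift (raag \<Gamma>) (f y) (f x k) = gen \<Gamma> k"
    if x: "x = gen \<Gamma> j \<or> x = inv\<^bsub>raag \<Gamma>\<^esub> gen \<Gamma> j" and y: "y = gen \<Gamma> j \<or> y = inv\<^bsub>raag \<Gamma>\<^esub> gen \<Gamma> j"
      and xy: "y = inv\<^bsub>raag \<Gamma>\<^esub> x" and k: "k \<in> verts \<Gamma>" for x y k
  proof (cases "k \<in> U")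
    case True
    have x': "x \<in> carrier (raag \<Gamma>)" using x assms(1) by auto
    have yk: "raag_lift (raag \<Gamma>) (f y) (gen \<Gamma> k) = y \<otimes>\<^bsub>raag \<Gamma>\<^esub> gen \<Gamma> k \<otimes>\<^bsub>raag \<Gamma>\<^esub> inv\<^bsub>raag \<Gamma>\<^esub> y"
      using A.raag_lift_gen[OF f[OF y] k] True by (simp add: f_def)
    have fx: "f x k = x \<otimes>\<^bsub>raag \<Gamma>\<^esub> gen \<Gamma> k \<otimes>\<^bsub>raag \<Gamma>\<^esub> inv\<^bsub>raag \<Gamma>\<^esub> x"
      using True by (simp add: f_def)
    have "raag_lift (raag \<Gamma>) (f y) (f x k) =
        raag_lift (raag \<Gamma>) (f y) x \<otimes>\<^bsub>raag \<Gamma>\<^esub> raag_lift (raag \<Gamma>) (f y) (gen \<Gamma> k) \<otimes>\<^bsub>raag \<Gamma>\<^esub>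
        inv\<^bsub>raag \<Gamma>\<^esub> raag_lift (raag \<Gamma>) (f y) x"
      unfolding fx using x' gen_closed[OF k] raag_lift_mult[OF f[OF y]] raag_lift_inv[OF f[OF y]]
      by (simp only: A.inv_closed A.m_closed)
    also have "\<dots> = x \<otimes>\<^bsub>raag \<Gamma>\<^esub> (inv\<^bsub>raag \<Gamma>\<^esub> x \<otimes>\<^bsub>raag \<Gamma>\<^esub> gen \<Gamma> k \<otimes>\<^bsub>raag \<Gamma>\<^esub> inv\<^bsub>raag \<Gamma>\<^esub> (inv\<^bsub>raag \<Gamma>\<^esub> x)) \<otimes>\<^bsub>raag \<Gamma>\<^esub> inv\<^bsub>raag \<Gamma>\<^esub> x"
      unfolding yk g[OF x y] unfolding xy ..
    also have "\<dots> = gen \<Gamma> k"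
      using x' gen_closed[OF k] by (simp add: A.m_assoc)
    finally show ?thesis .
  next
    case False
    then show ?thesis using A.raag_lift_gen[OF f[OF y] k] by (simp add: f_def)
  qed
  have inv: "gen \<Gamma> j = inv\<^bsub>raag \<Gamma>\<^esub> (inv\<^bsub>raag \<Gamma>\<^esub> gen \<Gamma> j)" using assms(1) by (simp add: gen_closed)
  note * = raag_autI[OF f[OF disjI1[OF HOL.refl]] f[OF disjI2[OF HOL.refl]]
      key[OF disjI1[OF HOL.refl] disjI2[OF HOL.refl] HOL.refl] key[OF disjI2[OF HOL.refl] disjI1[OF HOL.refl] inv]]
  have uc: "union_conjugation j U = raag_aut \<Gamma> (f (gen \<Gamma> j))"
    by (simp add: union_conjugation_def f_def)
  show "union_conjugation j U \<in> auto (raag \<Gamma>)"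
    unfolding uc by (rule *(1))
  show "union_conjugation j U (gen \<Gamma> k) = (if k \<in> U
      then gen \<Gamma> j \<otimes>\<^bsub>raag \<Gamma>\<^esub> gen \<Gamma> k \<otimes>\<^bsub>raag \<Gamma>\<^esub> inv\<^bsub>raag \<Gamma>\<^esub> gen \<Gamma> j else gen \<Gamma> k)" if "k \<in> verts \<Gamma>"
  proof -
    have 1: "f (gen \<Gamma> j) k = (if k \<in> U
      then gen \<Gamma> j \<otimes>\<^bsub>raag \<Gamma>\<^esub> gen \<Gamma> k \<otimes>\<^bsub>raag \<Gamma>\<^esub> inv\<^bsub>raag \<Gamma>\<^esub> gen \<Gamma> j else gen \<Gamma> k)"
      unfolding f_def ..
    show ?thesis
      unfolding uc 1[symmetric] using *(2) that by blast
  qed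
qed

end

lemma adj_induce_subgraph [simp]: "u \<rightarrow>\<^bsub>\<Gamma> \<restriction> S\<^esub> w \<longleftrightarrow> u \<in> S \<and> w \<in> S \<and> u \<rightarrow>\<^bsub>\<Gamma>\<^esub> w"
  by (auto simp: arcs_ends_conv)

section \<open>Connected components of \<Gamma> - st(j) and extended partial conjugations\<close>

context raag_graph
begin

lemma same_component_verts:
  assumes "same_component \<Gamma> j s t"
  shows "s \<in> verts \<Gamma> - star \<Gamma> j" "t \<in> verts \<Gamma> - star \<Gamma> j"
  using assms by (auto simp: same_component_def elim: reachable_in_vertsE)

lemma same_component_refl: "s \<in> verts \<Gamma> - star \<Gamma> j \<Longrightarrow> same_component \<Gamma> j s s"
  unfolding same_component_def by (simp add: reachable_def)

lemma same_component_sym: "same_component \<Gamma> j s t \<Longrightarrow> same_component \<Gamma> j t s"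
  unfolding same_component_def
  by (rule symmetric_reachable) (auto simp: symmetric_def sym_def adj_sym)

lemma same_component_trans:
  "same_component \<Gamma> j s t \<Longrightarrow> same_component \<Gamma> j t u \<Longrightarrow> same_component \<Gamma> j s u"
  unfolding same_component_def reachable_def by (rule rtrancl_on_trans)

lemma same_component_step:
  assumes "w \<in> link \<Gamma> u" "u \<notin> star \<Gamma> j" "w \<notin> star \<Gamma> j"
  shows "same_component \<Gamma> j u w"
proof -
  have "u \<in> verts \<Gamma>" "w \<in> verts \<Gamma>" using assms(1) link_verts by auto
  then have "u \<rightarrow>\<^bsub>\<Gamma> \<restriction> (verts \<Gamma> - star \<Gamma> j)\<^esub> w" using assms by (simp add: mem_link_iff)
  moreover have "wf_digraph (\<Gamma> \<restriction> (verts \<Gamma> - star \<Gamma> j))" by (rule wellformed_induce_subgraph)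
  ultimately show ?thesis unfolding same_component_def by (simp add: wf_digraph.reachable_adjI)
qed

lemma component_union_closed:
  assumes "component_union j U" "u \<in> U" "same_component \<Gamma> j u w"
  shows "w \<in> U"
  using assms(3,2) unfolding same_component_def reachable_def
proof (induction rule: rtrancl_on_induct)
  case (step y z)
  then show ?case using assms(1) unfolding component_union_def by (simp add: mem_link_iff)
qed

lemma component_union_component: "component_union j {k. same_component \<Gamma> j i k}"
  unfolding component_union_def
proof (intro conjI ballI impI)
  show "{k. same_component \<Gamma> j i k} \<subseteq> verts \<Gamma> - star \<Gamma> j" using same_component_verts by blast
next
  fix u w assume "u \<in> {k. same_component \<Gamma> j i k}" "w \<in> link \<Gamma> u" "w \<notin> star \<Gamma> j"
  then show "w \<in> {k. same_component \<Gamma> j i k}"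
    using same_component_verts(2)[of j i u] same_component_step[of w u j] same_component_trans[of j i u w] by simp
qed

lemma component_union_Union:
  "(\<And>U. U \<in> \<U> \<Longrightarrow> component_union j U) \<Longrightarrow> component_union j (\<Union>\<U>)"
  unfolding component_union_def by blast

lemma partial_conjugation_eq:
  "partial_conjugation \<Gamma> i j = union_conjugation j {k. same_component \<Gamma> j i k}"
  by (simp add: partial_conjugation_def union_conjugation_def)

lemma union_conjugation_fixes:
  assumes "j \<in> verts \<Gamma>" "component_union j U"
  shows "union_conjugation j U (gen \<Gamma> j) = gen \<Gamma> j"
proof -
  have "j \<notin> U" using assms(2) by (auto simp: component_union_def star_def)
  then show ?thesis using assms by (simp add: union_conjugation_gen)
qed

text \<open>A vertex moved by the inner factor becomes a product of letters that the outer factor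
  fixes, since neither \<open>j\<close> nor a vertex of \<open>W\<close> lies in \<open>U\<close>.
  An overlap would be conjugated twice.\<close>

lemma union_conjugation_disjoint:
  assumes j: "j \<in> verts \<Gamma>" and U: "component_union j U" and W: "component_union j W" and "U \<inter> W = {}"
  shows "union_conjugation j U \<otimes>\<^bsub>AutoGroup (raag \<Gamma>)\<^esub> union_conjugation j W = union_conjugation j (U \<union> W)"
proof (rule raag_auto_eqI)
  have UW: "component_union j (U \<union> W)"
    using component_union_Union[of "{U, W}" j] U W by auto
  note auto = union_conjugation_auto[OF j]
  show "union_conjugation j U \<otimes>\<^bsub>AutoGroup (raag \<Gamma>)\<^esub> union_conjugation j W \<in> auto (raag \<Gamma>)"
    using U W by (intro A.mult_AutoGroup_closed auto)
  show "union_conjugation j (U \<union> W) \<in> auto (raag \<Gamma>)" by (rule auto[OF UW])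
  fix k assume k: "k \<in> verts \<Gamma>"
  show "(union_conjugation j U \<otimes>\<^bsub>AutoGroup (raag \<Gamma>)\<^esub> union_conjugation j W) (gen \<Gamma> k) =
      union_conjugation j (U \<union> W) (gen \<Gamma> k)"
    using assms(4) k j
    by (auto simp: A.mult_AutoGroup_apply[OF auto[OF U] auto[OF W]] gen_closed
        union_conjugation_gen[OF j U] union_conjugation_gen[OF j W] union_conjugation_gen[OF j UW]
        A.auto_mult[OF auto[OF U]] A.auto_inv[OF auto[OF U]] union_conjugation_fixes[OF j U])
qed

lemma union_conjugation_empty:
  "j \<in> verts \<Gamma> \<Longrightarrow> union_conjugation j {} = \<one>\<^bsub>AutoGroup (raag \<Gamma>)\<^esub>"
  using A.id_in_auto union_conjugation_auto[of j "{}"] union_conjugation_gen[of j "{}"]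
  by (intro raag_auto_eqI) (auto simp: component_union_def A.one_AutoGroup)

lemma ext_partial_conjugation_product:
  assumes j: "j \<in> verts \<Gamma>" and "distinct ts"
    and "\<forall>s\<in>set ts. \<forall>t\<in>set ts. s \<noteq> t \<longrightarrow> \<not> same_component \<Gamma> j s t"
  shows "foldr (\<lambda>t \<phi>. partial_conjugation \<Gamma> t j \<otimes>\<^bsub>AutoGroup (raag \<Gamma>)\<^esub> \<phi>) ts \<one>\<^bsub>AutoGroup (raag \<Gamma>)\<^esub> =
    union_conjugation j (\<Union>t\<in>set ts. {k. same_component \<Gamma> j t k})"
  using assms(2,3)
proof (induction ts)
  case Nil
  then show ?case by (simp add: union_conjugation_empty[OF j])
next
  case (Cons t ts)
  have "{k. same_component \<Gamma> j t k} \<inter> (\<Union>t\<in>set ts. {k. same_component \<Gamma> j t k}) = {}"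
  proof (rule ccontr)
    assume "\<not> ?thesis"
    then obtain s k where s: "s \<in> set ts" "same_component \<Gamma> j t k" "same_component \<Gamma> j s k" by blast
    then have "same_component \<Gamma> j t s" using same_component_trans same_component_sym by metis
    with s(1) Cons.prems show False by auto
  qed
  moreover have "component_union j (\<Union>t\<in>set ts. {k. same_component \<Gamma> j t k})"
    by (rule component_union_Union) (auto simp: component_union_component)
  ultimately show ?case
    using Cons union_conjugation_disjoint[OF j component_union_component]
    by (simp add: partial_conjugation_eq)
qed

lemma component_union_eq:
  assumes "component_union j U" "R \<subseteq> U" "\<And>u. u \<in> U \<Longrightarrow> \<exists>r\<in>R. same_component \<Gamma> j r u"
  shows "(\<Union>t\<in>R. {k. same_component \<Gamma> j t k}) = U"
proof (intro equalityI subsetI)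
  fix x assume "x \<in> (\<Union>t\<in>R. {k. same_component \<Gamma> j t k})"
  then obtain t where "t \<in> U" "same_component \<Gamma> j t x" using assms(2) by blast
  then show "x \<in> U" by (rule component_union_closed[OF assms(1)])
next
  fix x assume "x \<in> U"
  with assms(3) show "x \<in> (\<Union>t\<in>R. {k. same_component \<Gamma> j t k})" by blast
qed

text \<open>Replaces the enumerated transversals of the definition by the set of vertices that are
  moved. In this form restriction to a subgraph is just intersection of sets.\<close>

lemma ext_partial_conjugations_eq:
  "ext_partial_conjugations \<Gamma> = {union_conjugation j U | j U. j \<in> verts \<Gamma> \<and> component_union j U}"
proof (intro equalityI subsetI)
  fix \<phi> assume "\<phi> \<in> ext_partial_conjugations \<Gamma>"
  then obtain j ts where j: "j \<in> verts \<Gamma>" and ts: "distinct ts"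
    "\<forall>s\<in>set ts. \<forall>t\<in>set ts. s \<noteq> t \<longrightarrow> \<not> same_component \<Gamma> j s t"
    and \<phi>: "\<phi> = foldr (\<lambda>t \<phi>. partial_conjugation \<Gamma> t j \<otimes>\<^bsub>AutoGroup (raag \<Gamma>)\<^esub> \<phi>) ts \<one>\<^bsub>AutoGroup (raag \<Gamma>)\<^esub>"
    unfolding ext_partial_conjugations_def by blast
  have "component_union j (\<Union>t\<in>set ts. {k. same_component \<Gamma> j t k})"
    by (rule component_union_Union) (auto simp: component_union_component)
  with j show "\<phi> \<in> {union_conjugation j U | j U. j \<in> verts \<Gamma> \<and> component_union j U}"
    unfolding \<phi> ext_partial_conjugation_product[OF j ts] by blast
next
  fix \<phi> assume "\<phi> \<in> {union_conjugation j U | j U. j \<in> verts \<Gamma> \<and> component_union j U}"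
  then obtain j U where j: "j \<in> verts \<Gamma>" and U: "component_union j U" and \<phi>: "\<phi> = union_conjugation j U"
    by blast
  have U_sub: "U \<subseteq> verts \<Gamma> - star \<Gamma> j" using U by (simp add: component_union_def)
  \<comment> \<open>The choice depends only on the predicate
    \<open>same_component \<Gamma> j u\<close>, which is equal for all vertices of one component, so
    \<open>rep\<close> is constant on components and its values form a transversal.\<close>
  define rep where "rep = (\<lambda>u. SOME w. same_component \<Gamma> j u w)"
  have rep: "same_component \<Gamma> j u (rep u)" if "u \<in> U" for u
    unfolding rep_def by (rule someI, rule same_component_refl) (use U_sub that in blast)
  have rep_eq: "rep u = rep w" if "same_component \<Gamma> j u w" for u w
  proof -
    have "same_component \<Gamma> j u = same_component \<Gamma> j w"
    proof
      show "same_component \<Gamma> j u x = same_component \<Gamma> j w x" for x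
        using same_component_trans[OF that, of x] same_component_trans[OF same_component_sym[OF that], of x] by blast
    qed
    then show ?thesis by (simp add: rep_def)
  qed
  have "finite U" using U_sub finite_verts finite_subset by blast
  then obtain ts where ts: "set ts = rep ` U" "distinct ts"
    using finite_distinct_list[of "rep ` U"] by auto
  have rep_U: "rep ` U \<subseteq> U" using rep component_union_closed[OF U] by blast
  have "\<not> same_component \<Gamma> j s t" if "s \<in> set ts" "t \<in> set ts" "s \<noteq> t" for s t
  proof
    assume st: "same_component \<Gamma> j s t"
    obtain x where x: "s = rep x" "x \<in> U" using \<open>s \<in> set ts\<close> unfolding ts(1) by blast
    obtain y where y: "t = rep y" "y \<in> U" using \<open>t \<in> set ts\<close> unfolding ts(1) by blast
    have "rep s = s" using rep_eq[OF rep[OF x(2)]] x by simp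
    moreover have "rep t = t" using rep_eq[OF rep[OF y(2)]] y by simp
    ultimately show False using rep_eq[OF st] that by simp
  qed
  then have sep: "\<forall>s\<in>set ts. \<forall>t\<in>set ts. s \<noteq> t \<longrightarrow> \<not> same_component \<Gamma> j s t" by blast
  have "(\<Union>t\<in>set ts. {k. same_component \<Gamma> j t k}) = U"
    unfolding ts using rep by (intro component_union_eq[OF U rep_U]) (blast intro: same_component_sym)
  then have "\<phi> = foldr (\<lambda>t \<phi>. partial_conjugation \<Gamma> t j \<otimes>\<^bsub>AutoGroup (raag \<Gamma>)\<^esub> \<phi>) ts \<one>\<^bsub>AutoGroup (raag \<Gamma>)\<^esub>"
    unfolding ext_partial_conjugation_product[OF j ts(2) sep] \<phi> by simp
  moreover have "set ts \<subseteq> verts \<Gamma> - star \<Gamma> j" using rep_U U_sub ts by blast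
  ultimately show "\<phi> \<in> ext_partial_conjugations \<Gamma>"
    unfolding ext_partial_conjugations_def using j ts(2) sep by blast
qed

lemma Out0_generators_auto:
  "inversions \<Gamma> \<union> partial_conjugations \<Gamma> \<union> transvections \<Gamma> \<subseteq> auto (raag \<Gamma>)"
  unfolding partial_conjugations_def partial_conjugation_eq inversions_def transvections_def
  using union_conjugation_auto[OF _ component_union_component] inversion_auto transvection_auto by blast

lemma subgroup_Out0: "subgroup (Out0 \<Gamma>) (Out (raag \<Gamma>))"
  unfolding Out0_def
  by (rule group.generate_is_subgroup[OF A.group_Out])
     (use Out0_generators_auto in \<open>auto simp: A.carrier_Out\<close>)

text \<open>\<open>projection\<close> has its intended values only on \<open>Out0\<close>, whose
  generators include partial conjugations but not their extended products.\<close>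

lemma S0_subset_Out0: "S0_set \<Gamma> \<subseteq> Out0 \<Gamma>"
proof -
  have incl: "out_class (raag \<Gamma>) \<phi> \<in> Out0 \<Gamma>"
    if "\<phi> \<in> inversions \<Gamma> \<union> partial_conjugations \<Gamma> \<union> transvections \<Gamma>" for \<phi>
    unfolding Out0_def using that by (intro generate.incl imageI)
  \<comment> \<open>Membership in \<open>auto\<close> is carried along because
    \<open>out_class\<close> is known to be multiplicative only on automorphisms. Distinctness of
    components is dropped: any product of partial conjugations will do.\<close>
  have "out_class (raag \<Gamma>) (foldr (\<lambda>t \<phi>. partial_conjugation \<Gamma> t j \<otimes>\<^bsub>AutoGroup (raag \<Gamma>)\<^esub> \<phi>) ts \<one>\<^bsub>AutoGroup (raag \<Gamma>)\<^esub>) \<in> Out0 \<Gamma>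
      \<and> foldr (\<lambda>t \<phi>. partial_conjugation \<Gamma> t j \<otimes>\<^bsub>AutoGroup (raag \<Gamma>)\<^esub> \<phi>) ts \<one>\<^bsub>AutoGroup (raag \<Gamma>)\<^esub> \<in> auto (raag \<Gamma>)"
    if j: "j \<in> verts \<Gamma>" and "set ts \<subseteq> verts \<Gamma> - star \<Gamma> j" for j ts
    using that(2)
  proof (induction ts)
    case Nil
    show ?case
      using subgroup.one_closed[OF subgroup_Out0] A.id_in_auto
      by (simp add: A.out_class_one) (simp add: A.one_AutoGroup)
  next
    case (Cons t ts)
    have "partial_conjugation \<Gamma> t j \<in> partial_conjugations \<Gamma>"
      unfolding partial_conjugations_def using Cons j by auto
    then have "partial_conjugation \<Gamma> t j \<in> auto (raag \<Gamma>)"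
      and "out_class (raag \<Gamma>) (partial_conjugation \<Gamma> t j) \<in> Out0 \<Gamma>"
      using Out0_generators_auto incl by blast+
    then show ?case
      using Cons by (simp add: A.out_class_mult A.mult_AutoGroup_closed subgroup.m_closed[OF subgroup_Out0])
  qed
  then have "out_class (raag \<Gamma>) \<phi> \<in> Out0 \<Gamma>" if "\<phi> \<in> ext_partial_conjugations \<Gamma>" for \<phi>
    using that unfolding ext_partial_conjugations_def by blast
  with incl show ?thesis unfolding S0_set_def by blast
qed

end

subsection \<open>Full subgraphs and their retractions\<close>

lemma (in graph) graph_induce_subgraph:
  assumes "S \<subseteq> verts G"
  shows "graph (G \<restriction> S)"
proof -
  interpret S: wf_digraph "G \<restriction> S" by (rule wellformed_induce_subgraph)
  show ?thesis
  proof
    show "finite (verts (G \<restriction> S))" "finite (arcs (G \<restriction> S))"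
      using assms by (auto intro: finite_subset)
    show "symmetric (G \<restriction> S)"
      using sym_arcs by (auto simp: symmetric_def sym_def)
    show "tail (G \<restriction> S) e \<noteq> head (G \<restriction> S) e" if "e \<in> arcs (G \<restriction> S)" for e
      using that no_loops by simp
    show "e1 = e2" if "e1 \<in> arcs (G \<restriction> S)" "e2 \<in> arcs (G \<restriction> S)"
      "arc_to_ends (G \<restriction> S) e1 = arc_to_ends (G \<restriction> S) e2" for e1 e2
      using that no_multi_arcs[of e1 e2] by (simp add: arc_to_ends_def)
  qed
qed

text \<open>With the sublocale below, every result on \<Gamma> is available a second time, under the
  prefix \<open>S\<close>, for the full subgraph.\<close>

locale raag_full_subgraph = raag_graph \<Gamma> for \<Gamma> :: "('v, 'e) pre_digraph" +
  fixes S :: "'v set"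
  assumes S_verts: "S \<subseteq> verts \<Gamma>"

sublocale raag_full_subgraph \<subseteq> S: raag_graph "\<Gamma> \<restriction> S"
  unfolding raag_graph_def by (rule graph_induce_subgraph[OF S_verts])

context raag_full_subgraph
begin

lemma link_induce: "i \<in> S \<Longrightarrow> link (\<Gamma> \<restriction> S) i = link \<Gamma> i \<inter> S"
  using link_verts by (auto simp: link_def)

lemma star_induce: "i \<in> S \<Longrightarrow> star (\<Gamma> \<restriction> S) i = star \<Gamma> i \<inter> S"
  by (auto simp: star_def link_induce)

lemma raag_eq_induce: "raag_eq (\<Gamma> \<restriction> S) x y \<Longrightarrow> raag_eq \<Gamma> x y"
proof (induction rule: raag_eq.induct)
  case (refl x)
  then show ?case using S_verts by (intro raag_eq.refl) (auto simp: words_def)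
next
  case (sym x y)
  then show ?case by (blast intro: raag_eq.sym)
next
  case (trans x y z)
  then show ?case by (blast intro: raag_eq.trans)
next
  case (append x x' y y')
  then show ?case by (blast intro: raag_eq.append)
next
  case (cancel v b)
  then show ?case using S_verts by (intro raag_eq.cancel) auto
next
  case (commute v w)
  then show ?case using S_verts by (intro raag_eq.commute) auto
qed

text \<open>A relation of the subgraph is a relation of \<Gamma>, so the words equivalent in
  \<Gamma> to some member of the small class form a single class of \<Gamma>.\<close>

lemma raag_emb_word_class:
  assumes "w \<in> words (\<Gamma> \<restriction> S)"
  shows "raag_emb \<Gamma> (word_class (\<Gamma> \<restriction> S) w) = word_class \<Gamma> w"
proof (intro equalityI subsetI)
  fix x assume "x \<in> raag_emb \<Gamma> (word_class (\<Gamma> \<restriction> S) w)"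
  then obtain y where "raag_eq (\<Gamma> \<restriction> S) w y" "raag_eq \<Gamma> y x"
    by (auto simp: raag_emb_def word_class_def raag_rel_def)
  then have "raag_eq \<Gamma> w x" using raag_eq_induce raag_eq.trans by blast
  then show "x \<in> word_class \<Gamma> w" by (simp add: word_class_def raag_rel_def)
next
  fix x assume "x \<in> word_class \<Gamma> w"
  moreover have "w \<in> word_class (\<Gamma> \<restriction> S) w"
    using raag_eq.refl[OF assms] by (simp add: word_class_def raag_rel_def)
  ultimately show "x \<in> raag_emb \<Gamma> (word_class (\<Gamma> \<restriction> S) w)"
    by (auto simp: raag_emb_def word_class_def raag_rel_def)
qed

lemma words_induce: "w \<in> words (\<Gamma> \<restriction> S) \<Longrightarrow> w \<in> words \<Gamma>"
  using S_verts by (auto simp: words_def)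

lemma raag_emb_hom: "raag_emb \<Gamma> \<in> hom (raag (\<Gamma> \<restriction> S)) (raag \<Gamma>)"
  by (rule homI) (auto simp: carrier_raag mult_word_class raag_emb_word_class words_induce)

lemma raag_emb_gen: "k \<in> S \<Longrightarrow> raag_emb \<Gamma> (gen (\<Gamma> \<restriction> S) k) = gen \<Gamma> k"
  by (simp add: gen_eq_word_class raag_emb_word_class)

lemma raag_emb_closed: "x \<in> carrier (raag (\<Gamma> \<restriction> S)) \<Longrightarrow> raag_emb \<Gamma> x \<in> carrier (raag \<Gamma>)"
  using raag_emb_hom by (auto simp: hom_def)

lemma raag_emb_group_hom: "group_hom (raag (\<Gamma> \<restriction> S)) (raag \<Gamma>) (raag_emb \<Gamma>)"
  by (simp add: group_hom_def group_hom_axioms_def group_raag raag_emb_hom)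

definition retr :: "('v \<times> bool) list set \<Rightarrow> ('v \<times> bool) list set" where
  "retr = raag_lift (raag (\<Gamma> \<restriction> S)) (\<lambda>k. if k \<in> S then gen (\<Gamma> \<restriction> S) k else \<one>\<^bsub>raag (\<Gamma> \<restriction> S)\<^esub>)"

lemma retr_respects_arcs:
  "respects_arcs \<Gamma> (raag (\<Gamma> \<restriction> S)) (\<lambda>k. if k \<in> S then gen (\<Gamma> \<restriction> S) k else \<one>\<^bsub>raag (\<Gamma> \<restriction> S)\<^esub>)"
proof (rule respects_arcsI)
  fix u w assume "w \<in> link \<Gamma> u"
  then show "(if u \<in> S then gen (\<Gamma> \<restriction> S) u else \<one>\<^bsub>raag (\<Gamma> \<restriction> S)\<^esub>) \<otimes>\<^bsub>raag (\<Gamma> \<restriction> S)\<^esub>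
      (if w \<in> S then gen (\<Gamma> \<restriction> S) w else \<one>\<^bsub>raag (\<Gamma> \<restriction> S)\<^esub>) =
      (if w \<in> S then gen (\<Gamma> \<restriction> S) w else \<one>\<^bsub>raag (\<Gamma> \<restriction> S)\<^esub>) \<otimes>\<^bsub>raag (\<Gamma> \<restriction> S)\<^esub>
      (if u \<in> S then gen (\<Gamma> \<restriction> S) u else \<one>\<^bsub>raag (\<Gamma> \<restriction> S)\<^esub>)"
    using gen_commute[of u "\<Gamma> \<restriction> S" w] by (simp add: mem_link_iff gen_closed)
qed (simp add: gen_closed)

lemma retr_hom: "retr \<in> hom (raag \<Gamma>) (raag (\<Gamma> \<restriction> S))"
  unfolding retr_def by (rule S.A.raag_lift_hom[OF retr_respects_arcs])

lemma retr_gen: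
  "k \<in> verts \<Gamma> \<Longrightarrow> retr (gen \<Gamma> k) = (if k \<in> S then gen (\<Gamma> \<restriction> S) k else \<one>\<^bsub>raag (\<Gamma> \<restriction> S)\<^esub>)"
  unfolding retr_def by (rule S.A.raag_lift_gen[OF retr_respects_arcs])

lemma retr_group_hom: "group_hom (raag \<Gamma>) (raag (\<Gamma> \<restriction> S)) retr"
  by (simp add: group_hom_def group_hom_axioms_def group_raag retr_hom)

lemma retr_closed: "x \<in> carrier (raag \<Gamma>) \<Longrightarrow> retr x \<in> carrier (raag (\<Gamma> \<restriction> S))"
  using retr_hom by (auto simp: hom_def)

lemma retr_mult:
  "x \<in> carrier (raag \<Gamma>) \<Longrightarrow> y \<in> carrier (raag \<Gamma>) \<Longrightarrow>
    retr (x \<otimes>\<^bsub>raag \<Gamma>\<^esub> y) = retr x \<otimes>\<^bsub>raag (\<Gamma> \<restriction> S)\<^esub> retr y"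
  using retr_hom by (auto simp: hom_def)

lemma retr_inv:
  "x \<in> carrier (raag \<Gamma>) \<Longrightarrow> retr (inv\<^bsub>raag \<Gamma>\<^esub> x) = inv\<^bsub>raag (\<Gamma> \<restriction> S)\<^esub> retr x"
  by (rule group_hom.hom_inv[OF retr_group_hom])

text \<open>Both sides are homomorphisms agreeing on vertices. The embedding is therefore injective,
  and elements of the image can be recovered by a homomorphism.\<close>

lemma retr_raag_emb:
  assumes "x \<in> carrier (raag (\<Gamma> \<restriction> S))"
  shows "retr (raag_emb \<Gamma> x) = x"
proof -
  have id: "(\<lambda>x. x) \<in> hom (raag (\<Gamma> \<restriction> S)) (raag (\<Gamma> \<restriction> S))" by (auto simp: hom_def)
  have "(retr \<circ> raag_emb \<Gamma>) x = x"
    by (rule S.A.raag_hom_eqI[OF Group.hom_compose[OF raag_emb_hom retr_hom] id _ assms])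
       (use S_verts in \<open>auto simp: raag_emb_gen retr_gen\<close>)
  then show ?thesis by simp
qed

end

section \<open>Subgroups generated by vertices and their images under automorphisms\<close>

context raag_graph
begin

lemma carrier_raag_sub:
  assumes "U \<subseteq> verts \<Gamma>"
  shows "carrier (raag_sub \<Gamma> U) = generate (raag \<Gamma>) (gen \<Gamma> ` U)"
proof -
  have "carrier (raag \<Gamma>) \<inter> gen \<Gamma> ` U = gen \<Gamma> ` U" using assms gen_closed by blast
  then show ?thesis by (simp add: raag_sub_def carrier_subgroup_generated)
qed

lemma subgroup_raag_sub: "U \<subseteq> verts \<Gamma> \<Longrightarrow> subgroup (carrier (raag_sub \<Gamma> U)) (raag \<Gamma>)"
  unfolding carrier_raag_sub by (rule A.generate_is_subgroup) (auto simp: gen_closed)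

lemma gen_in_raag_sub: "U \<subseteq> verts \<Gamma> \<Longrightarrow> k \<in> U \<Longrightarrow> gen \<Gamma> k \<in> carrier (raag_sub \<Gamma> U)"
  by (simp add: carrier_raag_sub generate.incl)

lemma raag_sub_subset:
  assumes "U \<subseteq> verts \<Gamma>" "subgroup K (raag \<Gamma>)" "gen \<Gamma> ` U \<subseteq> K"
  shows "carrier (raag_sub \<Gamma> U) \<subseteq> K"
  unfolding carrier_raag_sub[OF assms(1)] by (rule A.generate_subgroup_incl[OF assms(3,2)])

text \<open>An automorphism may map \<open>A_U\<close> onto a proper subgroup of itself, so the
  images of the generators alone do not suffice; the last hypothesis asks for preimages of the
  generators inside \<open>A_U\<close>.\<close>

lemma auto_image_raag_sub:
  assumes U: "U \<subseteq> verts \<Gamma>" and \<psi>: "\<psi> \<in> auto (raag \<Gamma>)"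
    and "\<And>k. k \<in> U \<Longrightarrow> \<psi> (gen \<Gamma> k) \<in> carrier (raag_sub \<Gamma> U)"
    and "\<And>k. k \<in> U \<Longrightarrow> gen \<Gamma> k \<in> \<psi> ` carrier (raag_sub \<Gamma> U)"
  shows "\<psi> ` carrier (raag_sub \<Gamma> U) = carrier (raag_sub \<Gamma> U)"
proof
  interpret \<psi>: group_hom "raag \<Gamma>" "raag \<Gamma>" \<psi> by (rule A.auto_group_hom[OF \<psi>])
  have sub: "gen \<Gamma> ` U \<subseteq> carrier (raag \<Gamma>)" using U gen_closed by blast
  have "\<psi> ` carrier (raag_sub \<Gamma> U) = generate (raag \<Gamma>) (\<psi> ` gen \<Gamma> ` U)"
    unfolding carrier_raag_sub[OF U] by (rule \<psi>.generate_img[OF sub, symmetric])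
  also have "\<dots> \<subseteq> carrier (raag_sub \<Gamma> U)"
    using assms(3) by (intro A.generate_subgroup_incl[OF _ subgroup_raag_sub[OF U]]) blast
  finally show "\<psi> ` carrier (raag_sub \<Gamma> U) \<subseteq> carrier (raag_sub \<Gamma> U)" .
  have "subgroup (\<psi> ` carrier (raag_sub \<Gamma> U)) (raag \<Gamma>)"
    by (rule \<psi>.subgroup_img_is_subgroup[OF subgroup_raag_sub[OF U]])
  with assms(4) show "carrier (raag_sub \<Gamma> U) \<subseteq> \<psi> ` carrier (raag_sub \<Gamma> U)"
    by (intro raag_sub_subset[OF U]) blast+
qed

end

subsection \<open>Maximal classes and their links\<close>

lemma std_le_refl: "std_le \<Gamma> u u"
  by (auto simp: std_le_def star_def)

context raag_graph
begin

lemma std_le_trans: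
  assumes "std_le \<Gamma> u w" "std_le \<Gamma> w z"
  shows "std_le \<Gamma> u z"
  unfolding std_le_def
proof
  fix x assume x: "x \<in> link \<Gamma> u"
  then have "x \<in> star \<Gamma> w" using assms(1) by (auto simp: std_le_def)
  then consider "x = w" | "x \<in> link \<Gamma> w" by (auto simp: star_def)
  then show "x \<in> star \<Gamma> z"
  proof cases
    \<comment> \<open>The delicate case, where the neighbour of \<open>u\<close> is \<open>w\<close>
      itself. Then \<open>u\<close> \<in> lk(w) \<subseteq> st(z). Either \<open>u = z\<close>, and
      \<open>x\<close> is adjacent to \<open>z\<close>, or \<open>z\<close> \<in> lk(u) \<subseteq>
      st(w), and symmetry puts \<open>w\<close> into st(z).\<close>
    case 1
    then have "u \<in> link \<Gamma> w" using x link_sym by blast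
    then have "u \<in> star \<Gamma> z" using assms(2) by (auto simp: std_le_def)
    then consider "u = z" | "z \<in> link \<Gamma> u" using link_sym by (auto simp: star_def)
    then show ?thesis
    proof cases
      case 1
      then show ?thesis using x by (simp add: star_def)
    next
      case 2
      then have "z \<in> star \<Gamma> w" using assms(1) by (auto simp: std_le_def)
      then show ?thesis using \<open>x = w\<close> star_sym by blast
    qed
  next
    case 2
    then show ?thesis using assms(2) by (auto simp: std_le_def)
  qed
qed

end

locale raag_projection = raag_graph \<Gamma> for \<Gamma> :: "('v, 'e) pre_digraph" +
  fixes v :: 'v
  assumes maximal: "maximal_vertex \<Gamma> v"
begin

abbreviation X :: "'v set" where "X \<equiv> std_class \<Gamma> v"
abbreviation K :: "'v set" where "K \<equiv> link_set \<Gamma> X"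
abbreviation L :: "('v, 'e) pre_digraph" where "L \<equiv> \<Gamma> \<restriction> K"

end

sublocale raag_projection \<subseteq> raag_full_subgraph \<Gamma> "link_set \<Gamma> (std_class \<Gamma> v)"
  by unfold_locales (auto simp: link_set_def)

context raag_projection
begin

lemma X_verts: "X \<subseteq> verts \<Gamma>"
  by (auto simp: std_class_def)

lemma star_set_verts: "star_set \<Gamma> X \<subseteq> verts \<Gamma>"
  using X_verts S_verts by (simp add: star_set_def)

lemma X_K_adjacent: "x \<in> X \<Longrightarrow> l \<in> K \<Longrightarrow> l \<in> link \<Gamma> x"
  by (simp add: link_set_def)

lemma X_K_disjoint: "x \<in> X \<Longrightarrow> x \<notin> K"
  using X_K_adjacent link_irrefl by blast

text \<open>The form in which maximality of \<open>v\<close> enters all later arguments.\<close>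

lemma X_up_closed:
  assumes "x \<in> X" "j \<in> verts \<Gamma>" "std_le \<Gamma> x j"
  shows "j \<in> X"
proof -
  have "std_le \<Gamma> v j" using assms std_le_trans by (auto simp: std_class_def)
  then show ?thesis using maximal assms(2) by (auto simp: std_class_def maximal_vertex_def)
qed

lemma mem_K_if_star:
  assumes "j \<in> verts \<Gamma>" "j \<notin> X" "X \<subseteq> star \<Gamma> j"
  shows "j \<in> K"
  unfolding link_set_def
proof (intro IntI INT_I)
  fix x assume x: "x \<in> X"
  then have "j \<in> star \<Gamma> x" using assms(3) star_sym by blast
  moreover have "j \<noteq> x" using x assms(2) by blast
  ultimately show "j \<in> link \<Gamma> x" by (simp add: star_def)
qed (fact assms(1))

text \<open>Here [v] \<subseteq> lk(i) \<subseteq> st(j), so \<open>j\<close> is adjacent to all of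
  [v] unless it belongs to [v]. Thus no transvection leads from lk[v] out of st[v].\<close>

lemma transvection_from_K:
  assumes "i \<in> K" "transvection_defined \<Gamma> i j"
  shows "j \<in> X \<or> (j \<in> K \<and> transvection_defined L i j)"
proof (cases "j \<in> X")
  case False
  have j: "j \<in> verts \<Gamma>" "link \<Gamma> i \<subseteq> star \<Gamma> j" "i \<noteq> j"
    using assms(2) by (auto simp: transvection_defined_def)
  have "X \<subseteq> link \<Gamma> i" using X_K_adjacent[OF _ assms(1)] link_sym by blast
  then have "j \<in> K" using mem_K_if_star[OF j(1) False] j(2) by blast
  moreover have "link L i \<subseteq> star L j"
    using j(2) assms(1) \<open>j \<in> K\<close> by (auto simp: link_induce star_induce)
  ultimately show ?thesis using assms(1) j(3) by (simp add: transvection_defined_def)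
qed simp

text \<open>A single component may fall apart after intersection with \<open>K\<close>; being closed
  under adjacency outside the star nevertheless passes to the intersection.\<close>

lemma component_union_K:
  assumes "j \<in> K" "component_union j U"
  shows "S.component_union j (U \<inter> K)"
  using assms unfolding component_union_def S.component_union_def
  by (auto simp: link_induce star_induce)

text \<open>Maximality of \<open>[v]\<close> makes \<open>st[v] - st(j)\<close> connected in \<open>\<Gamma> - st(j)\<close>.\<close>

lemma component_union_star_set:
  assumes j: "j \<in> verts \<Gamma>" "j \<notin> star_set \<Gamma> X" and U: "component_union j U"
  shows "star_set \<Gamma> X - star \<Gamma> j \<subseteq> U \<or> star_set \<Gamma> X \<inter> U = {}"
proof -
  have UD: "\<And>u. u \<in> U \<Longrightarrow> u \<notin> star \<Gamma> j" using U by (auto simp: component_union_def)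
  have step: "u \<in> U \<longleftrightarrow> w \<in> U" if "w \<in> link \<Gamma> u" "u \<notin> star \<Gamma> j" "w \<notin> star \<Gamma> j" for u w
    using that U link_sym[of w u] unfolding component_union_def by blast
  have jX: "j \<notin> X" and jK: "j \<notin> K" using j(2) by (auto simp: star_set_def)
  then have "\<not> X \<subseteq> star \<Gamma> j" using mem_K_if_star[OF j(1)] by blast
  \<comment> \<open>This \<open>x\<close> serves as a hub: every other vertex of st[v] - st(j) is
    joined to it by a path of length at most two avoiding st(j).\<close>
  then obtain x where x: "x \<in> X" "x \<notin> star \<Gamma> j" by blast
  have "x \<in> U \<longleftrightarrow> y \<in> U" if y: "y \<in> star_set \<Gamma> X" "y \<notin> star \<Gamma> j" for y
  proof (cases "y \<in> K \<or> y \<in> link \<Gamma> x")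
    case True
    then have "y \<in> link \<Gamma> x" using X_K_adjacent[OF x(1)] by blast
    then show ?thesis using step x y by blast
  next
    case False
    then have "y \<in> X" using y by (simp add: star_set_def)
    then have "std_le \<Gamma> x y" using x(1) std_le_trans by (auto simp: std_class_def)
    moreover have "\<not> std_le \<Gamma> x j" using X_up_closed[OF x(1) j(1)] jX by blast
    \<comment> \<open>From \<open>x\<close> \<le> \<open>y\<close> but not \<open>x\<close> \<le>
      \<open>j\<close>, some neighbour of \<open>x\<close> lies outside st(j), and all neighbours of
      \<open>x\<close> lie in st(y). The path is \<open>x\<close>, \<open>l\<close>,
      \<open>y\<close>.\<close>
    ultimately obtain l where l: "l \<in> link \<Gamma> x" "l \<notin> star \<Gamma> j" "l \<in> star \<Gamma> y"
      unfolding std_le_def by blast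
    have "l \<noteq> y" using False l(1) by blast
    then have "l \<in> link \<Gamma> y" using l(3) by (simp add: star_def)
    then show ?thesis using step[OF l(1) x(2) l(2)] step[OF _ y(2) l(2)] by blast
  qed
  then show ?thesis using UD by blast
qed

subsection \<open>The projection\<close>

abbreviation N :: "('v \<times> bool) list set set" where
  "N \<equiv> carrier (raag_sub \<Gamma> X)"
abbreviation H :: "('v \<times> bool) list set set" where
  "H \<equiv> carrier (raag_sub \<Gamma> (star_set \<Gamma> X))"

lemma N_carrier: "n \<in> N \<Longrightarrow> n \<in> carrier (raag \<Gamma>)"
  using subgroup.subset[OF subgroup_raag_sub[OF X_verts]] by blast

lemma H_carrier: "H \<subseteq> carrier (raag \<Gamma>)"
  by (rule subgroup.subset[OF subgroup_raag_sub[OF star_set_verts]])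

lemma gen_in_H: "k \<in> star_set \<Gamma> X \<Longrightarrow> gen \<Gamma> k \<in> H"
  by (rule gen_in_raag_sub[OF star_set_verts])

lemma gen_in_N: "k \<in> X \<Longrightarrow> gen \<Gamma> k \<in> N"
  by (rule gen_in_raag_sub[OF X_verts])

lemma retr_N:
  assumes "n \<in> N" shows "retr n = \<one>\<^bsub>raag L\<^esub>"
proof -
  interpret r: group_hom "raag \<Gamma>" "raag L" retr by (rule retr_group_hom)
  have "gen \<Gamma> ` X \<subseteq> kernel (raag \<Gamma>) (raag L) retr"
  proof
    fix y assume "y \<in> gen \<Gamma> ` X"
    then obtain x where "x \<in> X" "y = gen \<Gamma> x" by blast
    then show "y \<in> kernel (raag \<Gamma>) (raag L) retr"
      using X_verts X_K_disjoint by (auto simp: kernel_def retr_gen gen_closed subset_iff)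
  qed
  from raag_sub_subset[OF X_verts r.subgroup_kernel this] assms
  show ?thesis by (auto simp: kernel_def)
qed

text \<open>Every vertex of [v] is adjacent to every vertex of lk[v]. The commutation is spread by
  an induction over \<open>g\<close> for a fixed vertex of [v], then by one over
  \<open>n\<close>.\<close>

lemma N_commutes:
  assumes "n \<in> N" "g \<in> carrier (raag L)"
  shows "n \<otimes>\<^bsub>raag \<Gamma>\<^esub> raag_emb \<Gamma> g = raag_emb \<Gamma> g \<otimes>\<^bsub>raag \<Gamma>\<^esub> n"
proof -
  interpret e: group_hom "raag L" "raag \<Gamma>" "raag_emb \<Gamma>" by (rule raag_emb_group_hom)
  have gen: "gen \<Gamma> x \<otimes>\<^bsub>raag \<Gamma>\<^esub> raag_emb \<Gamma> g = raag_emb \<Gamma> g \<otimes>\<^bsub>raag \<Gamma>\<^esub> gen \<Gamma> x" if x: "x \<in> X" for x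
  proof -
    have xc: "gen \<Gamma> x \<in> carrier (raag \<Gamma>)" using x X_verts by blast
    have l: "gen \<Gamma> x \<otimes>\<^bsub>raag \<Gamma>\<^esub> gen \<Gamma> l = gen \<Gamma> l \<otimes>\<^bsub>raag \<Gamma>\<^esub> gen \<Gamma> x"
      "gen \<Gamma> l \<in> carrier (raag \<Gamma>)" if "l \<in> K" for l
      using gen_commute_star[of x l] X_K_adjacent[OF x that] X_verts S_verts x that
      by (auto simp: star_def)
    show ?thesis using assms(2)
    proof (induction g rule: raag_induct)
      case one
      then show ?case using xc by simp
    next
      case (gen k y)
      then show ?case using xc l[of k]
        by (simp add: raag_emb_gen gen_closed A.commute_mult)
    next
      case (inv_gen k y)
      then show ?case using xc l[of k]
        by (simp add: raag_emb_gen gen_closed A.commute_mult A.commute_inv)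
    qed
  qed
  have gc: "raag_emb \<Gamma> g \<in> carrier (raag \<Gamma>)" using assms(2) by simp
  from assms(1) show ?thesis
    unfolding carrier_raag_sub[OF X_verts]
  proof (induction rule: generate.induct)
    case one
    then show ?case using gc by simp
  next
    case (incl h)
    then show ?case using gen by blast
  next
    case (inv h)
    then obtain x where x: "x \<in> X" "h = gen \<Gamma> x" by blast
    have "h \<in> carrier (raag \<Gamma>)" using x X_verts by blast
    then show ?case using A.commute_inv[OF gc, of h] gen[OF x(1)] x(2) by simp
  next
    case (eng h1 h2)
    have "h1 \<in> carrier (raag \<Gamma>)" "h2 \<in> carrier (raag \<Gamma>)"
      using eng N_carrier by (simp_all add: carrier_raag_sub[OF X_verts])
    then show ?case using A.commute_mult[OF gc, of h1 h2] eng by simp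
  qed
qed

text \<open>The factorization A_st[v] = A_[v] A_lk[v]. Existence of some factors comes by induction
  over the generators of A_st[v], using commutation to merge two products.\<close>

lemma H_decompose:
  assumes "h \<in> H"
  shows "h \<in> N #>\<^bsub>raag \<Gamma>\<^esub> raag_emb \<Gamma> (retr h)"
proof -
  interpret e: group_hom "raag L" "raag \<Gamma>" "raag_emb \<Gamma>" by (rule raag_emb_group_hom)
  interpret N: subgroup N "raag \<Gamma>" by (rule subgroup_raag_sub[OF X_verts])
  have "\<exists>n\<in>N. \<exists>g\<in>carrier (raag L). h = n \<otimes>\<^bsub>raag \<Gamma>\<^esub> raag_emb \<Gamma> g"
    using assms unfolding carrier_raag_sub[OF star_set_verts]
  proof (induction rule: generate.induct)
    case one
    show ?case by (rule bexI[of _ "\<one>\<^bsub>raag \<Gamma>\<^esub>"], rule bexI[of _ "\<one>\<^bsub>raag L\<^esub>"]) simp_all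
  next
    case (incl h)
    then obtain k where k: "k \<in> star_set \<Gamma> X" "h = gen \<Gamma> k" by blast
    then consider "k \<in> X" | "k \<in> K" by (auto simp: star_set_def)
    then show ?case
    proof cases
      case 1
      then show ?thesis using k gen_in_N[of k] N_carrier
        by (intro bexI[of _ h] bexI[of _ "\<one>\<^bsub>raag L\<^esub>"]) simp_all
    next
      case 2
      then show ?thesis using k S_verts
        by (intro bexI[of _ "\<one>\<^bsub>raag \<Gamma>\<^esub>"] bexI[of _ "gen L k"]) (auto simp: raag_emb_gen gen_closed)
    qed
  next
    case (inv h)
    then obtain k where k: "k \<in> star_set \<Gamma> X" "h = gen \<Gamma> k" by blast
    then consider "k \<in> X" | "k \<in> K" by (auto simp: star_set_def)
    then show ?case
    proof cases
      case 1
      then show ?thesis using k gen_in_N[of k] N_carrier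
        by (intro bexI[of _ "inv\<^bsub>raag \<Gamma>\<^esub> h"] bexI[of _ "\<one>\<^bsub>raag L\<^esub>"]) simp_all
    next
      case 2
      then have "gen \<Gamma> k \<in> carrier (raag \<Gamma>)" using S_verts by blast
      with 2 show ?thesis using k
        by (intro bexI[of _ "\<one>\<^bsub>raag \<Gamma>\<^esub>"] bexI[of _ "inv\<^bsub>raag L\<^esub> gen L k"]) (auto simp: raag_emb_gen gen_closed)
    qed
  next
    case (eng h1 h2)
    then obtain n1 g1 n2 g2 where 1: "n1 \<in> N" "g1 \<in> carrier (raag L)" "h1 = n1 \<otimes>\<^bsub>raag \<Gamma>\<^esub> raag_emb \<Gamma> g1"
      and 2: "n2 \<in> N" "g2 \<in> carrier (raag L)" "h2 = n2 \<otimes>\<^bsub>raag \<Gamma>\<^esub> raag_emb \<Gamma> g2" by blast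
    have c: "n1 \<in> carrier (raag \<Gamma>)" "n2 \<in> carrier (raag \<Gamma>)"
      "raag_emb \<Gamma> g1 \<in> carrier (raag \<Gamma>)" "raag_emb \<Gamma> g2 \<in> carrier (raag \<Gamma>)"
      using 1 2 N_carrier by simp_all
    have "h1 \<otimes>\<^bsub>raag \<Gamma>\<^esub> h2 = n1 \<otimes>\<^bsub>raag \<Gamma>\<^esub> (raag_emb \<Gamma> g1 \<otimes>\<^bsub>raag \<Gamma>\<^esub> n2) \<otimes>\<^bsub>raag \<Gamma>\<^esub> raag_emb \<Gamma> g2"
      using c by (simp add: 1(3) 2(3) A.m_assoc)
    also have "\<dots> = (n1 \<otimes>\<^bsub>raag \<Gamma>\<^esub> n2) \<otimes>\<^bsub>raag \<Gamma>\<^esub> raag_emb \<Gamma> (g1 \<otimes>\<^bsub>raag L\<^esub> g2)"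
      using c 1(2) 2(2) by (simp add: N_commutes[OF 2(1) 1(2), symmetric] A.m_assoc)
    finally show ?case using 1 2 by blast
  qed
  then obtain n g where n: "n \<in> N" and g: "g \<in> carrier (raag L)" and h: "h = n \<otimes>\<^bsub>raag \<Gamma>\<^esub> raag_emb \<Gamma> g"
    by blast
  \<comment> \<open>The retraction kills the factor in A_[v], so the other factor is forced.\<close>
  have "retr h = g"
    using n g N_carrier[OF n] by (simp add: h retr_mult retr_N retr_raag_emb raag_emb_closed)
  then show ?thesis using n h by (auto simp: r_coset_def)
qed

lemma retr_N_coset:
  assumes "g \<in> carrier (raag L)" "h \<in> N #>\<^bsub>raag \<Gamma>\<^esub> raag_emb \<Gamma> g"
  shows "retr h = g"
proof -
  obtain n where "n \<in> N" "h = n \<otimes>\<^bsub>raag \<Gamma>\<^esub> raag_emb \<Gamma> g" using assms(2) by (auto simp: r_coset_def)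
  then show ?thesis
    using assms(1) N_carrier by (simp add: retr_mult retr_N retr_raag_emb raag_emb_closed)
qed

lemma auto_image_coset:
  assumes "\<psi> \<in> auto (raag \<Gamma>)" "\<psi> ` N = N" "x \<in> carrier (raag \<Gamma>)"
  shows "\<psi> ` (N #>\<^bsub>raag \<Gamma>\<^esub> x) = N #>\<^bsub>raag \<Gamma>\<^esub> \<psi> x"
proof -
  have coset: "N #>\<^bsub>raag \<Gamma>\<^esub> y = (\<lambda>n. n \<otimes>\<^bsub>raag \<Gamma>\<^esub> y) ` N" for y by (auto simp: r_coset_def)
  have "\<psi> ` (N #>\<^bsub>raag \<Gamma>\<^esub> x) = (\<lambda>n. n \<otimes>\<^bsub>raag \<Gamma>\<^esub> \<psi> x) ` \<psi> ` N"
    unfolding coset image_image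
    using assms(1,3) N_carrier by (intro image_cong) (auto simp: A.auto_mult)
  then show ?thesis by (simp add: assms(2) coset)
qed

lemma N_coset_eqI:
  assumes "h \<in> H"
  shows "N #>\<^bsub>raag \<Gamma>\<^esub> h = N #>\<^bsub>raag \<Gamma>\<^esub> raag_emb \<Gamma> (retr h)"
  using A.repr_independence[OF H_decompose[OF assms] _ subgroup_raag_sub[OF X_verts]]
    raag_emb_closed retr_closed H_carrier assms by blast

lemma emb_in_H:
  assumes "g \<in> carrier (raag L)"
  shows "raag_emb \<Gamma> g \<in> H"
proof -
  interpret e: group_hom "raag L" "raag \<Gamma>" "raag_emb \<Gamma>" by (rule raag_emb_group_hom)
  interpret H: subgroup H "raag \<Gamma>" by (rule subgroup_raag_sub[OF star_set_verts])
  have l: "gen \<Gamma> k \<in> H" if "k \<in> K" for k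
    using that by (intro gen_in_H) (simp add: star_set_def)
  show ?thesis using assms
  proof (induction g rule: raag_induct)
    case one
    then show ?case by simp
  next
    case (gen k y)
    then show ?case using l[of k] by (simp add: raag_emb_gen gen_closed)
  next
    case (inv_gen k y)
    then show ?case using l[of k] by (simp add: raag_emb_gen gen_closed)
  qed
qed

lemma induces_on_linkD:
  assumes "induces_on_link \<Gamma> v \<psi> \<theta>"
  shows "\<psi> ` H = H" "\<psi> ` N = N" "\<theta> \<in> auto (raag L)"
    "g \<in> carrier (raag L) \<Longrightarrow> \<psi> ` (N #>\<^bsub>raag \<Gamma>\<^esub> raag_emb \<Gamma> g) = N #>\<^bsub>raag \<Gamma>\<^esub> raag_emb \<Gamma> (\<theta> g)"
  using assms by (simp_all add: induces_on_link_def Let_def)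

text \<open>The condition on cosets amounts to the identity of homomorphisms
  \<open>retr \<circ> \<psi> \<circ> raag_emb \<Gamma>\<close> = \<theta>, because a coset of A_[v]
  in A_st[v] is determined by its value under \<open>retr\<close>. Such an identity need only be
  checked on vertices.\<close>

lemma induces_on_linkI:
  assumes \<psi>: "\<psi> \<in> auto (raag \<Gamma>)" "\<psi> ` H = H" "\<psi> ` N = N" and \<theta>: "\<theta> \<in> auto (raag L)"
    and eq: "\<And>l. l \<in> K \<Longrightarrow> retr (\<psi> (gen \<Gamma> l)) = \<theta> (gen L l)"
  shows "induces_on_link \<Gamma> v \<psi> \<theta>"
proof -
  have "\<psi> ` (N #>\<^bsub>raag \<Gamma>\<^esub> raag_emb \<Gamma> g) = N #>\<^bsub>raag \<Gamma>\<^esub> raag_emb \<Gamma> (\<theta> g)" if g: "g \<in> carrier (raag L)" for g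
  proof -
    have "(retr \<circ> (\<psi> \<circ> raag_emb \<Gamma>)) g = \<theta> g"
      by (rule S.A.raag_hom_eqI[OF
            Group.hom_compose[OF Group.hom_compose[OF raag_emb_hom A.auto_imp_hom[OF \<psi>(1)]] retr_hom] S.A.auto_imp_hom[OF \<theta>] _ g])
         (simp add: raag_emb_gen eq)
    moreover have "\<psi> (raag_emb \<Gamma> g) \<in> H" using \<psi>(2) emb_in_H[OF g] by blast
    ultimately show ?thesis
      using auto_image_coset[OF \<psi>(1,3) raag_emb_closed[OF g]] N_coset_eqI by simp
  qed
  with assms show ?thesis by (simp add: induces_on_link_def Let_def)
qed

text \<open>The converse of \<open>induces_on_linkI\<close>: an explicit formula, hence uniqueness
  of \<theta> for given \<psi>.\<close>

lemma induces_on_link_eq: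
  assumes "induces_on_link \<Gamma> v \<psi> \<theta>" "g \<in> carrier (raag L)"
  shows "\<theta> g = retr (\<psi> (raag_emb \<Gamma> g))"
proof -
  interpret N: subgroup N "raag \<Gamma>" by (rule subgroup_raag_sub[OF X_verts])
  have "raag_emb \<Gamma> g \<in> N #>\<^bsub>raag \<Gamma>\<^esub> raag_emb \<Gamma> g"
    using A.rcos_self[OF raag_emb_closed[OF assms(2)] N.subgroup_axioms] .
  then have "\<psi> (raag_emb \<Gamma> g) \<in> N #>\<^bsub>raag \<Gamma>\<^esub> raag_emb \<Gamma> (\<theta> g)"
    using induces_on_linkD(4)[OF assms] by blast
  moreover have "\<theta> g \<in> carrier (raag L)"
    using S.A.auto_closed[OF induces_on_linkD(3)[OF assms(1)] assms(2)] .
  ultimately show ?thesis using retr_N_coset by simp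
qed

text \<open>The element \<open>g\<close> ranges over all of A_\<Gamma>. Since \<open>retr\<close> is
  defined there too, the formulas for \<theta> and \<theta>' can be compared without knowing where
  \<open>g\<close> lies.\<close>

lemma induces_on_link_conj:
  assumes \<psi>: "\<psi> \<in> auto (raag \<Gamma>)" and g: "g \<in> carrier (raag \<Gamma>)"
    and \<theta>: "induces_on_link \<Gamma> v \<psi> \<theta>"
    and \<theta>': "induces_on_link \<Gamma> v (A.conj_aut g \<otimes>\<^bsub>AutoGroup (raag \<Gamma>)\<^esub> \<psi>) \<theta>'"
  shows "out_class (raag L) \<theta>' = out_class (raag L) \<theta>"
proof -
  have auto: "\<theta> \<in> auto (raag L)" "\<theta>' \<in> auto (raag L)" using \<theta> \<theta>' induces_on_linkD(3) by blast+
  have rg: "retr g \<in> carrier (raag L)" using g by (rule retr_closed)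
  have "\<theta>' = S.A.conj_aut (retr g) \<otimes>\<^bsub>AutoGroup (raag L)\<^esub> \<theta>"
  proof (rule S.A.auto_eqI)
    fix x assume x: "x \<in> carrier (raag L)"
    have c: "\<psi> (raag_emb \<Gamma> x) \<in> carrier (raag \<Gamma>)"
      using A.auto_closed[OF \<psi> raag_emb_closed[OF x]] .
    show "\<theta>' x = (S.A.conj_aut (retr g) \<otimes>\<^bsub>AutoGroup (raag L)\<^esub> \<theta>) x"
      using c g x rg
      by (simp add: induces_on_link_eq[OF \<theta>'] induces_on_link_eq[OF \<theta>]
          A.mult_AutoGroup_apply[OF A.conj_aut_closed[OF g] \<psi>] raag_emb_closed A.conj_aut_apply retr_mult retr_inv
          S.A.mult_AutoGroup_apply[OF S.A.conj_aut_closed[OF rg] auto(1)] S.A.conj_aut_apply retr_closed)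
  qed (use auto rg in \<open>auto intro: S.A.mult_AutoGroup_closed S.A.conj_aut_closed\<close>)
  then show ?thesis using S.A.conj_aut_mult_out_class[OF auto(1) rg] by simp
qed

text \<open>Discharges the definite description: any two suitable representatives of the class
  differ by an inner automorphism and so induce the same outer class.\<close>

lemma projection_eq:
  assumes "\<Phi> \<in> Out0 \<Gamma>" "\<psi> \<in> \<Phi>" "induces_on_link \<Gamma> v \<psi> \<theta>"
  shows "projection \<Gamma> v \<Phi> = out_class (raag L) \<theta>"
proof -
  obtain \<phi> where \<phi>: "\<phi> \<in> auto (raag \<Gamma>)" "\<Phi> = out_class (raag \<Gamma>) \<phi>"
    using assms(1) subgroup.subset[OF subgroup_Out0] by (auto simp: A.carrier_Out)
  have \<psi>: "\<psi> \<in> auto (raag \<Gamma>)" using A.mem_out_class_auto[OF \<phi>(1)] assms(2) \<phi>(2) by blast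
  have \<Phi>: "\<Phi> = out_class (raag \<Gamma>) \<psi>" using A.mem_out_class_imp_eq[OF \<phi>(1)] assms(2) \<phi>(2) by blast
  have uniq: "out_class (raag L) \<theta>' = out_class (raag L) \<theta>"
    if \<psi>': "\<psi>' \<in> \<Phi>" and \<theta>': "induces_on_link \<Gamma> v \<psi>' \<theta>'" for \<psi>' \<theta>'
  proof -
    obtain g where g: "g \<in> carrier (raag \<Gamma>)" "\<psi>' = A.conj_aut g \<otimes>\<^bsub>AutoGroup (raag \<Gamma>)\<^esub> \<psi>"
      using \<psi>' unfolding \<Phi> A.mem_out_class_iff[OF \<psi>] by blast
    show ?thesis using induces_on_link_conj[OF \<psi> g(1) assms(3)] \<theta>' g(2) by simp
  qed
  have "(THE \<Psi>. \<exists>\<psi>\<in>\<Phi>. \<exists>\<theta>. induces_on_link \<Gamma> v \<psi> \<theta> \<and> \<Psi> = out_class (raag L) \<theta>) = out_class (raag L) \<theta>"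
    using assms(2,3) uniq by (intro the_equality) blast+
  then show ?thesis using assms(1) by (simp add: projection_def)
qed

lemma induces_on_link_one:
  "induces_on_link \<Gamma> v \<one>\<^bsub>AutoGroup (raag \<Gamma>)\<^esub> \<one>\<^bsub>AutoGroup (raag L)\<^esub>"
proof (rule induces_on_linkI)
  show "\<one>\<^bsub>AutoGroup (raag \<Gamma>)\<^esub> \<in> auto (raag \<Gamma>)" "\<one>\<^bsub>AutoGroup (raag L)\<^esub> \<in> auto (raag L)"
    using A.id_in_auto S.A.id_in_auto by (simp_all add: A.one_AutoGroup S.A.one_AutoGroup)
  show "\<one>\<^bsub>AutoGroup (raag \<Gamma>)\<^esub> ` H = H"
    using H_carrier by (force simp: A.one_AutoGroup)
  show "\<one>\<^bsub>AutoGroup (raag \<Gamma>)\<^esub> ` N = N"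
    using N_carrier by (force simp: A.one_AutoGroup)
  show "retr (\<one>\<^bsub>AutoGroup (raag \<Gamma>)\<^esub> (gen \<Gamma> l)) = \<one>\<^bsub>AutoGroup (raag L)\<^esub> (gen L l)" if "l \<in> K" for l
    using that S_verts by (auto simp: A.one_AutoGroup S.A.one_AutoGroup gen_closed retr_gen subset_iff)
qed

lemma induces_on_link_mult:
  assumes \<psi>1: "\<psi>1 \<in> auto (raag \<Gamma>)" and \<psi>2: "\<psi>2 \<in> auto (raag \<Gamma>)"
    and 1: "induces_on_link \<Gamma> v \<psi>1 \<theta>1" and 2: "induces_on_link \<Gamma> v \<psi>2 \<theta>2"
  shows "induces_on_link \<Gamma> v (\<psi>1 \<otimes>\<^bsub>AutoGroup (raag \<Gamma>)\<^esub> \<psi>2) (\<theta>1 \<otimes>\<^bsub>AutoGroup (raag L)\<^esub> \<theta>2)"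
proof -
  note \<theta>1 = induces_on_linkD[OF 1] and \<theta>2 = induces_on_linkD[OF 2]
  have img: "(\<psi>1 \<otimes>\<^bsub>AutoGroup (raag \<Gamma>)\<^esub> \<psi>2) ` Y = \<psi>1 ` \<psi>2 ` Y" if "Y \<subseteq> carrier (raag \<Gamma>)" for Y
    unfolding image_image using that by (intro image_cong) (auto simp: A.mult_AutoGroup_apply[OF \<psi>1 \<psi>2])
  have Nsub: "N \<subseteq> carrier (raag \<Gamma>)" using N_carrier by blast
  have "(\<psi>1 \<otimes>\<^bsub>AutoGroup (raag \<Gamma>)\<^esub> \<psi>2) ` (N #>\<^bsub>raag \<Gamma>\<^esub> raag_emb \<Gamma> g) =
      N #>\<^bsub>raag \<Gamma>\<^esub> raag_emb \<Gamma> ((\<theta>1 \<otimes>\<^bsub>AutoGroup (raag L)\<^esub> \<theta>2) g)" if g: "g \<in> carrier (raag L)" for g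
    using img[OF A.r_coset_subset_G[OF Nsub raag_emb_closed[OF g]]] \<theta>2(4)[OF g]
      \<theta>1(4)[OF S.A.auto_closed[OF \<theta>2(3) g]] g
    by (simp add: S.A.mult_AutoGroup_apply[OF \<theta>1(3) \<theta>2(3)])
  then show ?thesis
    using img[OF H_carrier] img[OF Nsub] \<theta>1(1,2) \<theta>2(1,2) S.A.mult_AutoGroup_closed[OF \<theta>1(3) \<theta>2(3)]
    by (simp add: induces_on_link_def Let_def)
qed

lemma induces_on_link_inv:
  assumes \<psi>: "\<psi> \<in> auto (raag \<Gamma>)" and 1: "induces_on_link \<Gamma> v \<psi> \<theta>"
  shows "induces_on_link \<Gamma> v (inv\<^bsub>AutoGroup (raag \<Gamma>)\<^esub> \<psi>) (inv\<^bsub>AutoGroup (raag L)\<^esub> \<theta>)"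
proof -
  note \<theta> = induces_on_linkD[OF 1]
  have img: "(inv\<^bsub>AutoGroup (raag \<Gamma>)\<^esub> \<psi>) ` \<psi> ` Y = Y" if "Y \<subseteq> carrier (raag \<Gamma>)" for Y
    unfolding image_image using that A.inv_AutoGroup_apply(1)[OF \<psi>] by (auto simp: subset_iff image_iff)
  have Nsub: "N \<subseteq> carrier (raag \<Gamma>)" using N_carrier by blast
  have "(inv\<^bsub>AutoGroup (raag \<Gamma>)\<^esub> \<psi>) ` (N #>\<^bsub>raag \<Gamma>\<^esub> raag_emb \<Gamma> g) =
      N #>\<^bsub>raag \<Gamma>\<^esub> raag_emb \<Gamma> ((inv\<^bsub>AutoGroup (raag L)\<^esub> \<theta>) g)" if g: "g \<in> carrier (raag L)" for g
  proof -
    let ?g = "(inv\<^bsub>AutoGroup (raag L)\<^esub> \<theta>) g"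
    have g': "?g \<in> carrier (raag L)"
      using S.A.auto_closed[OF S.A.inv_AutoGroup_closed[OF \<theta>(3)] g] .
    have "\<theta> ?g = g" using S.A.inv_AutoGroup_apply(2)[OF \<theta>(3) g] .
    then show ?thesis
      using img[OF A.r_coset_subset_G[OF Nsub raag_emb_closed[OF g']]] \<theta>(4)[OF g'] by simp
  qed
  then show ?thesis
    using img[OF H_carrier] img[OF Nsub] \<theta>(1,2) S.A.inv_AutoGroup_closed[OF \<theta>(3)]
    by (simp add: induces_on_link_def Let_def)
qed

end

subsection \<open>The projection of the generators\<close>

context raag_graph
begin

lemma auto_image_raag_sub_fixed:
  assumes "U \<subseteq> verts \<Gamma>" "\<psi> \<in> auto (raag \<Gamma>)" "\<And>k. k \<in> U \<Longrightarrow> \<psi> (gen \<Gamma> k) = gen \<Gamma> k"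
  shows "\<psi> ` carrier (raag_sub \<Gamma> U) = carrier (raag_sub \<Gamma> U)"
proof (rule auto_image_raag_sub[OF assms(1,2)])
  fix k assume k: "k \<in> U"
  show "\<psi> (gen \<Gamma> k) \<in> carrier (raag_sub \<Gamma> U)"
    using gen_in_raag_sub[OF assms(1) k] assms(3)[OF k] by simp
  show "gen \<Gamma> k \<in> \<psi> ` carrier (raag_sub \<Gamma> U)"
    using assms(3)[OF k] gen_in_raag_sub[OF assms(1) k] by (rule image_eqI[OF HOL.sym])
qed

lemma inversion_image_raag_sub:
  assumes U: "U \<subseteq> verts \<Gamma>" and i: "i \<in> verts \<Gamma>"
  shows "inversion \<Gamma> i ` carrier (raag_sub \<Gamma> U) = carrier (raag_sub \<Gamma> U)"
proof (rule auto_image_raag_sub[OF U inversion_auto[OF i]])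
  interpret U: subgroup "carrier (raag_sub \<Gamma> U)" "raag \<Gamma>" by (rule subgroup_raag_sub[OF U])
  fix k assume k: "k \<in> U"
  then have kv: "k \<in> verts \<Gamma>" using U by blast
  have gk: "gen \<Gamma> k \<in> carrier (raag_sub \<Gamma> U)" by (rule gen_in_raag_sub[OF U k])
  then show "inversion \<Gamma> i (gen \<Gamma> k) \<in> carrier (raag_sub \<Gamma> U)"
    by (auto simp: inversion_gen[OF i kv])
  have "inversion \<Gamma> i (if k = i then inv\<^bsub>raag \<Gamma>\<^esub> gen \<Gamma> k else gen \<Gamma> k) = gen \<Gamma> k"
    using kv i by (auto simp: inversion_gen[OF i] A.auto_inv[OF inversion_auto[OF i]] gen_closed)
  moreover have "(if k = i then inv\<^bsub>raag \<Gamma>\<^esub> gen \<Gamma> k else gen \<Gamma> k) \<in> carrier (raag_sub \<Gamma> U)"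
    using gk by auto
  ultimately show "gen \<Gamma> k \<in> inversion \<Gamma> i ` carrier (raag_sub \<Gamma> U)" by (rule image_eqI[OF HOL.sym])
qed

text \<open>Names the preimage of \<open>v_i\<close>. It shows that subgroups are mapped onto
  themselves, and later gives the inverse transvection on vertices;
  \<open>union_conjugation_cancel\<close> plays the same double role.\<close>

lemma transvection_cancel:
  assumes "transvection_defined \<Gamma> i j"
  shows "transvection \<Gamma> i j (gen \<Gamma> i \<otimes>\<^bsub>raag \<Gamma>\<^esub> inv\<^bsub>raag \<Gamma>\<^esub> gen \<Gamma> j) = gen \<Gamma> i"
proof -
  have "i \<in> verts \<Gamma>" "j \<in> verts \<Gamma>" "i \<noteq> j" using assms by (auto simp: transvection_defined_def)
  then show ?thesis
    by (simp add: A.auto_mult[OF transvection_auto[OF assms]] A.auto_inv[OF transvection_auto[OF assms]]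
        gen_closed transvection_gen[OF assms] A.m_assoc)
qed

lemma transvection_image_raag_sub:
  assumes U: "U \<subseteq> verts \<Gamma>" and ij: "transvection_defined \<Gamma> i j" and "i \<in> U \<Longrightarrow> j \<in> U"
  shows "transvection \<Gamma> i j ` carrier (raag_sub \<Gamma> U) = carrier (raag_sub \<Gamma> U)"
proof (rule auto_image_raag_sub[OF U transvection_auto[OF ij]])
  interpret U: subgroup "carrier (raag_sub \<Gamma> U)" "raag \<Gamma>" by (rule subgroup_raag_sub[OF U])
  fix k assume k: "k \<in> U"
  then have kv: "k \<in> verts \<Gamma>" using U by blast
  have gk: "gen \<Gamma> k \<in> carrier (raag_sub \<Gamma> U)" by (rule gen_in_raag_sub[OF U k])
  have gj: "gen \<Gamma> j \<in> carrier (raag_sub \<Gamma> U)" if "k = i"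
    using that k assms(3) gen_in_raag_sub[OF U] by blast
  show "transvection \<Gamma> i j (gen \<Gamma> k) \<in> carrier (raag_sub \<Gamma> U)"
    using gk gj by (auto simp: transvection_gen[OF ij kv])
  show "gen \<Gamma> k \<in> transvection \<Gamma> i j ` carrier (raag_sub \<Gamma> U)"
  proof (cases "k = i")
    case True
    then have "gen \<Gamma> i \<otimes>\<^bsub>raag \<Gamma>\<^esub> inv\<^bsub>raag \<Gamma>\<^esub> gen \<Gamma> j \<in> carrier (raag_sub \<Gamma> U)" using gk gj by simp
    with transvection_cancel[OF ij] show ?thesis unfolding True by (rule image_eqI[OF HOL.sym])
  next
    case False
    then have "transvection \<Gamma> i j (gen \<Gamma> k) = gen \<Gamma> k" by (simp add: transvection_gen[OF ij kv])
    then show ?thesis using gk by (rule image_eqI[OF HOL.sym])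
  qed
qed

lemma union_conjugation_cancel:
  assumes j: "j \<in> verts \<Gamma>" and U: "component_union j U" and k: "k \<in> U"
  shows "union_conjugation j U (inv\<^bsub>raag \<Gamma>\<^esub> gen \<Gamma> j \<otimes>\<^bsub>raag \<Gamma>\<^esub> gen \<Gamma> k \<otimes>\<^bsub>raag \<Gamma>\<^esub> gen \<Gamma> j) = gen \<Gamma> k"
proof -
  have kv: "k \<in> verts \<Gamma>" using U k by (auto simp: component_union_def)
  note auto = union_conjugation_auto[OF j U]
  show ?thesis
    using j kv k by (simp add: A.auto_mult[OF auto] A.auto_inv[OF auto]
        gen_closed union_conjugation_fixes[OF j U] union_conjugation_gen[OF j U kv] A.m_assoc)
qed

lemma union_conjugation_image_raag_sub:
  assumes W: "W \<subseteq> verts \<Gamma>" and j: "j \<in> W" and U: "component_union j U"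
  shows "union_conjugation j U ` carrier (raag_sub \<Gamma> W) = carrier (raag_sub \<Gamma> W)"
proof -
  have jv: "j \<in> verts \<Gamma>" using j W by blast
  note auto = union_conjugation_auto[OF jv U]
  show ?thesis
  proof (rule auto_image_raag_sub[OF W auto])
    interpret W: subgroup "carrier (raag_sub \<Gamma> W)" "raag \<Gamma>" by (rule subgroup_raag_sub[OF W])
    fix k assume k: "k \<in> W"
    then have kv: "k \<in> verts \<Gamma>" using W by blast
    have gk: "gen \<Gamma> k \<in> carrier (raag_sub \<Gamma> W)" by (rule gen_in_raag_sub[OF W k])
    have gj: "gen \<Gamma> j \<in> carrier (raag_sub \<Gamma> W)" by (rule gen_in_raag_sub[OF W j])
    show "union_conjugation j U (gen \<Gamma> k) \<in> carrier (raag_sub \<Gamma> W)"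
      using gk gj by (simp add: union_conjugation_gen[OF jv U kv])
    show "gen \<Gamma> k \<in> union_conjugation j U ` carrier (raag_sub \<Gamma> W)"
    proof (cases "k \<in> U")
      case True
      have "inv\<^bsub>raag \<Gamma>\<^esub> gen \<Gamma> j \<otimes>\<^bsub>raag \<Gamma>\<^esub> gen \<Gamma> k \<otimes>\<^bsub>raag \<Gamma>\<^esub> gen \<Gamma> j \<in> carrier (raag_sub \<Gamma> W)"
        using gk gj by simp
      with union_conjugation_cancel[OF jv U True] show ?thesis by (rule image_eqI[OF HOL.sym])
    next
      case False
      then have "union_conjugation j U (gen \<Gamma> k) = gen \<Gamma> k" by (simp add: union_conjugation_gen[OF jv U kv])
      then show ?thesis using gk by (rule image_eqI[OF HOL.sym])
    qed
  qed
qed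

lemma graph_symmetry_id: "graph_symmetry \<Gamma> id = \<one>\<^bsub>AutoGroup (raag \<Gamma>)\<^esub>"
  unfolding graph_symmetry_def
  by (rule raag_aut_eq) (simp_all add: A.one_AutoGroup A.id_in_auto gen_closed)

text \<open>Allows a generator with trivial projection to be kept in the generating set of the
  image.\<close>

lemma out_class_one_in_S_set: "out_class (raag \<Gamma>) \<one>\<^bsub>AutoGroup (raag \<Gamma>)\<^esub> \<in> S_set \<Gamma>"
proof -
  have "graph_automorphism \<Gamma> id" by (simp add: graph_automorphism_def)
  then have "\<one>\<^bsub>AutoGroup (raag \<Gamma>)\<^esub> \<in> graph_symmetries \<Gamma>"
    unfolding graph_symmetries_def using graph_symmetry_id[symmetric] by blast
  then show ?thesis unfolding S_set_def by blast
qed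

end

context raag_projection
begin

lemma induces_on_link_trivial:
  assumes "\<psi> \<in> auto (raag \<Gamma>)" "\<psi> ` H = H" "\<psi> ` N = N"
    and "\<And>l. l \<in> K \<Longrightarrow> retr (\<psi> (gen \<Gamma> l)) = gen L l"
  shows "induces_on_link \<Gamma> v \<psi> \<one>\<^bsub>AutoGroup (raag L)\<^esub>"
  using assms by (intro induces_on_linkI) (simp_all add: S.A.one_AutoGroup S.A.id_in_auto gen_closed)

lemma induces_inversion:
  assumes i: "i \<in> verts \<Gamma>"
  shows "induces_on_link \<Gamma> v (inversion \<Gamma> i) (if i \<in> K then inversion L i else \<one>\<^bsub>AutoGroup (raag L)\<^esub>)"
proof (cases "i \<in> K")
  case True
  have "induces_on_link \<Gamma> v (inversion \<Gamma> i) (inversion L i)"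
  proof (rule induces_on_linkI)
    have i': "i \<in> verts L" using True by simp
    show "inversion L i \<in> auto (raag L)" by (rule S.inversion_auto[OF i'])
    fix l assume l: "l \<in> K"
    then have l': "l \<in> verts \<Gamma>" "l \<in> verts L" using S_verts by auto
    show "retr (inversion \<Gamma> i (gen \<Gamma> l)) = inversion L i (gen L l)"
      using l l' by (auto simp: inversion_gen[OF i] S.inversion_gen[OF i'] retr_gen retr_inv gen_closed)
  qed (use i inversion_auto inversion_image_raag_sub X_verts star_set_verts in simp_all)
  with True show ?thesis by simp
next
  case False
  have "induces_on_link \<Gamma> v (inversion \<Gamma> i) \<one>\<^bsub>AutoGroup (raag L)\<^esub>"
  proof (rule induces_on_link_trivial)
    fix l assume l: "l \<in> K"
    then have l': "l \<in> verts \<Gamma>" "l \<noteq> i" using S_verts False by auto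
    show "retr (inversion \<Gamma> i (gen \<Gamma> l)) = gen L l"
      using l l' by (simp add: inversion_gen[OF i] retr_gen)
  qed (use i inversion_auto inversion_image_raag_sub X_verts star_set_verts in simp_all)
  with False show ?thesis by simp
qed

lemma induces_transvection:
  assumes ij: "transvection_defined \<Gamma> i j"
  shows "induces_on_link \<Gamma> v (transvection \<Gamma> i j)
     (if i \<in> K \<and> j \<in> K then transvection L i j else \<one>\<^bsub>AutoGroup (raag L)\<^esub>)"
proof -
  have i: "i \<in> verts \<Gamma>" and j: "j \<in> verts \<Gamma>" and le: "std_le \<Gamma> i j"
    using ij by (auto simp: transvection_defined_def std_le_def)
  have iX: "j \<in> X" if "i \<in> X" using X_up_closed[OF that j le] .
  have iK: "j \<in> X \<or> j \<in> K \<and> transvection_defined L i j" if "i \<in> K"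
    using transvection_from_K[OF that ij] .
  have iH: "j \<in> star_set \<Gamma> X" if "i \<in> star_set \<Gamma> X"
    using that iX iK unfolding star_set_def by blast
  have img: "transvection \<Gamma> i j ` H = H" "transvection \<Gamma> i j ` N = N"
    using transvection_image_raag_sub[OF star_set_verts ij iH]
      transvection_image_raag_sub[OF X_verts ij iX] by blast+
  show ?thesis
  proof (cases "i \<in> K \<and> j \<in> K")
    case True
    then have ij': "transvection_defined L i j" using iK X_K_disjoint by blast
    have "induces_on_link \<Gamma> v (transvection \<Gamma> i j) (transvection L i j)"
    proof (rule induces_on_linkI[OF transvection_auto[OF ij] img S.transvection_auto[OF ij']])
      fix l assume l: "l \<in> K"
      then have l': "l \<in> verts \<Gamma>" "l \<in> verts L" using S_verts by auto
      show "retr (transvection \<Gamma> i j (gen \<Gamma> l)) = transvection L i j (gen L l)"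
        using l l' True i j
        by (simp add: transvection_gen[OF ij] S.transvection_gen[OF ij'] retr_gen retr_mult gen_closed)
    qed
    with True show ?thesis by simp
  next
    case False
    \<comment> \<open>Either \<open>i\<close> is outside lk[v], whose vertices are then all fixed,
      or \<open>i\<close> is in it and \<open>j\<close> is not, and the factor \<open>v_j\<close> is
      killed by \<open>retr\<close>.\<close>
    have "induces_on_link \<Gamma> v (transvection \<Gamma> i j) \<one>\<^bsub>AutoGroup (raag L)\<^esub>"
    proof (rule induces_on_link_trivial[OF transvection_auto[OF ij] img])
      fix l assume l: "l \<in> K"
      then have l': "l \<in> verts \<Gamma>" "l \<in> verts L" using S_verts by auto
      show "retr (transvection \<Gamma> i j (gen \<Gamma> l)) = gen L l"
        using l l' False i j
        by (auto simp: transvection_gen[OF ij] retr_gen retr_mult gen_closed)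
    qed
    then show ?thesis unfolding if_not_P[OF False] .
  qed
qed

lemma induces_union_conjugation_K:
  assumes j: "j \<in> K" and U: "component_union j U"
  shows "induces_on_link \<Gamma> v (union_conjugation j U) (S.union_conjugation j (U \<inter> K))"
proof -
  have jv: "j \<in> verts \<Gamma>" and jL: "j \<in> verts L" using j S_verts by auto
  have U': "S.component_union j (U \<inter> K)" by (rule component_union_K[OF j U])
  \<comment> \<open>All of [v] is adjacent to \<open>j\<close>, hence inside st(j) and untouched; so
    A_[v] is even fixed elementwise.\<close>
  have UX: "k \<notin> U" if "k \<in> X" for k
    using X_K_adjacent[OF that j] link_sym[of j k] U by (auto simp: component_union_def star_def)
  show ?thesis
  proof (rule induces_on_linkI[OF union_conjugation_auto[OF jv U] _ _ S.union_conjugation_auto[OF jL U']])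
    show "union_conjugation j U ` H = H"
      by (rule union_conjugation_image_raag_sub[OF star_set_verts _ U]) (simp add: star_set_def j)
    show "union_conjugation j U ` N = N"
      by (rule auto_image_raag_sub_fixed[OF X_verts union_conjugation_auto[OF jv U]])
         (use UX X_verts in \<open>auto simp: union_conjugation_gen[OF jv U]\<close>)
    fix l assume l: "l \<in> K"
    then have l': "l \<in> verts \<Gamma>" "l \<in> verts L" using S_verts by auto
    show "retr (union_conjugation j U (gen \<Gamma> l)) = S.union_conjugation j (U \<inter> K) (gen L l)"
      using l l' j jv
      by (simp add: union_conjugation_gen[OF jv U] S.union_conjugation_gen[OF jL U'] retr_gen retr_mult retr_inv gen_closed)
  qed
qed

text \<open>Now lk[v] \<subseteq> st(j), so \<open>U\<close> misses lk[v]; A_[v] is preserved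
  because it contains the conjugating element.\<close>

lemma induces_union_conjugation_X:
  assumes j: "j \<in> X" and U: "component_union j U"
  shows "induces_on_link \<Gamma> v (union_conjugation j U) \<one>\<^bsub>AutoGroup (raag L)\<^esub>"
proof -
  have jv: "j \<in> verts \<Gamma>" using j X_verts by auto
  show ?thesis
  proof (rule induces_on_link_trivial[OF union_conjugation_auto[OF jv U]])
    show "union_conjugation j U ` H = H"
      by (rule union_conjugation_image_raag_sub[OF star_set_verts _ U]) (simp add: star_set_def j)
    show "union_conjugation j U ` N = N"
      by (rule union_conjugation_image_raag_sub[OF X_verts j U])
    fix l assume l: "l \<in> K"
    then have l': "l \<in> verts \<Gamma>" using S_verts by auto
    have "l \<notin> U" using X_K_adjacent[OF j l] U by (auto simp: component_union_def star_def)
    then show "retr (union_conjugation j U (gen \<Gamma> l)) = gen L l"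
      using l l' by (simp add: union_conjugation_gen[OF jv U] retr_gen)
  qed
qed

text \<open>Outside \<open>st[v]\<close>, an extended partial conjugation by \<open>j\<close> is on \<open>A\<^sub>s\<^sub>t\<^sub>[\<^sub>v\<^sub>]\<close> either trivial or the
  full conjugation by \<open>j\<close>, which an inner automorphism removes.\<close>

lemma induces_union_conjugation_outside:
  assumes j: "j \<in> verts \<Gamma>" "j \<notin> star_set \<Gamma> X" and U: "component_union j U"
  shows "\<exists>\<psi>\<in>out_class (raag \<Gamma>) (union_conjugation j U). induces_on_link \<Gamma> v \<psi> \<one>\<^bsub>AutoGroup (raag L)\<^esub>"
proof -
  note auto = union_conjugation_auto[OF j(1) U]
  have *: "induces_on_link \<Gamma> v \<psi> \<one>\<^bsub>AutoGroup (raag L)\<^esub>"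
    if \<psi>: "\<psi> \<in> auto (raag \<Gamma>)" and fixed: "\<And>k. k \<in> star_set \<Gamma> X \<Longrightarrow> \<psi> (gen \<Gamma> k) = gen \<Gamma> k" for \<psi>
  proof (rule induces_on_link_trivial[OF \<psi>])
    show "\<psi> ` H = H" by (rule auto_image_raag_sub_fixed[OF star_set_verts \<psi> fixed])
    show "\<psi> ` N = N" by (rule auto_image_raag_sub_fixed[OF X_verts \<psi> fixed]) (simp add: star_set_def)
    fix l assume l: "l \<in> K"
    then have "l \<in> star_set \<Gamma> X" "l \<in> verts \<Gamma>" using S_verts by (auto simp: star_set_def)
    then show "retr (\<psi> (gen \<Gamma> l)) = gen L l" using fixed l by (simp add: retr_gen)
  qed
  show ?thesis
  proof (cases "star_set \<Gamma> X \<inter> U = {}")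
    case True
    have "union_conjugation j U (gen \<Gamma> k) = gen \<Gamma> k" if "k \<in> star_set \<Gamma> X" for k
    proof -
      have "k \<notin> U" "k \<in> verts \<Gamma>" using that True star_set_verts by blast+
      then show ?thesis by (simp add: union_conjugation_gen[OF j(1) U])
    qed
    with *[OF auto] A.out_class_self[OF auto] show ?thesis by blast
  next
    case False
    then have sub: "star_set \<Gamma> X - star \<Gamma> j \<subseteq> U" using component_union_star_set[OF j U] by blast
    have gj: "gen \<Gamma> j \<in> carrier (raag \<Gamma>)" "inv\<^bsub>raag \<Gamma>\<^esub> gen \<Gamma> j \<in> carrier (raag \<Gamma>)"
      using j(1) gen_closed[of j \<Gamma>] A.inv_closed by blast+
    \<comment> \<open>On \<open>U\<close> the two conjugations cancel; the vertices of st[v] outside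
      \<open>U\<close> lie in st(j) and commute with \<open>v_j\<close>. Hence this representative
      fixes st[v] pointwise.\<close>
    let ?\<psi> = "A.conj_aut (inv\<^bsub>raag \<Gamma>\<^esub> gen \<Gamma> j) \<otimes>\<^bsub>AutoGroup (raag \<Gamma>)\<^esub> union_conjugation j U"
    note conj = A.conj_aut_closed[OF gj(2)]
    have "?\<psi> (gen \<Gamma> k) = gen \<Gamma> k" if k: "k \<in> star_set \<Gamma> X" for k
    proof -
      have kv: "k \<in> verts \<Gamma>" using k star_set_verts by blast
      then have gk: "gen \<Gamma> k \<in> carrier (raag \<Gamma>)" by blast
      show ?thesis
      proof (cases "k \<in> U")
        case True
        then show ?thesis
          using gj gk by (simp add: A.mult_AutoGroup_apply[OF conj auto] union_conjugation_gen[OF j(1) U kv] A.conj_aut_apply A.m_assoc)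
      next
        case False
        then have "k \<in> star \<Gamma> j" using sub k by blast
        then have "gen \<Gamma> j \<otimes>\<^bsub>raag \<Gamma>\<^esub> gen \<Gamma> k = gen \<Gamma> k \<otimes>\<^bsub>raag \<Gamma>\<^esub> gen \<Gamma> j"
          using gen_commute_star[OF j(1)] by blast
        then have "inv\<^bsub>raag \<Gamma>\<^esub> gen \<Gamma> j \<otimes>\<^bsub>raag \<Gamma>\<^esub> (gen \<Gamma> k \<otimes>\<^bsub>raag \<Gamma>\<^esub> gen \<Gamma> j) = gen \<Gamma> k"
          using gj gk A.inv_cancel_left(2)[of "gen \<Gamma> j" "gen \<Gamma> k"] by simp
        then show ?thesis
          using False gj gk by (simp add: A.mult_AutoGroup_apply[OF conj auto] union_conjugation_gen[OF j(1) U kv] A.conj_aut_apply A.m_assoc)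
      qed
    qed
    moreover have "?\<psi> \<in> auto (raag \<Gamma>)" by (rule A.mult_AutoGroup_closed[OF conj auto])
    ultimately have "induces_on_link \<Gamma> v ?\<psi> \<one>\<^bsub>AutoGroup (raag L)\<^esub>" using * by blast
    moreover have "?\<psi> \<in> out_class (raag \<Gamma>) (union_conjugation j U)"
      unfolding A.mem_out_class_iff[OF auto] using gj by blast
    ultimately show ?thesis by blast
  qed
qed

end

subsection \<open>The action on the abelianization\<close>

context raag_graph
begin

text \<open>A coordinate of the abelianization. Any map of vertices into the integers respects arcs,
  since the target is abelian.\<close>

definition exponent :: "'v \<Rightarrow> ('v \<times> bool) list set \<Rightarrow> int" where
  "exponent k = raag_lift integer_group (\<lambda>i. if i = k then 1 else 0)"

lemma exponent_respects_arcs: "respects_arcs \<Gamma> integer_group (\<lambda>i. if i = k then 1 else 0)"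
  by (rule respects_arcsI) simp_all

lemma exponent_hom: "exponent k \<in> hom (raag \<Gamma>) integer_group"
  unfolding exponent_def by (rule group.raag_lift_hom[OF group_integer_group exponent_respects_arcs])

lemma exponent_gen: "i \<in> verts \<Gamma> \<Longrightarrow> exponent k (gen \<Gamma> i) = (if i = k then 1 else 0)"
  unfolding exponent_def by (rule group.raag_lift_gen[OF group_integer_group exponent_respects_arcs])

lemma exponent_mult:
  "x \<in> carrier (raag \<Gamma>) \<Longrightarrow> y \<in> carrier (raag \<Gamma>) \<Longrightarrow>
    exponent k (x \<otimes>\<^bsub>raag \<Gamma>\<^esub> y) = exponent k x + exponent k y"
  using exponent_hom by (simp add: hom_def)

lemma exponent_group_hom: "group_hom (raag \<Gamma>) integer_group (exponent k)"
  by (simp add: group_hom_def group_hom_axioms_def group_raag exponent_hom)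

lemma exponent_one: "exponent k \<one>\<^bsub>raag \<Gamma>\<^esub> = 0"
  using group_hom.hom_one[OF exponent_group_hom] by simp

lemma exponent_inv: "x \<in> carrier (raag \<Gamma>) \<Longrightarrow> exponent k (inv\<^bsub>raag \<Gamma>\<^esub> x) = - exponent k x"
  using group_hom.hom_inv[OF exponent_group_hom] by simp

text \<open>Inner automorphisms act trivially on the abelianization, so matrix entries depend only
  on the outer class.\<close>

lemma exponent_conj:
  assumes "g \<in> carrier (raag \<Gamma>)" "\<theta> \<in> auto (raag \<Gamma>)" "x \<in> carrier (raag \<Gamma>)"
  shows "exponent k ((A.conj_aut g \<otimes>\<^bsub>AutoGroup (raag \<Gamma>)\<^esub> \<theta>) x) = exponent k (\<theta> x)"
  using assms by (simp add: A.mult_AutoGroup_apply A.conj_aut_closed A.conj_aut_apply A.auto_closed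
      exponent_mult exponent_inv)

lemma exponent_out_class_eq:
  assumes "out_class (raag \<Gamma>) \<theta> = out_class (raag \<Gamma>) \<theta>'"
    and "\<theta> \<in> auto (raag \<Gamma>)" "\<theta>' \<in> auto (raag \<Gamma>)" "x \<in> carrier (raag \<Gamma>)"
  shows "exponent k (\<theta> x) = exponent k (\<theta>' x)"
proof -
  have "\<theta> \<in> out_class (raag \<Gamma>) \<theta>'" using A.out_class_self[OF assms(2)] assms(1) by simp
  then obtain g where "g \<in> carrier (raag \<Gamma>)" "\<theta> = A.conj_aut g \<otimes>\<^bsub>AutoGroup (raag \<Gamma>)\<^esub> \<theta>'"
    unfolding A.mem_out_class_iff[OF assms(3)] by blast
  then show ?thesis using exponent_conj assms(3,4) by simp
qed

text \<open>Linearity of the action on the abelianization, with the image of vertex \<open>k\<close>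
  as row \<open>k\<close>: a row vector is multiplied by the matrix of \<theta>.\<close>

lemma exponent_auto:
  assumes \<theta>: "\<theta> \<in> auto (raag \<Gamma>)" and "x \<in> carrier (raag \<Gamma>)"
  shows "exponent j (\<theta> x) = (\<Sum>k\<in>verts \<Gamma>. exponent k x * exponent j (\<theta> (gen \<Gamma> k)))"
  using assms(2)
proof (induction x rule: raag_induct)
  case one
  have "\<theta> \<one>\<^bsub>raag \<Gamma>\<^esub> = \<one>\<^bsub>raag \<Gamma>\<^esub>" by (rule group_hom.hom_one[OF A.auto_group_hom[OF \<theta>]])
  then show ?case by (simp add: exponent_one)
next
  case (gen u y)
  have "(\<Sum>k\<in>verts \<Gamma>. (if u = k then 1 else 0) * exponent j (\<theta> (gen \<Gamma> k))) = exponent j (\<theta> (gen \<Gamma> u))"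
    using gen(1) by (simp add: if_distrib[of "\<lambda>a. a * _"] sum.delta cong: if_cong)
  with gen show ?case
    by (simp add: A.auto_mult[OF \<theta>] exponent_mult A.auto_closed[OF \<theta>] gen_closed exponent_gen
        distrib_right sum.distrib)
next
  case (inv_gen u y)
  have "(\<Sum>k\<in>verts \<Gamma>. (if u = k then 1 else 0) * exponent j (\<theta> (gen \<Gamma> k))) = exponent j (\<theta> (gen \<Gamma> u))"
    using inv_gen(1) by (simp add: if_distrib[of "\<lambda>a. a * _"] sum.delta cong: if_cong)
  with inv_gen show ?case
    by (simp add: A.auto_mult[OF \<theta>] A.auto_inv[OF \<theta>] exponent_mult exponent_inv A.auto_closed[OF \<theta>] gen_closed exponent_gen
        left_diff_distrib sum_subtractf)
qed

text \<open>For a preorder \<open>R\<close> this is block triangular shape, the blocks being the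
  classes of \<open>R\<close>.\<close>

definition triangular :: "('v \<Rightarrow> 'v \<Rightarrow> bool) \<Rightarrow> (('v \<times> bool) list set \<Rightarrow> ('v \<times> bool) list set) \<Rightarrow> bool" where
  "triangular R \<theta> \<longleftrightarrow>
     (\<forall>i\<in>verts \<Gamma>. \<forall>j\<in>verts \<Gamma>. exponent j (\<theta> (gen \<Gamma> i)) \<noteq> 0 \<longrightarrow> R i j)"

text \<open>A nonzero entry (i, j) of the product needs a nonzero summand, that is, some
  \<open>k\<close> with \<open>R i k\<close> and \<open>R k j\<close>.\<close>

lemma triangular_mult:
  assumes \<theta>: "\<theta> \<in> auto (raag \<Gamma>)" and \<theta>': "\<theta>' \<in> auto (raag \<Gamma>)"
    and R: "triangular R \<theta>" "triangular R \<theta>'"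
    and trans: "\<And>i j k. R i j \<Longrightarrow> R j k \<Longrightarrow> R i k"
  shows "triangular R (\<theta> \<otimes>\<^bsub>AutoGroup (raag \<Gamma>)\<^esub> \<theta>')"
  unfolding triangular_def
proof (intro ballI impI)
  fix i j assume i: "i \<in> verts \<Gamma>" and j: "j \<in> verts \<Gamma>"
    and "exponent j ((\<theta> \<otimes>\<^bsub>AutoGroup (raag \<Gamma>)\<^esub> \<theta>') (gen \<Gamma> i)) \<noteq> 0"
  moreover have gi: "gen \<Gamma> i \<in> carrier (raag \<Gamma>)" using i by (rule gen_closed)
  ultimately have "exponent j (\<theta> (\<theta>' (gen \<Gamma> i))) \<noteq> 0"
    by (simp add: A.mult_AutoGroup_apply[OF \<theta> \<theta>'])
  then have "(\<Sum>k\<in>verts \<Gamma>. exponent k (\<theta>' (gen \<Gamma> i)) * exponent j (\<theta> (gen \<Gamma> k))) \<noteq> 0"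
    using exponent_auto[OF \<theta> A.auto_closed[OF \<theta>' gi]] by simp
  then obtain k where "k \<in> verts \<Gamma>" "exponent k (\<theta>' (gen \<Gamma> i)) * exponent j (\<theta> (gen \<Gamma> k)) \<noteq> 0"
    by (meson sum.neutral)
  then have "R i k" "R k j" using R i j by (auto simp: triangular_def)
  then show "R i j" by (rule trans)
qed

lemma triangularI:
  assumes "\<And>i. i \<in> verts \<Gamma> \<Longrightarrow> \<theta> (gen \<Gamma> i) = y i"
    and "\<And>i j. i \<in> verts \<Gamma> \<Longrightarrow> j \<in> verts \<Gamma> \<Longrightarrow> exponent j (y i) \<noteq> 0 \<Longrightarrow> R i j"
  shows "triangular R \<theta>"
  using assms by (simp add: triangular_def)

lemma triangular_one: "(\<And>i. R i i) \<Longrightarrow> triangular R \<one>\<^bsub>AutoGroup (raag \<Gamma>)\<^esub>"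
  by (rule triangularI[where y = "gen \<Gamma>"])
     (auto simp: A.one_AutoGroup gen_closed exponent_gen split: if_splits)

text \<open>Inverses are treated for each kind of generator by direct evaluation on vertices;
  \<open>generate\<close> introduces inverses of generators only, so nothing is required about
  inverting general matrices of this shape.\<close>

lemma triangular_inversion:
  assumes R: "\<And>i. R i i" and k: "k \<in> verts \<Gamma>"
  shows "triangular R (inversion \<Gamma> k)" "triangular R (inv\<^bsub>AutoGroup (raag \<Gamma>)\<^esub> inversion \<Gamma> k)"
proof -
  let ?y = "\<lambda>i. if i = k then inv\<^bsub>raag \<Gamma>\<^esub> gen \<Gamma> i else gen \<Gamma> i"
  note auto = inversion_auto[OF k]
  have y: "?y i \<in> carrier (raag \<Gamma>)" if "i \<in> verts \<Gamma>" for i using gen_closed[OF that] by auto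
  have *: "R i j" if "i \<in> verts \<Gamma>" "j \<in> verts \<Gamma>" "exponent j (?y i) \<noteq> 0" for i j
    using that R by (auto simp: exponent_inv exponent_gen gen_closed split: if_splits)
  show "triangular R (inversion \<Gamma> k)"
    by (rule triangularI[where y = ?y, OF inversion_gen[OF k] *])
  have "inversion \<Gamma> k (?y i) = gen \<Gamma> i" if "i \<in> verts \<Gamma>" for i
    using that k by (auto simp: inversion_gen[OF k] A.auto_inv[OF auto] gen_closed)
  then have "(inv\<^bsub>AutoGroup (raag \<Gamma>)\<^esub> inversion \<Gamma> k) (gen \<Gamma> i) = ?y i" if "i \<in> verts \<Gamma>" for i
    using that by (intro A.inv_AutoGroup_eq[OF auto y])
  then show "triangular R (inv\<^bsub>AutoGroup (raag \<Gamma>)\<^esub> inversion \<Gamma> k)"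
    by (rule triangularI[where y = ?y, OF _ *])
qed

lemma triangular_transvection:
  assumes R: "\<And>i. R i i" and ab: "transvection_defined \<Gamma> a b" and "R a b"
  shows "triangular R (transvection \<Gamma> a b)" "triangular R (inv\<^bsub>AutoGroup (raag \<Gamma>)\<^esub> transvection \<Gamma> a b)"
proof -
  have a: "a \<in> verts \<Gamma>" and b: "b \<in> verts \<Gamma>" using ab by (auto simp: transvection_defined_def)
  have ga: "gen \<Gamma> a \<in> carrier (raag \<Gamma>)" and gb: "gen \<Gamma> b \<in> carrier (raag \<Gamma>)" using a b by blast+
  note auto = transvection_auto[OF ab]
  have *: "R i j" if "i \<in> verts \<Gamma>" "j \<in> verts \<Gamma>"
    "exponent j (if i = a then gen \<Gamma> a \<otimes>\<^bsub>raag \<Gamma>\<^esub> gen \<Gamma> b else gen \<Gamma> i) \<noteq> 0" for i j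
    using that R \<open>R a b\<close> a b by (auto simp: exponent_mult exponent_gen gen_closed split: if_splits)
  show "triangular R (transvection \<Gamma> a b)"
    by (rule triangularI[OF _ *]) (rule transvection_gen[OF ab])
  let ?y = "\<lambda>i. if i = a then gen \<Gamma> a \<otimes>\<^bsub>raag \<Gamma>\<^esub> inv\<^bsub>raag \<Gamma>\<^esub> gen \<Gamma> b else gen \<Gamma> i"
  have y: "?y i \<in> carrier (raag \<Gamma>)" if "i \<in> verts \<Gamma>" for i using gen_closed[OF that] ga gb by simp
  have "transvection \<Gamma> a b (?y i) = gen \<Gamma> i" if "i \<in> verts \<Gamma>" for i
    using that transvection_cancel[OF ab] by (simp add: transvection_gen[OF ab])
  then have eq: "(inv\<^bsub>AutoGroup (raag \<Gamma>)\<^esub> transvection \<Gamma> a b) (gen \<Gamma> i) = ?y i" if "i \<in> verts \<Gamma>" for i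
    using that by (intro A.inv_AutoGroup_eq[OF auto y])
  have **: "R i j" if "i \<in> verts \<Gamma>" "j \<in> verts \<Gamma>" "exponent j (?y i) \<noteq> 0" for i j
    using that R \<open>R a b\<close> a b by (auto simp: exponent_mult exponent_inv exponent_gen gen_closed split: if_splits)
  show "triangular R (inv\<^bsub>AutoGroup (raag \<Gamma>)\<^esub> transvection \<Gamma> a b)"
    by (rule triangularI[where y = ?y, OF eq **])
qed

text \<open>A conjugated vertex has the same exponents as the vertex, so the matrix is the identity
  and reflexivity of \<open>R\<close> suffices.\<close>

lemma triangular_union_conjugation:
  assumes R: "\<And>i. R i i" and b: "b \<in> verts \<Gamma>" and U: "component_union b U"
  shows "triangular R (union_conjugation b U)"
    "triangular R (inv\<^bsub>AutoGroup (raag \<Gamma>)\<^esub> union_conjugation b U)"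
proof -
  have gb: "gen \<Gamma> b \<in> carrier (raag \<Gamma>)" using b by blast
  note auto = union_conjugation_auto[OF b U]
  have *: "R i j" if "i \<in> verts \<Gamma>" "j \<in> verts \<Gamma>"
    "exponent j (if i \<in> U then gen \<Gamma> b \<otimes>\<^bsub>raag \<Gamma>\<^esub> gen \<Gamma> i \<otimes>\<^bsub>raag \<Gamma>\<^esub> inv\<^bsub>raag \<Gamma>\<^esub> gen \<Gamma> b else gen \<Gamma> i) \<noteq> 0" for i j
    using that R gb by (auto simp: exponent_mult exponent_inv exponent_gen gen_closed split: if_splits)
  show "triangular R (union_conjugation b U)"
    by (rule triangularI[OF _ *]) (rule union_conjugation_gen[OF b U])
  let ?y = "\<lambda>i. if i \<in> U then inv\<^bsub>raag \<Gamma>\<^esub> gen \<Gamma> b \<otimes>\<^bsub>raag \<Gamma>\<^esub> gen \<Gamma> i \<otimes>\<^bsub>raag \<Gamma>\<^esub> gen \<Gamma> b else gen \<Gamma> i"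
  have y: "?y i \<in> carrier (raag \<Gamma>)" if "i \<in> verts \<Gamma>" for i using gen_closed[OF that] gb by simp
  have "union_conjugation b U (?y i) = gen \<Gamma> i" if "i \<in> verts \<Gamma>" for i
    using that union_conjugation_cancel[OF b U] by (simp add: union_conjugation_gen[OF b U])
  then have eq: "(inv\<^bsub>AutoGroup (raag \<Gamma>)\<^esub> union_conjugation b U) (gen \<Gamma> i) = ?y i" if "i \<in> verts \<Gamma>" for i
    using that by (intro A.inv_AutoGroup_eq[OF auto y])
  have **: "R i j" if "i \<in> verts \<Gamma>" "j \<in> verts \<Gamma>" "exponent j (?y i) \<noteq> 0" for i j
    using that R gb by (auto simp: exponent_mult exponent_inv exponent_gen gen_closed split: if_splits)
  show "triangular R (inv\<^bsub>AutoGroup (raag \<Gamma>)\<^esub> union_conjugation b U)"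
    by (rule triangularI[where y = ?y, OF eq **])
qed

section \<open>The preorder attached to a subgroup\<close>

lemma G_le_std_le: "G_le \<Gamma> G i j \<Longrightarrow> std_le \<Gamma> i j"
  using std_le_refl[of \<Gamma> i] unfolding G_le_def transvection_defined_def std_le_def by blast

lemma G_le_refl: "G_le \<Gamma> G i i"
  by (simp add: G_le_def)

text \<open>The Steinberg relation of elementary matrices, valid for the automorphisms themselves.
  Written without inverses it can be checked on vertices: both sides send \<open>v_i\<close> to
  \<open>v_i v_j v_k\<close> and \<open>v_j\<close> to \<open>v_j v_k\<close>.\<close>

lemma transvection_relation:
  assumes ij: "transvection_defined \<Gamma> i j" and jk: "transvection_defined \<Gamma> j k" and ik: "transvection_defined \<Gamma> i k"
  shows "transvection \<Gamma> j k \<otimes>\<^bsub>AutoGroup (raag \<Gamma>)\<^esub> transvection \<Gamma> i j =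
    transvection \<Gamma> i j \<otimes>\<^bsub>AutoGroup (raag \<Gamma>)\<^esub> (transvection \<Gamma> i k \<otimes>\<^bsub>AutoGroup (raag \<Gamma>)\<^esub> transvection \<Gamma> j k)"
proof (rule raag_auto_eqI)
  have v: "i \<in> verts \<Gamma>" "j \<in> verts \<Gamma>" "k \<in> verts \<Gamma>" and ne: "i \<noteq> j" "j \<noteq> k" "i \<noteq> k"
    using assms by (auto simp: transvection_defined_def)
  have g: "gen \<Gamma> i \<in> carrier (raag \<Gamma>)" "gen \<Gamma> j \<in> carrier (raag \<Gamma>)" "gen \<Gamma> k \<in> carrier (raag \<Gamma>)"
    using v by blast+
  note auto = transvection_auto[OF ij] transvection_auto[OF jk] transvection_auto[OF ik]
  show "transvection \<Gamma> j k \<otimes>\<^bsub>AutoGroup (raag \<Gamma>)\<^esub> transvection \<Gamma> i j \<in> auto (raag \<Gamma>)"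
    by (intro A.mult_AutoGroup_closed auto)
  show "transvection \<Gamma> i j \<otimes>\<^bsub>AutoGroup (raag \<Gamma>)\<^esub> (transvection \<Gamma> i k \<otimes>\<^bsub>AutoGroup (raag \<Gamma>)\<^esub> transvection \<Gamma> j k) \<in> auto (raag \<Gamma>)"
    by (intro A.mult_AutoGroup_closed auto)
  fix l assume l: "l \<in> verts \<Gamma>"
  then have gl: "gen \<Gamma> l \<in> carrier (raag \<Gamma>)" by blast
  have "transvection \<Gamma> j k (transvection \<Gamma> i j (gen \<Gamma> l)) =
    transvection \<Gamma> i j (transvection \<Gamma> i k (transvection \<Gamma> j k (gen \<Gamma> l)))"
    using l v ne g
    by (auto simp: transvection_gen[OF ij] transvection_gen[OF jk] transvection_gen[OF ik]
        A.auto_mult[OF auto(1)] A.auto_mult[OF auto(2)] A.auto_mult[OF auto(3)] A.m_assoc)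
  then show "(transvection \<Gamma> j k \<otimes>\<^bsub>AutoGroup (raag \<Gamma>)\<^esub> transvection \<Gamma> i j) (gen \<Gamma> l) =
    (transvection \<Gamma> i j \<otimes>\<^bsub>AutoGroup (raag \<Gamma>)\<^esub> (transvection \<Gamma> i k \<otimes>\<^bsub>AutoGroup (raag \<Gamma>)\<^esub> transvection \<Gamma> j k)) (gen \<Gamma> l)"
    by (simp add: A.mult_AutoGroup_apply auto gl A.mult_AutoGroup_closed A.auto_closed)
qed

text \<open>Solving the Steinberg relation for the transvection from \<open>i\<close> to
  \<open>k\<close> expresses its class through elements of \<open>G\<close>. The case
  \<open>i = k\<close>, where no such transvection exists, is reflexivity.\<close>

lemma G_le_trans:
  assumes G: "subgroup G (Out (raag \<Gamma>))" and 1: "G_le \<Gamma> G i j" and 2: "G_le \<Gamma> G j k"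
  shows "G_le \<Gamma> G i k"
proof (cases "i = j \<or> j = k \<or> i = k")
  case True
  then show ?thesis using 1 2 G_le_refl by blast
next
  case False
  interpret Out: group "Out (raag \<Gamma>)" by (rule A.group_Out)
  let ?c = "out_class (raag \<Gamma>)"
  have ij: "transvection_defined \<Gamma> i j" "?c (transvection \<Gamma> i j) \<in> G"
    and jk: "transvection_defined \<Gamma> j k" "?c (transvection \<Gamma> j k) \<in> G"
    using 1 2 False by (auto simp: G_le_def)
  have ik: "transvection_defined \<Gamma> i k"
    using ij(1) jk(1) False std_le_trans[of i j k] by (auto simp: transvection_defined_def std_le_def)
  note auto = transvection_auto[OF ij(1)] transvection_auto[OF jk(1)] transvection_auto[OF ik]
  have c: "?c (transvection \<Gamma> i j) \<in> carrier (Out (raag \<Gamma>))" "?c (transvection \<Gamma> j k) \<in> carrier (Out (raag \<Gamma>))"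
    "?c (transvection \<Gamma> i k) \<in> carrier (Out (raag \<Gamma>))"
    using auto by (auto simp: A.carrier_Out)
  have "?c (transvection \<Gamma> j k) \<otimes>\<^bsub>Out (raag \<Gamma>)\<^esub> ?c (transvection \<Gamma> i j) =
     ?c (transvection \<Gamma> i j) \<otimes>\<^bsub>Out (raag \<Gamma>)\<^esub> (?c (transvection \<Gamma> i k) \<otimes>\<^bsub>Out (raag \<Gamma>)\<^esub> ?c (transvection \<Gamma> j k))"
    using transvection_relation[OF ij(1) jk(1) ik] auto
    by (simp add: A.out_class_mult[symmetric] A.mult_AutoGroup_closed)
  then have "?c (transvection \<Gamma> i k) = inv\<^bsub>Out (raag \<Gamma>)\<^esub> ?c (transvection \<Gamma> i j) \<otimes>\<^bsub>Out (raag \<Gamma>)\<^esub>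
     (?c (transvection \<Gamma> j k) \<otimes>\<^bsub>Out (raag \<Gamma>)\<^esub> ?c (transvection \<Gamma> i j)) \<otimes>\<^bsub>Out (raag \<Gamma>)\<^esub> inv\<^bsub>Out (raag \<Gamma>)\<^esub> ?c (transvection \<Gamma> j k)"
    using c by (simp add: Out.m_assoc)
  also have "\<dots> \<in> G"
    using ij(2) jk(2) by (intro subgroup.m_closed[OF G] subgroup.m_inv_closed[OF G])
  finally show ?thesis using ik by (simp add: G_le_def)
qed

end

subsection \<open>The image of the projection\<close>

context raag_projection
begin

text \<open>Keeps a representative \<theta> of the projected class, so that the shape of its matrix
  can be carried through inductions over products.\<close>

definition projects :: "(('v \<times> bool) list set \<Rightarrow> ('v \<times> bool) list set) set \<Rightarrow>
    (('v \<times> bool) list set \<Rightarrow> ('v \<times> bool) list set) \<Rightarrow> bool" where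
  "projects \<Phi> \<theta> \<longleftrightarrow> \<Phi> \<in> Out0 \<Gamma> \<and> (\<exists>\<psi>\<in>auto (raag \<Gamma>). \<Phi> = out_class (raag \<Gamma>) \<psi> \<and> induces_on_link \<Gamma> v \<psi> \<theta>)"

lemma projects_projection: "projects \<Phi> \<theta> \<Longrightarrow> projection \<Gamma> v \<Phi> = out_class (raag L) \<theta>"
  unfolding projects_def using projection_eq A.out_class_self by blast

lemma projects_auto: "projects \<Phi> \<theta> \<Longrightarrow> \<theta> \<in> auto (raag L)"
  unfolding projects_def using induces_on_linkD(3) by blast

lemma projects_one: "projects \<one>\<^bsub>Out (raag \<Gamma>)\<^esub> \<one>\<^bsub>AutoGroup (raag L)\<^esub>"
  unfolding projects_def
proof (intro conjI bexI[of _ "\<one>\<^bsub>AutoGroup (raag \<Gamma>)\<^esub>"])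
  show "\<one>\<^bsub>AutoGroup (raag \<Gamma>)\<^esub> \<in> auto (raag \<Gamma>)" by (simp add: A.one_AutoGroup A.id_in_auto)
qed (simp_all add: subgroup.one_closed[OF subgroup_Out0] induces_on_link_one A.out_class_one)

lemma projects_mult:
  assumes "projects \<Phi> \<theta>" "projects \<Phi>' \<theta>'"
  shows "projects (\<Phi> \<otimes>\<^bsub>Out (raag \<Gamma>)\<^esub> \<Phi>') (\<theta> \<otimes>\<^bsub>AutoGroup (raag L)\<^esub> \<theta>')"
proof -
  obtain \<psi> \<psi>' where 1: "\<psi> \<in> auto (raag \<Gamma>)" "\<Phi> = out_class (raag \<Gamma>) \<psi>" "induces_on_link \<Gamma> v \<psi> \<theta>"
    and 2: "\<psi>' \<in> auto (raag \<Gamma>)" "\<Phi>' = out_class (raag \<Gamma>) \<psi>'" "induces_on_link \<Gamma> v \<psi>' \<theta>'"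
    using assms unfolding projects_def by blast
  have "\<Phi> \<otimes>\<^bsub>Out (raag \<Gamma>)\<^esub> \<Phi>' \<in> Out0 \<Gamma>"
    using assms subgroup.m_closed[OF subgroup_Out0] by (simp add: projects_def)
  then show ?thesis
    unfolding projects_def
    using induces_on_link_mult[OF 1(1) 2(1) 1(3) 2(3)] A.mult_AutoGroup_closed[OF 1(1) 2(1)]
      A.out_class_mult[OF 1(1) 2(1)] 1(2) 2(2) by auto
qed

lemma projects_inv:
  assumes "projects \<Phi> \<theta>"
  shows "projects (inv\<^bsub>Out (raag \<Gamma>)\<^esub> \<Phi>) (inv\<^bsub>AutoGroup (raag L)\<^esub> \<theta>)"
proof -
  obtain \<psi> where 1: "\<psi> \<in> auto (raag \<Gamma>)" "\<Phi> = out_class (raag \<Gamma>) \<psi>" "induces_on_link \<Gamma> v \<psi> \<theta>"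
    using assms unfolding projects_def by blast
  have "inv\<^bsub>Out (raag \<Gamma>)\<^esub> \<Phi> \<in> Out0 \<Gamma>"
    using assms subgroup.m_inv_closed[OF subgroup_Out0] by (simp add: projects_def)
  then show ?thesis
    unfolding projects_def
    using induces_on_link_inv[OF 1(1) 1(3)] A.inv_AutoGroup_closed[OF 1(1)]
      A.out_class_inv[OF 1(1)] 1(2) by auto
qed

text \<open>Collects all that is needed of a single generator: the kind of its image, and the shape
  of the matrices of the image and its inverse. Membership in \<open>G\<close> matters for
  transvections, whose off-diagonal entry must be allowed by \<le>_G.\<close>

lemma projects_S0:
  assumes \<Phi>: "\<Phi> \<in> S0_set \<Gamma>" "\<Phi> \<in> G"
  shows "\<exists>\<theta>. projects \<Phi> \<theta> \<and> out_class (raag L) \<theta> \<in> S_set L \<and>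
    S.triangular (G_le \<Gamma> G) \<theta> \<and> S.triangular (G_le \<Gamma> G) (inv\<^bsub>AutoGroup (raag L)\<^esub> \<theta>)"
proof -
  have \<Phi>0: "\<Phi> \<in> Out0 \<Gamma>" using \<Phi>(1) S0_subset_Out0 by blast
  note refl = G_le_refl[of G]
  have inv_one: "inv\<^bsub>AutoGroup (raag L)\<^esub> \<one>\<^bsub>AutoGroup (raag L)\<^esub> = \<one>\<^bsub>AutoGroup (raag L)\<^esub>"
    by (rule monoid.inv_one[OF group.is_monoid[OF S.A.AutoGroup]])
  have triv: ?thesis if "\<psi> \<in> auto (raag \<Gamma>)" "\<Phi> = out_class (raag \<Gamma>) \<psi>"
    "induces_on_link \<Gamma> v \<psi> \<one>\<^bsub>AutoGroup (raag L)\<^esub>" for \<psi>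
  proof (intro exI[of _ "\<one>\<^bsub>AutoGroup (raag L)\<^esub>"] conjI)
    show "projects \<Phi> \<one>\<^bsub>AutoGroup (raag L)\<^esub>" unfolding projects_def using that \<Phi>0 by blast
    show "out_class (raag L) \<one>\<^bsub>AutoGroup (raag L)\<^esub> \<in> S_set L" by (rule S.out_class_one_in_S_set)
    show "S.triangular (G_le \<Gamma> G) \<one>\<^bsub>AutoGroup (raag L)\<^esub>" by (rule S.triangular_one[OF refl])
    then show "S.triangular (G_le \<Gamma> G) (inv\<^bsub>AutoGroup (raag L)\<^esub> \<one>\<^bsub>AutoGroup (raag L)\<^esub>)" by (simp only: inv_one)
  qed
  have proj: "projects \<Phi> \<theta>" if "\<psi> \<in> auto (raag \<Gamma>)" "\<Phi> = out_class (raag \<Gamma>) \<psi>" "induces_on_link \<Gamma> v \<psi> \<theta>" for \<psi> \<theta>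
    unfolding projects_def using that \<Phi>0 by blast
  consider (pc) j U where "j \<in> verts \<Gamma>" "component_union j U" "\<Phi> = out_class (raag \<Gamma>) (union_conjugation j U)"
    | (inv) i where "i \<in> verts \<Gamma>" "\<Phi> = out_class (raag \<Gamma>) (inversion \<Gamma> i)"
    | (tv) i j where "transvection_defined \<Gamma> i j" "\<Phi> = out_class (raag \<Gamma>) (transvection \<Gamma> i j)"
    using \<Phi>(1) unfolding S0_set_def ext_partial_conjugations_eq inversions_def transvections_def by blast
  then show ?thesis
  proof cases
    case pc
    note auto = union_conjugation_auto[OF pc(1,2)]
    consider "j \<in> K" | "j \<in> X" | "j \<notin> star_set \<Gamma> X" by (auto simp: star_set_def)
    then show ?thesis
    proof cases
      case 1
      then have jL: "j \<in> verts L" by simp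
      note U' = component_union_K[OF 1 pc(2)]
      have "out_class (raag L) (S.union_conjugation j (U \<inter> K)) \<in> S_set L"
        unfolding S_set_def S.ext_partial_conjugations_eq using jL U' by blast
      then show ?thesis
        using proj[OF auto pc(3) induces_union_conjugation_K[OF 1 pc(2)]]
          S.triangular_union_conjugation[where R = "G_le \<Gamma> G", OF refl jL U'] by blast
    next
      case 2
      show ?thesis by (rule triv[OF auto pc(3) induces_union_conjugation_X[OF 2 pc(2)]])
    next
      case 3
      obtain \<psi> where \<psi>: "\<psi> \<in> out_class (raag \<Gamma>) (union_conjugation j U)"
        "induces_on_link \<Gamma> v \<psi> \<one>\<^bsub>AutoGroup (raag L)\<^esub>"
        using induces_union_conjugation_outside[OF pc(1) 3 pc(2)] by blast
      have "\<Phi> = out_class (raag \<Gamma>) \<psi>" using A.mem_out_class_imp_eq[OF auto \<psi>(1)] pc(3) by simp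
      then show ?thesis by (rule triv[OF A.mem_out_class_auto[OF auto \<psi>(1)] _ \<psi>(2)])
    qed
  next
    case inv
    note auto = inversion_auto[OF inv(1)]
    show ?thesis
    proof (cases "i \<in> K")
      case True
      then have iL: "i \<in> verts L" by simp
      have "out_class (raag L) (inversion L i) \<in> S_set L"
        unfolding S_set_def inversions_def using iL by blast
      moreover have "induces_on_link \<Gamma> v (inversion \<Gamma> i) (inversion L i)"
        using induces_inversion[OF inv(1)] unfolding if_P[OF True] .
      ultimately show ?thesis
        using proj[OF auto inv(2)] S.triangular_inversion[where R = "G_le \<Gamma> G", OF refl iL] by blast
    next
      case False
      then show ?thesis using triv[OF auto inv(2)] induces_inversion[OF inv(1)] unfolding if_not_P[OF False] by blast
    qed
  next
    case tv
    note auto = transvection_auto[OF tv(1)]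
    have le: "G_le \<Gamma> G i j" using tv \<Phi>(2) by (simp add: G_le_def)
    show ?thesis
    proof (cases "i \<in> K \<and> j \<in> K")
      case True
      then have ij': "transvection_defined L i j" using transvection_from_K[OF _ tv(1)] X_K_disjoint by blast
      have "out_class (raag L) (transvection L i j) \<in> S_set L"
        unfolding S_set_def transvections_def using ij' by blast
      moreover have "induces_on_link \<Gamma> v (transvection \<Gamma> i j) (transvection L i j)"
        using induces_transvection[OF tv(1)] unfolding if_P[OF True] .
      ultimately show ?thesis
        using proj[OF auto tv(2)] S.triangular_transvection[where R = "G_le \<Gamma> G", OF refl ij' le] by blast
    next
      case False
      then show ?thesis using triv[OF auto tv(2)] induces_transvection[OF tv(1)] unfolding if_not_P[OF False] by blast
    qed
  qed
qed

lemma projection_generate: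
  assumes G: "subgroup G (Out (raag \<Gamma>))" and B: "B \<subseteq> S0_set \<Gamma>" "B \<subseteq> G"
    and \<Phi>: "\<Phi> \<in> generate (Out (raag \<Gamma>)) B"
  shows "\<exists>\<theta>. projects \<Phi> \<theta> \<and> S.triangular (G_le \<Gamma> G) \<theta> \<and>
    out_class (raag L) \<theta> \<in> generate (Out (raag L)) (projection \<Gamma> v ` B)"
  using \<Phi>
proof (induction rule: generate.induct)
  case one
  have "out_class (raag L) \<one>\<^bsub>AutoGroup (raag L)\<^esub> \<in> generate (Out (raag L)) (projection \<Gamma> v ` B)"
    using generate.one by (simp only: S.A.out_class_one)
  then show ?case using projects_one S.triangular_one[where R = "G_le \<Gamma> G", OF G_le_refl] by blast
next
  case (incl h)
  then obtain \<theta> where \<theta>: "projects h \<theta>" "S.triangular (G_le \<Gamma> G) \<theta>"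
    using projects_S0[of h G] B by blast
  have "projection \<Gamma> v h \<in> generate (Out (raag L)) (projection \<Gamma> v ` B)"
    using incl by (intro generate.incl imageI)
  then show ?case using \<theta> by (auto simp: projects_projection)
next
  case (inv h)
  then obtain \<theta> where \<theta>: "projects h \<theta>" "S.triangular (G_le \<Gamma> G) (inv\<^bsub>AutoGroup (raag L)\<^esub> \<theta>)"
    using projects_S0[of h G] B by blast
  have "inv\<^bsub>Out (raag L)\<^esub> projection \<Gamma> v h \<in> generate (Out (raag L)) (projection \<Gamma> v ` B)"
    using inv by (intro generate.inv imageI)
  then have "out_class (raag L) (inv\<^bsub>AutoGroup (raag L)\<^esub> \<theta>) \<in> generate (Out (raag L)) (projection \<Gamma> v ` B)"
    using \<theta>(1) by (simp add: projects_projection S.A.out_class_inv[OF projects_auto])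
  then show ?case using projects_inv[OF \<theta>(1)] \<theta>(2) by blast
next
  case (eng h1 h2)
  then obtain \<theta>1 \<theta>2 where 1: "projects h1 \<theta>1" "S.triangular (G_le \<Gamma> G) \<theta>1"
      "out_class (raag L) \<theta>1 \<in> generate (Out (raag L)) (projection \<Gamma> v ` B)"
    and 2: "projects h2 \<theta>2" "S.triangular (G_le \<Gamma> G) \<theta>2"
      "out_class (raag L) \<theta>2 \<in> generate (Out (raag L)) (projection \<Gamma> v ` B)" by blast
  have "out_class (raag L) (\<theta>1 \<otimes>\<^bsub>AutoGroup (raag L)\<^esub> \<theta>2) \<in> generate (Out (raag L)) (projection \<Gamma> v ` B)"
    using generate.eng[OF 1(3) 2(3)] by (simp add: S.A.out_class_mult[OF projects_auto[OF 1(1)] projects_auto[OF 2(1)]])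
  moreover have "S.triangular (G_le \<Gamma> G) (\<theta>1 \<otimes>\<^bsub>AutoGroup (raag L)\<^esub> \<theta>2)"
    by (rule S.triangular_mult[OF projects_auto[OF 1(1)] projects_auto[OF 2(1)] 1(2) 2(2) G_le_trans[OF G]])
  ultimately show ?case using projects_mult[OF 1(1) 2(1)] by blast
qed

text \<open>Lifts a product of projected generators letter by letter to the same product in the
  source.\<close>

lemma projection_generate_surj:
  assumes G: "subgroup G (Out (raag \<Gamma>))" and B: "B \<subseteq> S0_set \<Gamma>" "B \<subseteq> G"
    and \<Psi>: "\<Psi> \<in> generate (Out (raag L)) (projection \<Gamma> v ` B)"
  shows "\<exists>\<Phi>\<in>generate (Out (raag \<Gamma>)) B. \<exists>\<theta>. projects \<Phi> \<theta> \<and> \<Psi> = out_class (raag L) \<theta>"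
  using \<Psi>
proof (induction rule: generate.induct)
  case one
  show ?case using projects_one generate.one S.A.out_class_one[symmetric] by blast
next
  case (incl h)
  then obtain \<Phi> where \<Phi>: "\<Phi> \<in> B" "h = projection \<Gamma> v \<Phi>" by blast
  then obtain \<theta> where "projects \<Phi> \<theta>" using projects_S0[of \<Phi> G] B by blast
  with \<Phi> projects_projection[of \<Phi> \<theta>] generate.incl[OF \<Phi>(1)] show ?case by blast
next
  case (inv h)
  then obtain \<Phi> where \<Phi>: "\<Phi> \<in> B" "h = projection \<Gamma> v \<Phi>" by blast
  then obtain \<theta> where \<theta>: "projects \<Phi> \<theta>" using projects_S0[of \<Phi> G] B by blast
  have "inv\<^bsub>Out (raag L)\<^esub> h = out_class (raag L) (inv\<^bsub>AutoGroup (raag L)\<^esub> \<theta>)"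
    using \<Phi>(2) projects_projection[OF \<theta>] S.A.out_class_inv[OF projects_auto[OF \<theta>]] by simp
  then show ?case using projects_inv[OF \<theta>] generate.inv[OF \<Phi>(1)] by blast
next
  case (eng h1 h2)
  then obtain \<Phi>1 \<theta>1 \<Phi>2 \<theta>2 where 1: "\<Phi>1 \<in> generate (Out (raag \<Gamma>)) B" "projects \<Phi>1 \<theta>1" "h1 = out_class (raag L) \<theta>1"
    and 2: "\<Phi>2 \<in> generate (Out (raag \<Gamma>)) B" "projects \<Phi>2 \<theta>2" "h2 = out_class (raag L) \<theta>2" by blast
  have "h1 \<otimes>\<^bsub>Out (raag L)\<^esub> h2 = out_class (raag L) (\<theta>1 \<otimes>\<^bsub>AutoGroup (raag L)\<^esub> \<theta>2)"
    using 1 2 by (simp add: S.A.out_class_mult projects_auto)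
  then show ?case using projects_mult[OF 1(2) 2(2)] generate.eng[OF 1(1) 2(1)] by blast
qed

lemma projection_image_generate:
  assumes "subgroup G (Out (raag \<Gamma>))" "B \<subseteq> S0_set \<Gamma>" "B \<subseteq> G"
  shows "projection \<Gamma> v ` generate (Out (raag \<Gamma>)) B = generate (Out (raag L)) (projection \<Gamma> v ` B)"
proof (intro equalityI subsetI)
  fix \<Psi> assume "\<Psi> \<in> projection \<Gamma> v ` generate (Out (raag \<Gamma>)) B"
  then obtain \<Phi> where \<Phi>: "\<Phi> \<in> generate (Out (raag \<Gamma>)) B" "\<Psi> = projection \<Gamma> v \<Phi>" by blast
  then show "\<Psi> \<in> generate (Out (raag L)) (projection \<Gamma> v ` B)"
    using projection_generate[OF assms \<Phi>(1)] projects_projection by auto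
next
  fix \<Psi> assume "\<Psi> \<in> generate (Out (raag L)) (projection \<Gamma> v ` B)"
  then show "\<Psi> \<in> projection \<Gamma> v ` generate (Out (raag \<Gamma>)) B"
    using projection_generate_surj[OF assms] projects_projection by blast
qed

lemma projection_S0_subset_S_set:
  assumes "B \<subseteq> S0_set \<Gamma>"
  shows "projection \<Gamma> v ` B \<subseteq> S_set L"
proof
  fix \<Psi> assume "\<Psi> \<in> projection \<Gamma> v ` B"
  then obtain \<Phi> where \<Phi>: "\<Phi> \<in> B" "\<Psi> = projection \<Gamma> v \<Phi>" by blast
  \<comment> \<open>Only the kind of the image is of interest here, so the shape of the matrices is
    made vacuous by taking the set of all classes for \<open>G\<close>.\<close>
  then show "\<Psi> \<in> S_set L"
    using projects_S0[of \<Phi> UNIV] assms projects_projection \<Phi> by (metis UNIV_I subsetD)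
qed

text \<open>The class of the transvection also has a representative \<theta> of the right shape;
  entry (i, j) is the same for both representatives, and being nonzero it forces the
  relation.\<close>

lemma G_le_projection:
  assumes "subgroup G (Out (raag \<Gamma>))" "B \<subseteq> S0_set \<Gamma>" "B \<subseteq> G"
    and "G_le L (projection \<Gamma> v ` generate (Out (raag \<Gamma>)) B) i j"
  shows "G_le \<Gamma> G i j"
proof (cases "i = j")
  case True
  then show ?thesis by (simp add: G_le_refl)
next
  case False
  then have ij: "transvection_defined L i j"
    and "out_class (raag L) (transvection L i j) \<in> projection \<Gamma> v ` generate (Out (raag \<Gamma>)) B"
    using assms(4) by (auto simp: G_le_def)
  then obtain \<Phi> where \<Phi>: "\<Phi> \<in> generate (Out (raag \<Gamma>)) B"
    "out_class (raag L) (transvection L i j) = projection \<Gamma> v \<Phi>" by blast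
  obtain \<theta> where \<theta>: "projects \<Phi> \<theta>" "S.triangular (G_le \<Gamma> G) \<theta>"
    using projection_generate[OF assms(1-3) \<Phi>(1)] by blast
  have eq: "out_class (raag L) (transvection L i j) = out_class (raag L) \<theta>"
    using \<Phi>(2) projects_projection[OF \<theta>(1)] by simp
  have v: "i \<in> verts L" "j \<in> verts L" using ij by (auto simp: transvection_defined_def)
  \<comment> \<open>Since \<open>i\<close> and \<open>j\<close> differ, the exponent of
    \<open>v_j\<close> in \<open>v_i v_j\<close> is 0 + 1.\<close>
  have "S.exponent j (\<theta> (gen L i)) = S.exponent j (transvection L i j (gen L i))"
    using S.exponent_out_class_eq[OF eq S.transvection_auto[OF ij] projects_auto[OF \<theta>(1)] gen_closed[OF v(1)]] by simp
  also have "\<dots> = 1"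
    using v False by (simp add: S.transvection_gen[OF ij] S.exponent_mult S.exponent_gen gen_closed)
  finally show ?thesis using \<theta>(2) v unfolding S.triangular_def by simp
qed

end

subsection \<open>Abelian classes\<close>

text \<open>Two non-adjacent vertices can be sent to non-commuting transpositions.\<close>

lemma (in raag_graph) gen_commute_imp_adjacent:
  assumes a: "a \<in> verts \<Gamma>" and b: "b \<in> verts \<Gamma>" and "a \<noteq> b"
    and comm: "gen \<Gamma> a \<otimes>\<^bsub>raag \<Gamma>\<^esub> gen \<Gamma> b = gen \<Gamma> b \<otimes>\<^bsub>raag \<Gamma>\<^esub> gen \<Gamma> a"
  shows "b \<in> link \<Gamma> a"
proof (rule ccontr)
  assume nadj: "b \<notin> link \<Gamma> a"
  \<comment> \<open>The transpositions (0 1) and (1 2), taken as permutations of all natural numbers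
    so that \<open>Bij UNIV\<close> asks nothing about extensionality.\<close>
  define s where "s = (\<lambda>x::nat. if x = 0 then 1 else if x = 1 then 0 else x)"
  define t where "t = (\<lambda>x::nat. if x = 1 then 2 else if x = 2 then 1 else x)"
  have "bij_betw s UNIV UNIV" "bij_betw t UNIV UNIV"
    by (rule bij_betw_byWitness[where f' = s], auto simp: s_def)
       (rule bij_betw_byWitness[where f' = t], auto simp: t_def)
  then have Bij: "s \<in> Bij UNIV" "t \<in> Bij UNIV" by (simp_all add: Bij_def)
  let ?S = "BijGroup (UNIV :: nat set)"
  interpret S3: group ?S by (rule group_BijGroup)
  have st: "s \<in> carrier ?S" "t \<in> carrier ?S" using Bij by (simp_all add: BijGroup_def)
  define f where "f = (\<lambda>k. if k = a then s else if k = b then t else \<one>\<^bsub>?S\<^esub>)"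
  have f_closed: "f u \<in> carrier ?S" for u using st by (simp add: f_def)
  have resp: "respects_arcs \<Gamma> ?S f"
  proof (rule respects_arcsI)
    fix u w assume w: "w \<in> link \<Gamma> u"
    have "\<not> (u = a \<and> w = b)" "\<not> (u = b \<and> w = a)" "u \<noteq> w"
      using w nadj link_sym[of b a] link_irrefl by blast+
    then show "f u \<otimes>\<^bsub>?S\<^esub> f w = f w \<otimes>\<^bsub>?S\<^esub> f u" using st by (auto simp: f_def)
  qed (rule f_closed)
  interpret h: group_hom "raag \<Gamma>" ?S "raag_lift ?S f"
    by (simp add: group_hom_def group_hom_axioms_def group_raag S3.is_group S3.raag_lift_hom[OF resp])
  have "s \<otimes>\<^bsub>?S\<^esub> t = t \<otimes>\<^bsub>?S\<^esub> s"
    using arg_cong[OF comm, of "raag_lift ?S f"] a b \<open>a \<noteq> b\<close>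
    by (simp add: gen_closed S3.raag_lift_gen[OF resp]) (simp add: f_def)
  \<comment> \<open>The two products send 0 to 1 and to 2 respectively.\<close>
  then have "(s \<otimes>\<^bsub>?S\<^esub> t) 0 = (t \<otimes>\<^bsub>?S\<^esub> s) 0" by simp
  then show False using Bij by (simp add: BijGroup_def compose_def s_def t_def)
qed

lemma (in raag_graph) abelian_class_imp_adjacent:
  assumes C: "C \<subseteq> verts \<Gamma>" and ab: "abelian_class \<Gamma> C" and a: "a \<in> C" and b: "b \<in> C" and "a \<noteq> b"
  shows "b \<in> link \<Gamma> a"
proof (rule gen_commute_imp_adjacent)
  show "a \<in> verts \<Gamma>" "b \<in> verts \<Gamma>" using a b C by blast+
  obtain B :: "'v set" and h where h: "h \<in> iso (raag_sub \<Gamma> C) (free_Abelian_group B)"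
    using ab unfolding abelian_class_def is_iso_def by blast
  let ?a = "gen \<Gamma> a" and ?b = "gen \<Gamma> b"
  have mem: "?a \<in> carrier (raag_sub \<Gamma> C)" "?b \<in> carrier (raag_sub \<Gamma> C)"
    using gen_in_raag_sub[OF C] a b by blast+
  have mult: "x \<otimes>\<^bsub>raag_sub \<Gamma> C\<^esub> y = x \<otimes>\<^bsub>raag \<Gamma>\<^esub> y" for x y by (simp add: raag_sub_def)
  have hom: "h (x \<otimes>\<^bsub>raag \<Gamma>\<^esub> y) = h x + h y" if "x \<in> carrier (raag_sub \<Gamma> C)" "y \<in> carrier (raag_sub \<Gamma> C)" for x y
    using h that by (simp add: iso_def hom_def mult[symmetric])
  have inj: "inj_on h (carrier (raag_sub \<Gamma> C))" using h by (simp add: iso_def bij_betw_def)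
  have "h (?a \<otimes>\<^bsub>raag \<Gamma>\<^esub> ?b) = h (?b \<otimes>\<^bsub>raag \<Gamma>\<^esub> ?a)"
    using hom mem by (simp add: add.commute)
  then show "?a \<otimes>\<^bsub>raag \<Gamma>\<^esub> ?b = ?b \<otimes>\<^bsub>raag \<Gamma>\<^esub> ?a"
    by (rule inj_onD[OF inj]) (use mem subgroup.m_closed[OF subgroup_raag_sub[OF C]] in blast)+
qed (fact \<open>a \<noteq> b\<close>)

text \<open>Two universal properties give mutually inverse maps: \<open>h\<close> exists because
  \<open>A_C\<close> is commutative and the source is free abelian, and \<open>f\<close> is the
  restriction to \<open>A_C\<close> of a homomorphism defined on all of A_\<Gamma>.\<close>

lemma (in raag_graph) clique_abelian_class:
  assumes C: "C \<subseteq> verts \<Gamma>" and clique: "\<And>a b. a \<in> C \<Longrightarrow> b \<in> C \<Longrightarrow> a \<noteq> b \<Longrightarrow> b \<in> link \<Gamma> a"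
  shows "abelian_class \<Gamma> C"
proof -
  let ?A = "raag_sub \<Gamma> C" and ?F = "free_Abelian_group C"
  have sub: "subgroup (carrier ?A) (raag \<Gamma>)" by (rule subgroup_raag_sub[OF C])
  have carr: "x \<in> carrier (raag \<Gamma>)" if "x \<in> carrier ?A" for x using subgroup.subset[OF sub] that by blast
  have mult: "x \<otimes>\<^bsub>?A\<^esub> y = x \<otimes>\<^bsub>raag \<Gamma>\<^esub> y" and A_one: "\<one>\<^bsub>?A\<^esub> = \<one>\<^bsub>raag \<Gamma>\<^esub>" for x y
    by (simp_all add: raag_sub_def)
  have A_group: "group ?A" unfolding raag_sub_def by (rule A.group_subgroup_generated)
  have gens: "gen \<Gamma> a \<otimes>\<^bsub>raag \<Gamma>\<^esub> gen \<Gamma> b = gen \<Gamma> b \<otimes>\<^bsub>raag \<Gamma>\<^esub> gen \<Gamma> a" if "a \<in> C" "b \<in> C" for a b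
    using gen_commute_star[of a b] clique[OF that] that C by (cases "a = b") (auto simp: star_def)
  have gen_comm: "gen \<Gamma> a \<otimes>\<^bsub>raag \<Gamma>\<^esub> x = x \<otimes>\<^bsub>raag \<Gamma>\<^esub> gen \<Gamma> a" if a: "a \<in> C" and x: "x \<in> carrier ?A" for a x
  proof -
    have ga: "gen \<Gamma> a \<in> carrier (raag \<Gamma>)" using a C by blast
    show ?thesis using x unfolding carrier_raag_sub[OF C]
    proof (induction rule: generate.induct)
      case (inv h)
      then obtain b where "b \<in> C" "h = gen \<Gamma> b" by blast
      then show ?case using A.commute_inv[OF ga _ gens[OF a]] C by blast
    next
      case (eng h1 h2)
      then show ?case using A.commute_mult[OF ga] carr unfolding carrier_raag_sub[OF C] by simp
    qed (use ga gens[OF a] in auto)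
  qed
  have comm: "x \<otimes>\<^bsub>raag \<Gamma>\<^esub> y = y \<otimes>\<^bsub>raag \<Gamma>\<^esub> x" if x: "x \<in> carrier ?A" and y: "y \<in> carrier ?A" for x y
  proof -
    have yc: "y \<in> carrier (raag \<Gamma>)" using carr[OF y] .
    have "y \<otimes>\<^bsub>raag \<Gamma>\<^esub> x = x \<otimes>\<^bsub>raag \<Gamma>\<^esub> y" using x unfolding carrier_raag_sub[OF C]
    proof (induction rule: generate.induct)
      case (incl h)
      then show ?case using gen_comm[OF _ y] by auto
    next
      case (inv h)
      then obtain b where b: "b \<in> C" "h = gen \<Gamma> b" by blast
      have "y \<otimes>\<^bsub>raag \<Gamma>\<^esub> h = h \<otimes>\<^bsub>raag \<Gamma>\<^esub> y" using gen_comm[OF b(1) y] b(2) by simp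
      moreover have "h \<in> carrier (raag \<Gamma>)" using b C by blast
      ultimately show ?case using A.commute_inv[OF yc] by blast
    next
      case (eng h1 h2)
      then show ?case using A.commute_mult[OF yc] carr unfolding carrier_raag_sub[OF C] by simp
    qed (use yc in simp)
    then show ?thesis by simp
  qed
  interpret CA: comm_group ?A
    by (rule group.group_comm_groupI[OF A_group]) (use comm mult in simp)
  have "gen \<Gamma> ` C \<subseteq> carrier ?A" using gen_in_raag_sub[OF C] by blast
  then obtain h where h: "h \<in> hom ?F ?A" "\<And>x. x \<in> C \<Longrightarrow> h (frag_of x) = gen \<Gamma> x"
    using CA.free_Abelian_group_universal[of "gen \<Gamma>" C] by blast
  interpret h: group_hom ?F ?A h
    by (simp add: group_hom_def group_hom_axioms_def A_group h(1))
  \<comment> \<open>Vertices outside \<open>C\<close> are sent to 0; in an abelian target the arcs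
    impose no condition.\<close>
  have resp: "respects_arcs \<Gamma> ?F (\<lambda>k. if k \<in> C then frag_of k else 0)"
    by (rule respects_arcsI) (simp_all add: add.commute)
  define f where "f = raag_lift ?F (\<lambda>k. if k \<in> C then frag_of k else 0)"
  interpret f: group_hom "raag \<Gamma>" ?F f
    unfolding f_def by (simp add: group_hom_def group_hom_axioms_def group_raag group.raag_lift_hom[OF group_free_Abelian_group resp])
  have f_gen: "f (gen \<Gamma> k) = frag_of k" if "k \<in> C" for k
    using that C group.raag_lift_gen[OF group_free_Abelian_group resp, of k] by (auto simp: f_def)
  have hf: "h (f x) = x" if "x \<in> carrier ?A" for x
    using that unfolding carrier_raag_sub[OF C]
  proof (induction rule: generate.induct)
    case one
    then show ?case using h.hom_one f.hom_one A_one by simp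
  next
    case (incl x)
    then show ?case using f_gen h(2) by auto
  next
    case (inv x)
    then obtain k where k: "k \<in> C" "x = gen \<Gamma> k" by blast
    have xA: "x \<in> carrier ?A" using gen_in_raag_sub[OF C k(1)] k(2) by simp
    have "f (inv\<^bsub>raag \<Gamma>\<^esub> x) = inv\<^bsub>?F\<^esub> f x" by (rule f.hom_inv[OF carr[OF xA]])
    moreover have "h (inv\<^bsub>?F\<^esub> f x) = inv\<^bsub>?A\<^esub> h (f x)" by (rule h.hom_inv[OF f.hom_closed[OF carr[OF xA]]])
    moreover have "h (f x) = x" using f_gen[OF k(1)] h(2)[OF k(1)] k(2) by simp
    moreover have "inv\<^bsub>?A\<^esub> x = inv\<^bsub>raag \<Gamma>\<^esub> x"
      using xA unfolding raag_sub_def by (rule A.inv_subgroup_generated)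
    ultimately show ?case by simp
  next
    case (eng x y)
    have xy: "x \<in> carrier ?A" "y \<in> carrier ?A" using eng by (simp_all add: carrier_raag_sub[OF C])
    have "f (x \<otimes>\<^bsub>raag \<Gamma>\<^esub> y) = f x \<otimes>\<^bsub>?F\<^esub> f y" by (rule f.hom_mult[OF carr[OF xy(1)] carr[OF xy(2)]])
    moreover have "h (f x \<otimes>\<^bsub>?F\<^esub> f y) = h (f x) \<otimes>\<^bsub>?A\<^esub> h (f y)"
      by (rule h.hom_mult[OF f.hom_closed[OF carr[OF xy(1)]] f.hom_closed[OF carr[OF xy(2)]]])
    ultimately show ?case using eng.IH mult by simp
  qed
  have fh: "f (h z) = z" if "z \<in> carrier ?F" for z
  proof -
    have "Poly_Mapping.keys z \<subseteq> C" using that by simp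
    then show ?thesis
    proof (rule free_Abelian_group_induct)
      show "f (h 0) = 0" using h.hom_one f.hom_one A_one by simp
    next
      fix x y assume keys: "Poly_Mapping.keys x \<subseteq> C" "Poly_Mapping.keys y \<subseteq> C"
        and eq: "f (h x) = x" "f (h y) = y"
      have c: "h x \<in> carrier ?A" "h y \<in> carrier ?A" using h.hom_closed[of x] h.hom_closed[of y] keys by simp_all
      have "h (x - y) = h x \<otimes>\<^bsub>?A\<^esub> inv\<^bsub>?A\<^esub> h y"
        using h.hom_mult[of x "- y"] h.hom_inv[of y] keys by simp
      moreover have "inv\<^bsub>?A\<^esub> h y = inv\<^bsub>raag \<Gamma>\<^esub> h y"
        using c(2) unfolding raag_sub_def by (rule A.inv_subgroup_generated)
      moreover have "f (h x \<otimes>\<^bsub>raag \<Gamma>\<^esub> inv\<^bsub>raag \<Gamma>\<^esub> h y) = f (h x) - f (h y)"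
        using carr[OF c(1)] carr[OF c(2)] keys eq by simp
      ultimately show "f (h (x - y)) = x - y" using eq mult by simp
    next
      fix a assume "a \<in> C"
      then show "f (h (frag_of a)) = frag_of a" using f_gen h(2) by simp
    qed
  qed
  have "bij_betw f (carrier ?A) (carrier ?F)"
  proof (rule bij_betw_byWitness[where f' = h])
    show "f ` carrier ?A \<subseteq> carrier ?F" using f.hom_closed carr by blast
    show "h ` carrier ?F \<subseteq> carrier ?A" using h.hom_closed by blast
  qed (use hf fh in blast)+
  moreover have "f \<in> hom ?A ?F"
    by (rule homI) (use f.hom_closed f.hom_mult carr mult in simp_all)
  ultimately have "f \<in> iso ?A ?F" by (simp add: iso_def)
  then show ?thesis unfolding abelian_class_def is_iso_def by blast
qed

section \<open>Classes of the preorder and bounds for \<open>d_SL\<close>\<close>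

context raag_graph
begin

lemma G_class_subset: "G_class \<Gamma> G w \<subseteq> verts \<Gamma>"
  by (auto simp: G_class_def)

lemma G_class_self: "w \<in> verts \<Gamma> \<Longrightarrow> w \<in> G_class \<Gamma> G w"
  by (simp add: G_class_def G_le_refl)

lemma G_class_std_le:
  assumes "c \<in> G_class \<Gamma> G w" "d \<in> G_class \<Gamma> G w"
  shows "std_le \<Gamma> c d"
proof (rule std_le_trans)
  show "std_le \<Gamma> c w" "std_le \<Gamma> w d" using assms by (auto simp: G_class_def intro: G_le_std_le)
qed

lemma card_le_d_SL:
  assumes "w \<in> verts \<Gamma>" "abelian_class \<Gamma> (G_class \<Gamma> G w)"
  shows "card (G_class \<Gamma> G w) \<le> d_SL \<Gamma> G"
proof -
  let ?\<C> = "{C \<in> G_class \<Gamma> G ` verts \<Gamma>. abelian_class \<Gamma> C}"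
  have mem: "G_class \<Gamma> G w \<in> ?\<C>" using assms by blast
  then have "?\<C> \<noteq> {}" by blast
  then have "d_SL \<Gamma> G = Max (card ` ?\<C>)" unfolding d_SL_def Let_def by (rule if_not_P)
  moreover have "card (G_class \<Gamma> G w) \<le> Max (card ` ?\<C>)"
    using mem by (intro Max_ge finite_imageI imageI) simp_all
  ultimately show ?thesis by simp
qed

text \<open>Every class contains the vertex that names it, and the default value without abelian
  classes is 1.\<close>

lemma one_le_d_SL: "1 \<le> d_SL \<Gamma> G"
proof (cases "{C \<in> G_class \<Gamma> G ` verts \<Gamma>. abelian_class \<Gamma> C} = {}")
  case True
  then show ?thesis by (simp add: d_SL_def)
next
  case False
  then obtain w where w: "w \<in> verts \<Gamma>" "abelian_class \<Gamma> (G_class \<Gamma> G w)" by blast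
  have "finite (G_class \<Gamma> G w)" using G_class_subset finite_verts finite_subset by blast
  then have "1 \<le> card (G_class \<Gamma> G w)" using G_class_self[OF w(1)] by (auto simp: Suc_le_eq card_gt_0_iff)
  then show ?thesis using card_le_d_SL[OF w] by simp
qed

lemma d_SL_leI:
  assumes "1 \<le> m" "\<And>w. w \<in> verts \<Gamma> \<Longrightarrow> abelian_class \<Gamma> (G_class \<Gamma> G w) \<Longrightarrow> card (G_class \<Gamma> G w) \<le> m"
  shows "d_SL \<Gamma> G \<le> m"
proof (cases "{C \<in> G_class \<Gamma> G ` verts \<Gamma>. abelian_class \<Gamma> C} = {}")
  case True
  then show ?thesis using assms(1) by (simp add: d_SL_def)
next
  case False
  then show ?thesis using assms(2) unfolding d_SL_def Let_def if_not_P[OF False]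
    by (intro Max.boundedI) auto
qed

text \<open>One edge spreads over the class, since links of members lie in stars of members:
  \<open>b\<close> \<in> lk(a) \<subseteq> st(c) makes \<open>c\<close> equal or adjacent to
  \<open>b\<close>, then \<open>c\<close> \<in> lk(b) \<subseteq> st(a) joins \<open>c\<close> to
  \<open>a\<close>, and finally \<open>d\<close> \<in> lk(a) \<subseteq> st(c) joins
  \<open>d\<close> to \<open>c\<close>.\<close>

lemma G_class_abelian:
  assumes ab: "a \<in> G_class \<Gamma> G w" "b \<in> G_class \<Gamma> G w" "b \<in> link \<Gamma> a"
  shows "abelian_class \<Gamma> (G_class \<Gamma> G w)"
proof (rule clique_abelian_class[OF G_class_subset])
  have a: "c \<in> link \<Gamma> a" if c: "c \<in> G_class \<Gamma> G w" and "c \<noteq> a" for c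
  proof (cases "c = b")
    case False
    have "b \<in> star \<Gamma> c" using G_class_std_le[OF ab(1) c] ab(3) unfolding std_le_def by blast
    then have "c \<in> link \<Gamma> b" using False link_sym by (auto simp: star_def)
    then have "c \<in> star \<Gamma> a" using G_class_std_le[OF ab(2) ab(1)] unfolding std_le_def by blast
    then show ?thesis using \<open>c \<noteq> a\<close> by (simp add: star_def)
  qed (use ab(3) in simp)
  fix c d assume c: "c \<in> G_class \<Gamma> G w" and d: "d \<in> G_class \<Gamma> G w" and "c \<noteq> d"
  show "d \<in> link \<Gamma> c"
  proof (cases "d = a")
    case True
    then show ?thesis using a[OF c] \<open>c \<noteq> d\<close> link_sym by blast
  next
    case False
    then have "d \<in> star \<Gamma> c" using G_class_std_le[OF ab(1) c] a[OF d] unfolding std_le_def by blast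
    then show ?thesis using \<open>c \<noteq> d\<close> by (simp add: star_def)
  qed
qed

end

text \<open>An abelian class with two vertices contains an edge, which makes the surrounding class
  of \<open>G\<close> abelian and hence counted in \<open>d_SL \<Gamma> G\<close>. A class with one
  vertex is bounded by 1, whatever the surrounding class is.\<close>

lemma (in raag_projection) d_SL_projection:
  assumes G: "subgroup G (Out (raag \<Gamma>))" "B \<subseteq> S0_set \<Gamma>" "B \<subseteq> G"
  shows "d_SL L (projection \<Gamma> v ` generate (Out (raag \<Gamma>)) B) \<le> d_SL \<Gamma> G"
proof (rule S.d_SL_leI[OF one_le_d_SL])
  let ?P = "projection \<Gamma> v ` generate (Out (raag \<Gamma>)) B"
  fix w assume w: "w \<in> verts L" and ab: "abelian_class L (G_class L ?P w)"
  have wv: "w \<in> verts \<Gamma>" using w S_verts by auto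
  have sub: "G_class L ?P w \<subseteq> G_class \<Gamma> G w"
    using G_le_projection[OF G] S_verts unfolding G_class_def by auto
  have fin: "finite (G_class \<Gamma> G w)" using G_class_subset finite_verts finite_subset by blast
  show "card (G_class L ?P w) \<le> d_SL \<Gamma> G"
  proof (cases "\<exists>a b. a \<in> G_class L ?P w \<and> b \<in> G_class L ?P w \<and> a \<noteq> b")
    case True
    then obtain a b where ab': "a \<in> G_class L ?P w" "b \<in> G_class L ?P w" "a \<noteq> b" by blast
    have "b \<in> link L a" by (rule S.abelian_class_imp_adjacent[OF S.G_class_subset ab ab'])
    moreover have "a \<in> K" using ab'(1) S.G_class_subset by auto
    ultimately have "b \<in> link \<Gamma> a" by (simp add: link_induce)
    then have "abelian_class \<Gamma> (G_class \<Gamma> G w)" using G_class_abelian sub ab' by blast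
    then have "card (G_class \<Gamma> G w) \<le> d_SL \<Gamma> G" by (rule card_le_d_SL[OF wv])
    then show ?thesis using card_mono[OF fin sub] by simp
  next
    case False
    then have "card (G_class L ?P w) \<le> 1"
      using card_le_Suc0_iff_eq[OF finite_subset[OF sub fin]] by simp
    then show ?thesis using one_le_d_SL[of G] by simp
  qed
qed

theorem proposition5p6:
  fixes \<Gamma> :: "('v, 'e) pre_digraph" and v :: 'v
  assumes "graph \<Gamma>" and "Digraph_Component.connected \<Gamma>"
    and "maximal_vertex \<Gamma> v"
    and "subgroup G (Out (raag \<Gamma>))"
    and "T = G \<inter> S_set \<Gamma>"
    and "G = generate (Out (raag \<Gamma>)) T"
    and "G0 = generate (Out (raag \<Gamma>)) (T \<inter> S0_set \<Gamma>)"
    and "L = \<Gamma> \<restriction> link_set \<Gamma> (std_class \<Gamma> v)"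
  shows "(\<exists>T'\<subseteq>S_set L. projection \<Gamma> v ` G0 = generate (Out (raag L)) T')
    \<and> d_SL L (projection \<Gamma> v ` G0) \<le> d_SL \<Gamma> G
    \<and> d_SL \<Gamma> G = d_SL \<Gamma> G0"
proof -
  interpret graph \<Gamma> by (rule assms(1))
  interpret raag_projection \<Gamma> v by unfold_locales (rule assms(3))
  let ?B = "T \<inter> S0_set \<Gamma>"
  have B: "?B \<subseteq> S0_set \<Gamma>" "?B \<subseteq> G" using assms(5) by blast+
  \<comment> \<open>The image of \<open>?B\<close> is the witness for the generating subset of
    \<open>S_set L\<close>.\<close>
  have 1: "projection \<Gamma> v ` G0 = generate (Out (raag L)) (projection \<Gamma> v ` ?B)"
    unfolding assms(7,8) by (rule projection_image_generate[OF assms(4) B])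
  have 2: "projection \<Gamma> v ` ?B \<subseteq> S_set L"
    unfolding assms(8) by (rule projection_S0_subset_S_set[OF B(1)])
  have 3: "d_SL L (projection \<Gamma> v ` G0) \<le> d_SL \<Gamma> G"
    unfolding assms(7,8) by (rule d_SL_projection[OF assms(4) B])
  have G0: "G0 \<subseteq> G"
    unfolding assms(7) by (rule group.generate_subgroup_incl[OF A.group_Out B(2) assms(4)])
  \<comment> \<open>The preorder sees a subgroup only through the transvection classes it contains,
    and those of \<open>G\<close> all lie in \<open>?B\<close>, hence in \<open>G0\<close>.\<close>
  have "G_le \<Gamma> G i j \<longleftrightarrow> G_le \<Gamma> G0 i j" for i j
  proof
    assume le: "G_le \<Gamma> G i j"
    show "G_le \<Gamma> G0 i j"
    proof (cases "i = j")
      case False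
      then have ij: "transvection_defined \<Gamma> i j" "out_class (raag \<Gamma>) (transvection \<Gamma> i j) \<in> G"
        using le by (auto simp: G_le_def)
      then have "out_class (raag \<Gamma>) (transvection \<Gamma> i j) \<in> ?B"
        unfolding assms(5) S_set_def S0_set_def transvections_def by blast
      then show ?thesis using ij(1) unfolding assms(7) G_le_def by (blast intro: generate.incl)
    qed (simp add: G_le_refl)
  next
    assume "G_le \<Gamma> G0 i j"
    then show "G_le \<Gamma> G i j" using G0 unfolding G_le_def by blast
  qed
  then have "G_class \<Gamma> G = G_class \<Gamma> G0" by (intro ext) (simp add: G_class_def)
  then have "d_SL \<Gamma> G = d_SL \<Gamma> G0" by (simp add: d_SL_def)
  with 1 2 3 show ?thesis by blast
qed

end
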